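(* Let $\mathcal{X}$ be a permanental point process on $\Lambda$ (with reference measure $\mu$) whose kernel $K$ defines a self-adjoint, non-negative, trace-class integral operator on $L^2(\Lambda,\mu)$. Let $D_1,\dots,D_r\subset\Lambda$ be mutually disjoint Borel sets that are simultaneously observable, let $\phi_k$ be the common eigenfunctions of $K$ on the $D_i$'s, and let $\lambda_{k,i}$ be the corresponding eigenvalue of $\phi_k$ on $D_i$. Then $$(\mathcal{X}(D_1),\dots,\mathcal{X}(D_r))\stackrel{d}{=}\sum_k(\eta_{k,1},\dots,\eta_{k,r}),$$ where the vectors $(\eta_{k,1},\dots,\eta_{k,r})$ are independent for different values of $k$; for each $k$, the sum $\eta_k=\sum_{i}\eta_{k,i}$ has a geometric distribution with mean $\lambda_k:=\sum_i\lambda_{k,i}$; and, given $\sum_i\eta_{k,i}=N$, $$(\eta_{k,1},\dots,\eta_{k,r})\stackrel{d}{=}\mathrm{Multinomial}\Big(N;\frac{\lambda_{k,1}}{\lambda_k},\dots,\frac{\lambda_{k,r}}{\lambda_k}\Big).$$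
   Context: $\Lambda$ is a locally compact Polish space with a Radon (reference) measure $\mu$. A point process on $\Lambda$ is a random integer-valued positive Radon measure $\mathcal{X}$ on $\Lambda$ (multiple points allowed). Its joint intensities with respect to $\mu$ are functions $\rho_k:\Lambda^k\to[0,\infty)$, $k\ge1$, such that for mutually disjoint Borel sets $B_1,\dots,B_s$ and $k=\sum_i k_i$ (integers $k_i\ge1$), $\mathbf{E}\big[\prod_{i=1}^s\binom{\mathcal{X}(B_i)}{k_i}k_i!\big]=\int_{\prod_i B_i^{k_i}}\rho_k\,d\mu^{k}$. With $\operatorname{per}(M)=\sum_{\pi\in S_m}\prod_{i=1}^m M_{i,\pi(i)}$, a point process is permanental with kernel $K$ if $\rho_k(x_1,\dots,x_k)=\operatorname{per}(K(x_i,x_j))_{1\le i,j\le k}$ for every $k\ge1$. Kernels are interpreted pointwise, $\mu$-almost everywhere in each variable, through their eigenfunction expansion. For a Borel set $A\subset\Lambda$, $K|_{A\times A}$ acts on $L^2(A,\mu)$ by $f\mapsto\int_A K(\cdot,y)f(y)\,d\mu(y)$. Simultaneously observable: the mutually disjoint sets $D_1,\dots,D_r$, with $D=\bigcup_iD_i$, are simultaneously observable (for $K$) if there is an orthonormal family $(\phi_k)$ in $L^2(D,\mu)$ of eigenfunctions of $K|_{D\times D}$, accounting for all its nonzero eigenvalues with multiplicity and indexed so that each $\phi_k$ has nonzero eigenvalue, such that for every $i$ the restrictions $\phi_k|_{D_i}$ are pairwise orthogonal in $L^2(D_i,\mu)$ and each of them is either zero or an eigenfunction of $K|_{D_i\times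 D_i}$. These $\phi_k$ are the common eigenfunctions, and $\lambda_{k,i}$ is the eigenvalue of $K|_{D_i\times D_i}$ for $\phi_k|_{D_i}$ (with $\lambda_{k,i}=0$ if $\phi_k|_{D_i}=0$). The geometric distribution with mean $\lambda$ is the law on $\{0,1,2,\dots\}$ with $\mathbf{P}(\eta=s)=\big(\frac{\lambda}{\lambda+1}\big)^s\frac{1}{\lambda+1}$. *)

theory Defs
  imports "HOL-Probability.Probability"
begin

definition radon_measure :: "'a::polish_space measure \<Rightarrow> bool" where
  "radon_measure M \<longleftrightarrow>
     sets M = sets borel \<and>
     (\<forall>C. compact C \<longrightarrow> emeasure M C < \<top>) \<and>
     (\<forall>B\<in>sets borel. emeasure M B = (SUP C\<in>{C. compact C \<and> C \<subseteq> B}. emeasure M C))"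

definition point_process :: "'w measure \<Rightarrow> ('w \<Rightarrow> 'a::polish_space measure) \<Rightarrow> bool" where
  "point_process P X \<longleftrightarrow>
     prob_space P \<and>
     (\<forall>\<omega>\<in>space P. radon_measure (X \<omega>) \<and>
        (\<forall>B\<in>sets borel. \<exists>n. emeasure (X \<omega>) B = ennreal_of_enat n)) \<and>
     (\<forall>B\<in>sets borel. (\<lambda>\<omega>. emeasure (X \<omega>) B) \<in> borel_measurable P)"

text \<open>Counts may be infinite, so the binomial coefficient is extended by \<open>\<infinity>\<close> at \<open>\<infinity>\<close>, which is
  the right value for a positive lower argument (the only case used).\<close>

definition ext_binomial :: "ennreal \<Rightarrow> nat \<Rightarrow> ennreal" where
  "ext_binomial x k = (if x = \<top> then \<top> else of_nat (nat \<lfloor>enn2real x\<rfloor> choose k))"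

lemma ext_binomial_of_nat: "ext_binomial (of_nat n) k = of_nat (n choose k)"
  by (simp add: ext_binomial_def flip: ennreal_of_nat_eq_real_of_nat)

text \<open>The product of the \<open>B i ^ k i\<close> for \<open>i < s\<close>, with the coordinates \<open>0, \<dots>, (\<Sum>l<s. k l) - 1\<close> cut
  into consecutive blocks of lengths \<open>k 0, \<dots>, k (s - 1)\<close>.\<close>

definition block_product :: "nat \<Rightarrow> (nat \<Rightarrow> 'a set) \<Rightarrow> (nat \<Rightarrow> nat) \<Rightarrow> (nat \<Rightarrow> 'a) set" where
  "block_product s B k = {x. \<forall>i<s. \<forall>j<k i. x ((\<Sum>l<i. k l) + j) \<in> B i}"

definition joint_intensities ::
  "'w measure \<Rightarrow> 'a::polish_space measure \<Rightarrow> ('w \<Rightarrow> 'a measure) \<Rightarrow>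
     (nat \<Rightarrow> (nat \<Rightarrow> 'a) \<Rightarrow> real) \<Rightarrow> bool" where
  "joint_intensities P \<mu> X \<rho> \<longleftrightarrow>
     (\<forall>m\<ge>1. \<rho> m \<in> borel_measurable (PiM {..<m} (\<lambda>_. \<mu>)) \<and>
        (\<forall>x\<in>space (PiM {..<m} (\<lambda>_. \<mu>)). 0 \<le> \<rho> m x)) \<and>
     (\<forall>s\<ge>1. \<forall>B k. (\<forall>i<s. B i \<in> sets borel \<and> k i \<ge> 1) \<longrightarrow> disjoint_family_on B {..<s} \<longrightarrow>
        (\<integral>\<^sup>+\<omega>. (\<Prod>i<s. ext_binomial (emeasure (X \<omega>) (B i)) (k i) * of_nat (fact (k i))) \<partial>P) =
        (\<integral>\<^sup>+x\<in>block_product s B k. ennreal (\<rho> (\<Sum>i<s. k i) x)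
            \<partial>PiM {..<(\<Sum>i<s. k i)} (\<lambda>_. \<mu>)))"

definition per :: "nat \<Rightarrow> (nat \<Rightarrow> nat \<Rightarrow> 'b::comm_ring_1) \<Rightarrow> 'b" where
  "per m M = (\<Sum>\<pi> | \<pi> permutes {..<m}. \<Prod>i<m. M i (\<pi> i))"

text \<open>Joint intensities and kernels are only determined almost everywhere, so the two are compared
  almost everywhere on \<open>\<Lambda>\<^sup>m\<close>.\<close>

definition permanental ::
  "'w measure \<Rightarrow> 'a::polish_space measure \<Rightarrow> ('w \<Rightarrow> 'a measure) \<Rightarrow> ('a \<Rightarrow> 'a \<Rightarrow> complex) \<Rightarrow> bool" where
  "permanental P \<mu> X K \<longleftrightarrow>
     (\<exists>\<rho>. joint_intensities P \<mu> X \<rho> \<and>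
        (\<forall>m\<ge>1. AE x in PiM {..<m} (\<lambda>_. \<mu>).
           complex_of_real (\<rho> m x) = per m (\<lambda>i j. K (x i) (x j))))"

text \<open>Elements of \<open>L\<^sup>2(A, \<mu>)\<close> are represented by functions on the whole space whose values outside \<open>A\<close>
  are irrelevant; equality in \<open>L\<^sup>2(A, \<mu>)\<close> is equality almost everywhere on \<open>A\<close>.\<close>

definition L2 :: "'a measure \<Rightarrow> 'a set \<Rightarrow> ('a \<Rightarrow> complex) \<Rightarrow> bool" where
  "L2 \<mu> A f \<longleftrightarrow> set_borel_measurable \<mu> A f \<and> set_integrable \<mu> A (\<lambda>x. (cmod (f x))\<^sup>2)"

definition L2_inner :: "'a measure \<Rightarrow> 'a set \<Rightarrow> ('a \<Rightarrow> complex) \<Rightarrow> ('a \<Rightarrow> complex) \<Rightarrow> complex" where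
  "L2_inner \<mu> A f g = (LINT x:A|\<mu>. f x * cnj (g x))"

definition L2_orthonormal :: "'a measure \<Rightarrow> 'a set \<Rightarrow> nat set \<Rightarrow> (nat \<Rightarrow> 'a \<Rightarrow> complex) \<Rightarrow> bool" where
  "L2_orthonormal \<mu> A I e \<longleftrightarrow>
     (\<forall>k\<in>I. L2 \<mu> A (e k)) \<and>
     (\<forall>k\<in>I. \<forall>l\<in>I. L2_inner \<mu> A (e k) (e l) = (if k = l then 1 else 0))"

definition L2_orthonormal_basis ::
  "'a measure \<Rightarrow> 'a set \<Rightarrow> nat set \<Rightarrow> (nat \<Rightarrow> 'a \<Rightarrow> complex) \<Rightarrow> bool" where
  "L2_orthonormal_basis \<mu> A I e \<longleftrightarrow>
     L2_orthonormal \<mu> A I e \<and>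
     (\<forall>f. L2 \<mu> A f \<longrightarrow> (\<forall>k\<in>I. L2_inner \<mu> A f (e k) = 0) \<longrightarrow> (AE x in \<mu>. x \<in> A \<longrightarrow> f x = 0))"

text \<open>The action of the restriction of \<open>K\<close> to \<open>A \<times> A\<close>; the result matters on \<open>A\<close> only.\<close>

definition kernel_op ::
  "'a measure \<Rightarrow> 'a set \<Rightarrow> ('a \<Rightarrow> 'a \<Rightarrow> complex) \<Rightarrow> ('a \<Rightarrow> complex) \<Rightarrow> 'a \<Rightarrow> complex" where
  "kernel_op \<mu> A K f x = (LINT y:A|\<mu>. K x y * f y)"

definition bounded_kernel :: "'a measure \<Rightarrow> ('a \<Rightarrow> 'a \<Rightarrow> complex) \<Rightarrow> bool" where
  "bounded_kernel \<mu> K \<longleftrightarrow>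
     (\<lambda>(x, y). K x y) \<in> borel_measurable (\<mu> \<Otimes>\<^sub>M \<mu>) \<and>
     (\<forall>f. L2 \<mu> UNIV f \<longrightarrow>
        (AE x in \<mu>. integrable \<mu> (\<lambda>y. K x y * f y)) \<and> L2 \<mu> UNIV (kernel_op \<mu> UNIV K f)) \<and>
     (\<exists>C. \<forall>f. L2 \<mu> UNIV f \<longrightarrow>
        (LINT x|\<mu>. (cmod (kernel_op \<mu> UNIV K f x))\<^sup>2) \<le> C * (LINT x|\<mu>. (cmod (f x))\<^sup>2))"

definition selfadjoint_kernel :: "'a measure \<Rightarrow> ('a \<Rightarrow> 'a \<Rightarrow> complex) \<Rightarrow> bool" where
  "selfadjoint_kernel \<mu> K \<longleftrightarrow>
     (\<forall>f g. L2 \<mu> UNIV f \<longrightarrow> L2 \<mu> UNIV g \<longrightarrow>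
        L2_inner \<mu> UNIV (kernel_op \<mu> UNIV K f) g = L2_inner \<mu> UNIV f (kernel_op \<mu> UNIV K g))"

definition nonneg_kernel :: "'a measure \<Rightarrow> ('a \<Rightarrow> 'a \<Rightarrow> complex) \<Rightarrow> bool" where
  "nonneg_kernel \<mu> K \<longleftrightarrow>
     (\<forall>f. L2 \<mu> UNIV f \<longrightarrow> L2_inner \<mu> UNIV (kernel_op \<mu> UNIV K f) f \<in> \<real>\<^sub>\<ge>\<^sub>0)"

text \<open>Trace class, for a non-negative operator \<open>T\<close>: as \<open>|T| = T\<close>, the requirement is that
  \<open>\<Sum> \<langle>T e\<^sub>j, e\<^sub>j\<rangle>\<close> converges for some (equivalently, every) orthonormal basis.\<close>

definition trace_class_nonneg_kernel :: "'a measure \<Rightarrow> ('a \<Rightarrow> 'a \<Rightarrow> complex) \<Rightarrow> bool" where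
  "trace_class_nonneg_kernel \<mu> K \<longleftrightarrow>
     (\<exists>J e. L2_orthonormal_basis \<mu> UNIV J e \<and>
        (\<lambda>j. L2_inner \<mu> UNIV (kernel_op \<mu> UNIV K (e j)) (e j)) summable_on J)"

definition eigenfunction ::
  "'a measure \<Rightarrow> 'a set \<Rightarrow> ('a \<Rightarrow> 'a \<Rightarrow> complex) \<Rightarrow> complex \<Rightarrow> ('a \<Rightarrow> complex) \<Rightarrow> bool" where
  "eigenfunction \<mu> A K c f \<longleftrightarrow>
     L2 \<mu> A f \<and> \<not> (AE x in \<mu>. x \<in> A \<longrightarrow> f x = 0) \<and>
     (AE x in \<mu>. x \<in> A \<longrightarrow> kernel_op \<mu> A K f x = c * f x)"

text \<open>An orthonormal family of eigenfunctions that accounts for all nonzero eigenvalues with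
  multiplicity: for \<open>c \<noteq> 0\<close>, the members with eigenvalue \<open>c\<close> span the eigenspace of \<open>c\<close>. Finite
  linear combinations suffice because such eigenspaces are finite-dimensional for a compact
  operator.\<close>

definition nonzero_eigensystem ::
  "'a measure \<Rightarrow> 'a set \<Rightarrow> ('a \<Rightarrow> 'a \<Rightarrow> complex) \<Rightarrow> nat set \<Rightarrow> (nat \<Rightarrow> 'a \<Rightarrow> complex) \<Rightarrow>
     (nat \<Rightarrow> complex) \<Rightarrow> bool" where
  "nonzero_eigensystem \<mu> A K I \<phi> \<alpha> \<longleftrightarrow>
     L2_orthonormal \<mu> A I \<phi> \<and>
     (\<forall>k\<in>I. \<alpha> k \<noteq> 0 \<and> eigenfunction \<mu> A K (\<alpha> k) (\<phi> k)) \<and>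
     (\<forall>c f. c \<noteq> 0 \<longrightarrow> eigenfunction \<mu> A K c f \<longrightarrow>
        (\<exists>F b. finite F \<and> F \<subseteq> {k\<in>I. \<alpha> k = c} \<and>
           (AE x in \<mu>. x \<in> A \<longrightarrow> f x = (\<Sum>k\<in>F. b k * \<phi> k x))))"

text \<open>The operator determines its kernel only up to null sets of the product, whereas \<open>per\<close> involves
  the diagonal. The kernel is therefore pinned down by its eigenfunction expansion, which converges
  (absolutely) at all pairs of points outside a null set of the base space.\<close>

definition kernel_expansion :: "'a measure \<Rightarrow> ('a \<Rightarrow> 'a \<Rightarrow> complex) \<Rightarrow> bool" where
  "kernel_expansion \<mu> K \<longleftrightarrow>
     (\<exists>J \<psi> \<alpha>. nonzero_eigensystem \<mu> UNIV K J \<psi> \<alpha> \<and>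
        (\<exists>N\<in>null_sets \<mu>. \<forall>x\<in>-N. \<forall>y\<in>-N.
           ((\<lambda>j. \<alpha> j * \<psi> j x * cnj (\<psi> j y)) has_sum K x y) J))"

definition simultaneously_observable ::
  "'a measure \<Rightarrow> ('a \<Rightarrow> 'a \<Rightarrow> complex) \<Rightarrow> nat \<Rightarrow> (nat \<Rightarrow> 'a set) \<Rightarrow>
     nat set \<Rightarrow> (nat \<Rightarrow> 'a \<Rightarrow> complex) \<Rightarrow> (nat \<Rightarrow> nat \<Rightarrow> real) \<Rightarrow> bool" where
  "simultaneously_observable \<mu> K r D I \<phi> lam \<longleftrightarrow>
     (\<exists>\<alpha>. nonzero_eigensystem \<mu> (\<Union>i\<in>{1..r}. D i) K I \<phi> \<alpha>) \<and>
     (\<forall>i\<in>{1..r}. \<forall>k\<in>I. \<forall>l\<in>I. k \<noteq> l \<longrightarrow> L2_inner \<mu> (D i) (\<phi> k) (\<phi> l) = 0) \<and>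
     (\<forall>i\<in>{1..r}. \<forall>k\<in>I.
        (AE x in \<mu>. x \<in> D i \<longrightarrow> \<phi> k x = 0) \<and> lam k i = 0 \<or>
        eigenfunction \<mu> (D i) K (complex_of_real (lam k i)) (\<phi> k))"

definition multinomial_prob :: "nat \<Rightarrow> nat \<Rightarrow> (nat \<Rightarrow> real) \<Rightarrow> (nat \<Rightarrow> nat) \<Rightarrow> real" where
  "multinomial_prob r N p n =
     (if (\<Sum>i=1..r. n i) = N
      then fact N / (\<Prod>i=1..r. fact (n i)) * (\<Prod>i=1..r. p i ^ n i) else 0)"

end

theory Submission
  imports Defs "HOL-Complex_Analysis.Complex_Analysis" "HOL-Real_Asymp.Real_Asymp"
begin

text \<open>
  Both sides of the claimed identity are vectors of counts, and such a vector is determined in law by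
  its mixed factorial moments as soon as the moments of total order \<open>n\<close> are at most \<open>L ^ n * n!\<close>
  (\<open>mixed_factorial_moments_determine\<close>): the moments are the Taylor coefficients at \<open>1\<close> of a probability
  generating function that is analytic on a disc of radius greater than \<open>1\<close>. So it suffices to compute
  the moments. A moment of order \<open>n\<close> is described by a colouring \<open>c\<close> of \<open>n\<close> slots by the indices of the
  sets, and the value found on both sides is
  \<open>\<Sum>f. card {\<pi>. f \<circ> \<pi> = f} * (\<Prod>u<n. lam (f u) (c u))\<close>,
  where \<open>f\<close> attaches an eigenfunction to every slot and \<open>\<pi>\<close> permutes the slots (\<open>colour_permanent\<close>).

  For the process, the moment is the integral of the permanent of \<open>K (x i) (x j)\<close> over the points with
  \<open>x u \<in> D (c u)\<close>. The expansion \<open>K x y = (\<Sum>k. a k * \<phi> k x * cnj (\<phi> k y))\<close> turns each product in the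
  permanent into a sum over \<open>f\<close>, and the integral of a term factors over the slots. Because the \<open>\<phi> k\<close> are
  orthogonal on every single \<open>D i\<close>, a factor is \<open>lam (f u) (c u)\<close> if \<open>f\<close> takes the same value at \<open>u\<close> and at the
  preimage of \<open>u\<close> under \<open>\<pi>\<close>, and \<open>0\<close> otherwise (\<open>truncated_integral\<close>, \<open>block_integral_tendsto\<close>).

  For the sum of the independent vectors, Vandermonde's identity expands the falling factorials of a sum
  over the same functions \<open>f\<close> (\<open>colour_ffact_sum\<close>). Independence factors the expectations, a
  geometric-multinomial vector with means \<open>l i\<close> has the moment \<open>(card U)! * (\<Prod>u\<in>U. l (c u))\<close>, and
  the product over \<open>k\<close> of the factorials of the sizes of the fibres of \<open>f\<close> is the number of permutations that
  preserve the fibres (\<open>card_fibre_permutations\<close>). Both computations are carried out with finitely many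
  eigenfunctions, and the two moments are limits of the same sequence.

  What remains is the expansion of \<open>K\<close> in the common eigenfunctions on the union \<open>D\<close> of the sets. The
  hypotheses supply an expansion in eigenfunctions \<open>\<psi> j\<close> on the whole space, and the diagonal of \<open>K\<close>, a null
  set of the product, matters for the permanent. Cut down to \<open>D\<close>, the functions \<open>b j = sqrt (\<alpha> j) * \<psi> j\<close> satisfy
  \<open>K x y = (\<Sum>j. b j x * cnj (b j y))\<close>, and the trace \<open>\<integral> K x x\<close> over \<open>D\<close> is finite because the eigenvalues of a
  trace-class operator are summable. Pointwise, Bessel's inequality in \<open>l2\<close> bounds \<open>\<Sum>k. a k * (cmod (\<phi> k x))\<^sup>2\<close> by
  \<open>K x x\<close>. If the integrals of the two sides differed, a quadratic form on \<open>l2\<close> would take a positive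
  value; its maximum over the unit ball, which is compact for coordinatewise convergence, would be an
  eigenvalue with an eigenfunction orthogonal to all \<open>\<phi> k\<close>, although these account for all nonzero
  eigenvalues (\<open>q_le_0\<close>). Hence the traces agree, Bessel's inequality is an equality at almost every \<open>x\<close>,
  and Parseval's identity gives the expansion at all pairs of points outside a null set of the base space,
  including the diagonal (\<open>restricted_kernel_expansion\<close>).
\<close>

section \<open>Falling factorials of coloured counts\<close>

definition ffact :: "nat \<Rightarrow> nat \<Rightarrow> nat" where
  "ffact y m = (\<Prod>j<m. y - j)"

lemma ffact_0 [simp]: "ffact y 0 = 1"
  by (simp add: ffact_def)

lemma ffact_Suc: "ffact y (Suc m) = ffact y m * (y - m)"
  by (simp add: ffact_def)

lemma ffact_eq_0: "y < m \<Longrightarrow> ffact y m = 0"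
  by (auto simp: ffact_def)

lemma ffact_eq_choose: "ffact y m = (y choose m) * fact m"
proof (cases "m \<le> y")
  case True
  then show ?thesis
  proof (induction m)
    case (Suc m)
    then have *: "(y choose m) * (y - m) = Suc m * (y choose Suc m)"
      by (metis binomial_absorb_comp binomial_absorption mult.commute)
    have "ffact y (Suc m) = ((y choose m) * (y - m)) * fact m"
      using Suc by (simp add: ffact_Suc)
    then show ?case unfolding * by (simp add: algebra_simps del: binomial_Suc_Suc)
  qed simp
next
  case False
  then show ?thesis by (simp add: ffact_eq_0 binomial_eq_0)
qed

text \<open>The number of ways to pick, for the elements \<open>u\<close> of \<open>U\<close>, distinct individuals of the prescribed
  colours \<open>c u\<close> from a population with \<open>y i\<close> individuals of colour \<open>i\<close>.\<close>

definition colour_ffact :: "('c \<Rightarrow> nat) \<Rightarrow> ('u \<Rightarrow> 'c) \<Rightarrow> 'u set \<Rightarrow> nat" where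
  "colour_ffact y c U = (\<Prod>i\<in>c ` U. ffact (y i) (card {u\<in>U. c u = i}))"

lemma colour_ffact_empty [simp]: "colour_ffact y c {} = 1"
  by (simp add: colour_ffact_def)

lemma colour_ffact_superset:
  assumes "finite C" "c ` U \<subseteq> C"
  shows "colour_ffact y c U = (\<Prod>i\<in>C. ffact (y i) (card {u\<in>U. c u = i}))"
  unfolding colour_ffact_def
proof (rule prod.mono_neutral_left)
  show "\<forall>i\<in>C - c ` U. ffact (y i) (card {u\<in>U. c u = i}) = 1"
  proof
    fix i assume "i \<in> C - c ` U"
    then have "{u\<in>U. c u = i} = {}" by auto
    from this show "ffact (y i) (card {u\<in>U. c u = i}) = 1" by (simp only: card.empty ffact_0)
  qed
qed (use assms in auto)

text \<open>The individual for the new element is any individual of its colour that is not yet taken.\<close>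

lemma colour_ffact_insert:
  assumes "finite U" "v \<notin> U"
  shows "colour_ffact y c (insert v U) = colour_ffact y c U * (y (c v) - card {u\<in>U. c u = c v})"
proof -
  let ?C = "insert (c v) (c ` U)"
  have *: "card {u\<in>insert v U. c u = i} = (if i = c v then Suc (card {u\<in>U. c u = i}) else card {u\<in>U. c u = i})" for i
  proof -
    have "{u\<in>insert v U. c u = i} = (if i = c v then insert v {u\<in>U. c u = i} else {u\<in>U. c u = i})"
      by auto
    then show ?thesis using assms by simp
  qed
  have C: "finite ?C" "c ` U \<subseteq> ?C" "c ` insert v U \<subseteq> ?C" using assms by auto
  have "colour_ffact y c (insert v U) = (\<Prod>i\<in>?C. ffact (y i) (card {u\<in>insert v U. c u = i}))"
    using colour_ffact_superset C by blast
  also have "\<dots> = ffact (y (c v)) (card {u\<in>U. c u = c v}) * (y (c v) - card {u\<in>U. c u = c v})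
     * (\<Prod>i\<in>?C - {c v}. ffact (y i) (card {u\<in>insert v U. c u = i}))"
    by (subst prod.remove[of _ "c v"]) (use C * in \<open>auto simp: ffact_Suc\<close>)
  also have "(\<Prod>i\<in>?C - {c v}. ffact (y i) (card {u\<in>insert v U. c u = i}))
     = (\<Prod>i\<in>?C - {c v}. ffact (y i) (card {u\<in>U. c u = i}))"
    by (rule prod.cong) (use * in auto)
  also have "ffact (y (c v)) (card {u\<in>U. c u = c v}) * (y (c v) - card {u\<in>U. c u = c v})
     * (\<Prod>i\<in>?C - {c v}. ffact (y i) (card {u\<in>U. c u = i})) =
     (\<Prod>i\<in>?C. ffact (y i) (card {u\<in>U. c u = i})) * (y (c v) - card {u\<in>U. c u = c v})"
    by (subst (2) prod.remove[of _ "c v"]) (use C in \<open>auto simp: mult_ac\<close>)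
  also have "(\<Prod>i\<in>?C. ffact (y i) (card {u\<in>U. c u = i})) = colour_ffact y c U"
    using colour_ffact_superset[OF C(1,2)] by metis
  finally show ?thesis .
qed

lemma colour_ffact_eq_0:
  assumes "finite U" "u0 \<in> U" "y (c u0) < card {u\<in>U. c u = c u0}"
  shows "colour_ffact y c U = 0"
  unfolding colour_ffact_def using assms by (force intro!: prod_zero simp: ffact_eq_0)

lemma colour_ffact_nonzeroD:
  assumes "finite U" "colour_ffact y c U \<noteq> 0"
  shows "card {u\<in>U. c u = i} \<le> y i"
proof (rule ccontr)
  assume "\<not> ?thesis"
  moreover from this obtain u0 where "u0 \<in> U" "c u0 = i"
    by (metis (mono_tags, lifting) bot_nat_0.extremum card.empty empty_Collect_eq)
  ultimately show False using colour_ffact_eq_0[of U u0 y c] assms by auto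
qed

text \<open>Vandermonde's identity: when the population is divided into groups \<open>k \<in> A\<close>, a choice of
  individuals first assigns a group \<open>f u\<close> to every \<open>u\<close>. In the induction on \<open>U\<close>, the new element chooses its
  group \<open>k0\<close>. Truncated subtraction does no harm, since a product of falling factorials vanishes as soon
  as one of its differences would be negative.\<close>

lemma colour_ffact_sum:
  assumes "finite U" "finite A"
  shows "colour_ffact (\<lambda>i. \<Sum>k\<in>A. y k i) c U =
    (\<Sum>f\<in>U \<rightarrow>\<^sub>E A. \<Prod>k\<in>A. colour_ffact (y k) c {u\<in>U. f u = k})"
  using assms(1)
proof induction
  case empty
  then show ?case by simp
next
  case (insert v U)
  let ?Q = "\<lambda>f. \<Prod>k\<in>A. colour_ffact (y k) c {u\<in>U. f u = k}"
  let ?n = "\<lambda>f k. card {u\<in>{u\<in>U. f u = k}. c u = c v}"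
  have step: "?Q f * ((\<Sum>k\<in>A. y k (c v)) - card {u\<in>U. c u = c v}) =
     (\<Sum>k0\<in>A. ?Q f * (y k0 (c v) - ?n f k0))" if f: "f \<in> U \<rightarrow>\<^sub>E A" for f
  proof (cases "?Q f = 0")
    case False
    then have le: "?n f k \<le> y k (c v)" if "k \<in> A" for k
      using that colour_ffact_nonzeroD[of "{u\<in>U. f u = k}" "y k" c "c v"] insert.hyps assms by auto
    have "{u\<in>U. c u = c v} = (\<Union>k\<in>A. {u\<in>{u\<in>U. f u = k}. c u = c v})"
      using f by auto
    also have "card \<dots> = (\<Sum>k\<in>A. ?n f k)"
      by (rule card_UN_disjoint) (use insert.hyps assms in auto)
    finally show ?thesis using sum_subtractf_nat[of A "?n f" "\<lambda>k. y k (c v)", symmetric] le assms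
      by (simp add: sum_distrib_left)
  next
    case True
    then show ?thesis by simp
  qed
  have upd: "(\<Prod>k\<in>A. colour_ffact (y k) c {u\<in>insert v U. (f(v := k0)) u = k}) = ?Q f * (y k0 (c v) - ?n f k0)"
    if f: "f \<in> U \<rightarrow>\<^sub>E A" and k0: "k0 \<in> A" for f k0
  proof -
    have e1: "{u\<in>insert v U. (f(v := k0)) u = k0} = insert v {u\<in>U. f u = k0}"
      using insert.hyps by auto
    have e2: "{u\<in>insert v U. (f(v := k0)) u = k} = {u\<in>U. f u = k}" if "k \<noteq> k0" for k
      using insert.hyps that by auto
    have "(\<Prod>k\<in>A. colour_ffact (y k) c {u\<in>insert v U. (f(v := k0)) u = k}) =
      colour_ffact (y k0) c (insert v {u\<in>U. f u = k0}) * (\<Prod>k\<in>A - {k0}. colour_ffact (y k) c {u\<in>U. f u = k})"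
      by (subst prod.remove[OF assms(2) k0], subst e1) (intro arg_cong2[where f="(*)"] prod.cong refl, use e2 in auto)
    also have "colour_ffact (y k0) c (insert v {u\<in>U. f u = k0}) =
       colour_ffact (y k0) c {u\<in>U. f u = k0} * (y k0 (c v) - ?n f k0)"
      by (rule colour_ffact_insert) (use insert.hyps in auto)
    finally show ?thesis
      by (subst (2) prod.remove[OF assms(2) k0]) (simp add: mult_ac)
  qed
  have "colour_ffact (\<lambda>i. \<Sum>k\<in>A. y k i) c (insert v U) =
     (\<Sum>f\<in>U \<rightarrow>\<^sub>E A. ?Q f) * ((\<Sum>k\<in>A. y k (c v)) - card {u\<in>U. c u = c v})"
    using insert by (simp add: colour_ffact_insert)
  also have "\<dots> = (\<Sum>f\<in>U \<rightarrow>\<^sub>E A. \<Sum>k0\<in>A. ?Q f * (y k0 (c v) - ?n f k0))"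
    unfolding sum_distrib_right by (rule sum.cong) (use step in auto)
  also have "\<dots> = (\<Sum>k0\<in>A. \<Sum>f\<in>U \<rightarrow>\<^sub>E A. \<Prod>k\<in>A. colour_ffact (y k) c {u\<in>insert v U. (f(v := k0)) u = k})"
    by (subst sum.swap) (intro sum.cong refl, use upd in auto)
  also have "\<dots> = (\<Sum>(k0, f)\<in>A \<times> (U \<rightarrow>\<^sub>E A). \<Prod>k\<in>A. colour_ffact (y k) c {u\<in>insert v U. (f(v := k0)) u = k})"
    using insert assms by (simp add: sum.cartesian_product)
  also have "\<dots> = (\<Sum>f\<in>insert v U \<rightarrow>\<^sub>E A. \<Prod>k\<in>A. colour_ffact (y k) c {u\<in>insert v U. f u = k})"
    unfolding PiE_insert_eq
    by (subst sum.reindex) (use insert.hyps in \<open>auto intro!: sum.cong inj_combinator simp: case_prod_beta\<close>)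
  finally show ?case .
qed

definition fibre_permutations :: "('a \<Rightarrow> 'b) \<Rightarrow> 'a set \<Rightarrow> ('a \<Rightarrow> 'a) set" where
  "fibre_permutations f U = {\<pi>. \<pi> permutes U \<and> (\<forall>u\<in>U. f (\<pi> u) = f u)}"

text \<open>A permutation of \<open>insert a S\<close> is a permutation of \<open>S\<close> followed by a transposition of \<open>a\<close> with
  some \<open>b\<close>; it preserves \<open>f\<close> iff the permutation of \<open>S\<close> does and \<open>f b = f a\<close>. So adding \<open>a\<close> multiplies
  both sides by the new size of the fibre of \<open>a\<close>.\<close>

lemma card_fibre_permutations:
  assumes "finite U" "finite A" "f ` U \<subseteq> A"
  shows "card (fibre_permutations f U) = (\<Prod>k\<in>A. fact (card {u\<in>U. f u = k}))"
  using assms unfolding fibre_permutations_def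
proof (induction U)
  case empty
  have "{\<pi>. \<pi> permutes ({}::'a set)} = {id}" by auto
  then show ?case by simp
next
  case (insert a S)
  let ?P = "\<lambda>S. {\<pi>. \<pi> permutes S \<and> (\<forall>u\<in>S. f (\<pi> u) = f u)}"
  let ?B = "{b\<in>insert a S. f b = f a}"
  have ftr: "f (Transposition.transpose a b x) = f x" if "f b = f a" for b x
    using that by (auto simp: Transposition.transpose_def)
  have iff: "(\<forall>u\<in>insert a S. f ((Transposition.transpose a b \<circ> p) u) = f u) \<longleftrightarrow> f b = f a \<and> (\<forall>u\<in>S. f (p u) = f u)"
    if p: "p permutes S" for b p
  proof
    assume *: "\<forall>u\<in>insert a S. f ((Transposition.transpose a b \<circ> p) u) = f u"
    have "p a = a" using p insert.hyps by (simp add: permutes_not_in)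
    with * have "f b = f a" by auto
    with * show "f b = f a \<and> (\<forall>u\<in>S. f (p u) = f u)" by (auto simp: ftr)
  next
    assume *: "f b = f a \<and> (\<forall>u\<in>S. f (p u) = f u)"
    have "p a = a" using p insert.hyps by (simp add: permutes_not_in)
    with * show "\<forall>u\<in>insert a S. f ((Transposition.transpose a b \<circ> p) u) = f u" by (auto simp: ftr)
  qed
  have "?P (insert a S) = (\<lambda>(b, p). Transposition.transpose a b \<circ> p) ` (?B \<times> ?P S)"
  proof (rule set_eqI)
    fix x
    have "x \<in> ?P (insert a S) \<longleftrightarrow> (\<exists>b p. x = Transposition.transpose a b \<circ> p \<and> b \<in> insert a S \<and> p permutes S \<and> (\<forall>u\<in>insert a S. f (x u) = f u))"
      using permutes_insert[of a S] by (auto simp: set_eq_iff image_iff)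
    also have "\<dots> \<longleftrightarrow> (\<exists>b p. x = Transposition.transpose a b \<circ> p \<and> b \<in> insert a S \<and> p permutes S \<and> f b = f a \<and> (\<forall>u\<in>S. f (p u) = f u))"
      using iff by metis
    also have "\<dots> \<longleftrightarrow> x \<in> (\<lambda>(b, p). Transposition.transpose a b \<circ> p) ` (?B \<times> ?P S)"
      by auto
    finally show "x \<in> ?P (insert a S) \<longleftrightarrow> x \<in> (\<lambda>(b, p). Transposition.transpose a b \<circ> p) ` (?B \<times> ?P S)" .
  qed
  moreover have "inj_on (\<lambda>(b, p). Transposition.transpose a b \<circ> p) (?B \<times> ?P S)"
  proof (rule inj_onI, clarify)
    fix b p b' p' assume *: "p permutes S" "p' permutes S" "Transposition.transpose a b \<circ> p = Transposition.transpose a b' \<circ> p'"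
    have "p a = a" "p' a = a" using * insert.hyps by (auto simp: permutes_not_in)
    with *(3) have bb: "b = b'" by (metis comp_apply transpose_apply_first)
    have "Transposition.transpose a b \<circ> (Transposition.transpose a b \<circ> p) = Transposition.transpose a b \<circ> (Transposition.transpose a b \<circ> p')" using * bb by simp
    then have "p = p'" by (simp add: comp_assoc[symmetric] del: comp_apply)
    then show "b = b' \<and> p = p'" using bb by simp
  qed
  ultimately have "card (?P (insert a S)) = card ?B * card (?P S)"
    by (simp add: card_image card_cartesian_product)
  moreover have "card ?B = Suc (card {u\<in>S. f u = f a})"
  proof -
    have "?B = insert a {u\<in>S. f u = f a}" by auto
    then show ?thesis using insert.hyps by simp
  qed
  moreover have "(\<Prod>k\<in>A. fact (card {u\<in>insert a S. f u = k})) = Suc (card {u\<in>S. f u = f a}) * (\<Prod>k\<in>A. fact (card {u\<in>S. f u = k}) :: nat)"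
  proof -
    have fa: "f a \<in> A" using insert.prems by auto
    have e: "{u\<in>insert a S. f u = k} = (if k = f a then insert a {u\<in>S. f u = f a} else {u\<in>S. f u = k})" for k
      by auto
    have "(\<Prod>k\<in>A - {f a}. fact (card {u\<in>insert a S. f u = k})) = (\<Prod>k\<in>A - {f a}. fact (card {u\<in>S. f u = k}) :: nat)"
      by (rule prod.cong) (simp_all only: e, auto)
    then show ?thesis
      by (subst (1 2) prod.remove[OF insert.prems(1) fa]) (use insert.hyps in \<open>simp only: e, simp add: algebra_simps\<close>)
  qed
  moreover have "card (?P S) = (\<Prod>k\<in>A. fact (card {u\<in>S. f u = k}))"
    using insert by auto
  ultimately show ?case by simp
qed

section \<open>Laws determined by their factorial moments\<close>

lemma ffact_powser:
  fixes t :: real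
  shows "(\<Sum>j\<le>n. t ^ j / fact j * real (ffact n j)) = (1 + t) ^ n"
proof -
  have "(1 + t) ^ n = (\<Sum>j\<le>n. real (n choose j) * t ^ j)"
    by (subst add.commute, subst binomial_ring) simp
  then show ?thesis by (simp add: ffact_eq_choose algebra_simps)
qed

lemma suminf_swap_ennreal:
  fixes f :: "nat \<Rightarrow> nat \<Rightarrow> ennreal"
  shows "(\<Sum>i. \<Sum>j. f i j) = (\<Sum>j. \<Sum>i. f i j)"
proof -
  have "(\<Sum>i. \<Sum>j. f i j) = (\<integral>\<^sup>+i. (\<Sum>j. f i j) \<partial>count_space UNIV)"
    by (simp add: nn_integral_count_space_nat)
  also have "\<dots> = (\<Sum>j. \<integral>\<^sup>+i. f i j \<partial>count_space UNIV)"
    by (rule nn_integral_suminf) simp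
  finally show ?thesis by (simp add: nn_integral_count_space_nat)
qed

text \<open>The Taylor expansion of a probability generating function at \<open>1\<close>; all terms are nonnegative, so
  the sums may be interchanged.\<close>

lemma pgf_eq_factorial_moments:
  fixes p :: "nat \<Rightarrow> ennreal"
  assumes "t \<ge> 0"
  shows "(\<Sum>n. p n * ennreal ((1 + t) ^ n)) = (\<Sum>j. ennreal (t ^ j / fact j) * (\<Sum>n. p n * of_nat (ffact n j)))"
proof -
  have "ennreal ((1 + t) ^ n) = (\<Sum>j. ennreal (t ^ j / fact j) * of_nat (ffact n j))" for n
  proof -
    have "(\<Sum>j. ennreal (t ^ j / fact j) * of_nat (ffact n j)) = (\<Sum>j\<le>n. ennreal (t ^ j / fact j) * of_nat (ffact n j))"
      by (rule suminf_finite) (auto simp: ffact_eq_0)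
    also have "\<dots> = (\<Sum>j\<le>n. ennreal (t ^ j / fact j * real (ffact n j)))"
      using assms by (intro sum.cong refl) (simp add: ennreal_mult[symmetric] ennreal_of_nat_eq_real_of_nat)
    also have "\<dots> = ennreal (\<Sum>j\<le>n. t ^ j / fact j * real (ffact n j))"
      by (rule sum_ennreal) (use assms in auto)
    finally show ?thesis by (simp only: ffact_powser)
  qed
  then have "(\<Sum>n. p n * ennreal ((1 + t) ^ n)) = (\<Sum>n. \<Sum>j. p n * (ennreal (t ^ j / fact j) * of_nat (ffact n j)))"
    by simp
  also have "\<dots> = (\<Sum>j. \<Sum>n. p n * (ennreal (t ^ j / fact j) * of_nat (ffact n j)))"
    by (rule suminf_swap_ennreal)
  also have "\<dots> = (\<Sum>j. ennreal (t ^ j / fact j) * (\<Sum>n. p n * of_nat (ffact n j)))"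
    by (simp add: mult_ac flip: ennreal_suminf_cmult)
  finally show ?thesis .
qed

lemma fact_add_le: "fact (M + j) \<le> (2::real) ^ (M + j) * fact M * fact j"
proof -
  have "real ((M + j) choose M) \<le> 2 ^ (M + j)"
    using binomial_le_pow2[of "M + j" M] by (metis of_nat_le_iff of_nat_numeral of_nat_power)
  moreover have "fact (M + j) = real ((M + j) choose M) * fact M * fact j"
    by (subst binomial_fact) auto
  ultimately show ?thesis by (simp add: mult_right_mono)
qed

lemma pgf_finite:
  fixes p :: "nat \<Rightarrow> ennreal"
  assumes bound: "\<And>j. (\<Sum>n. p n * of_nat (ffact n j)) \<le> ennreal (C ^ (M + j) * fact (M + j))"
    and C: "C > 0" and t: "0 \<le> t" "t \<le> 1 / (4 * C)"
  shows "(\<Sum>n. p n * ennreal ((1 + t) ^ n)) < \<top>"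
proof -
  let ?a = "\<lambda>j. (2 * C) ^ M * fact M * (1 / 2) ^ j"
  have "ennreal (t ^ j / fact j) * (\<Sum>n. p n * of_nat (ffact n j)) \<le> ennreal (?a j)" for j
  proof -
    have "ennreal (t ^ j / fact j) * (\<Sum>n. p n * of_nat (ffact n j)) \<le>
        ennreal (t ^ j / fact j) * ennreal (C ^ (M + j) * fact (M + j))"
      by (intro mult_left_mono bound) simp
    also have "\<dots> = ennreal (t ^ j / fact j * (C ^ (M + j) * fact (M + j)))"
      using t C by (simp add: ennreal_mult[symmetric])
    also have "\<dots> \<le> ennreal (?a j)"
    proof (rule ennreal_leI)
      have "t ^ j / fact j * (C ^ (M + j) * fact (M + j)) \<le> t ^ j / fact j * (C ^ (M + j) * (2 ^ (M + j) * fact M * fact j))"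
        using t C by (intro mult_left_mono fact_add_le) auto
      also have "\<dots> = (2 * C) ^ M * fact M * (2 * C * t) ^ j"
        by (simp add: power_add power_mult_distrib field_simps)
      also have "\<dots> \<le> ?a j"
        using t C by (intro mult_left_mono power_mono) (auto simp: field_simps)
      finally show "t ^ j / fact j * (C ^ (M + j) * fact (M + j)) \<le> ?a j" .
    qed
    finally show ?thesis .
  qed
  then have "(\<Sum>j. ennreal (t ^ j / fact j) * (\<Sum>n. p n * of_nat (ffact n j))) \<le> (\<Sum>j. ennreal (?a j))"
    by (intro suminf_le) auto
  also have "\<dots> < \<top>"
    using C by (subst suminf_ennreal2) (auto intro!: summable_mult simp: summable_geometric)
  finally show ?thesis using pgf_eq_factorial_moments[OF t(1)] by simp
qed

text \<open>The bound on the moments makes both generating functions analytic on a disc of radius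
  \<open>1 + t0\<close> with \<open>t0 > 0\<close>. They agree on the real interval from \<open>1\<close> to \<open>1 + t0\<close>, where both are given by
  the moments, hence on the whole disc, and so do their coefficients.\<close>

lemma factorial_moments_determine_sequence:
  fixes p q :: "nat \<Rightarrow> ennreal"
  assumes eq: "\<And>j. (\<Sum>n. p n * of_nat (ffact n j)) = (\<Sum>n. q n * of_nat (ffact n j))"
    and bound: "\<And>j. (\<Sum>n. q n * of_nat (ffact n j)) \<le> ennreal (C ^ (M + j) * fact (M + j))"
    and C: "C > 0"
  shows "p = q"
proof
  fix n
  define t0 where "t0 = 1 / (4 * C)"
  have t0: "t0 > 0" using C by (simp add: t0_def)
  have fin: "(\<Sum>n. p n * ennreal ((1 + t) ^ n)) < \<top>" "(\<Sum>n. q n * ennreal ((1 + t) ^ n)) < \<top>"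
     if "0 \<le> t" "t \<le> t0" for t
    using pgf_finite[of p C M t] pgf_finite[of q C M t] eq bound C that by (auto simp: t0_def)
  have finite: "r n < \<top>" if "(\<Sum>n. r n * ennreal ((1 + 0) ^ n)) < \<top>" for r :: "nat \<Rightarrow> ennreal" and n
    using that by (simp add: ennreal_suminf_lessD)
  have pf: "p n < \<top>" "q n < \<top>" for n
    using finite fin[of 0] t0 by auto
  define P where "P = (\<lambda>n. enn2real (p n))"
  define Q where "Q = (\<lambda>n. enn2real (q n))"
  have P: "p n = ennreal (P n)" "q n = ennreal (Q n)" "P n \<ge> 0" "Q n \<ge> 0" for n
    using pf by (auto simp: P_def Q_def)
  have real: "summable (\<lambda>n. R n * (1 + t) ^ n) \<and> (\<Sum>n. R n * (1 + t) ^ n) = enn2real (\<Sum>n. ennreal (R n) * ennreal ((1 + t) ^ n))"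
    if "(\<Sum>n. ennreal (R n) * ennreal ((1 + t) ^ n)) < \<top>" "\<And>n. R n \<ge> 0" "t \<ge> 0" for R :: "nat \<Rightarrow> real" and t
  proof -
    have "(\<Sum>n. ennreal (R n) * ennreal ((1 + t) ^ n)) = (\<Sum>n. ennreal (R n * (1 + t) ^ n))"
      using that by (simp add: ennreal_mult)
    moreover from this have "summable (\<lambda>n. R n * (1 + t) ^ n)"
      using that by (intro summable_suminf_not_top) auto
    ultimately show ?thesis using that
      by (simp add: suminf_ennreal2 suminf_nonneg)
  qed
  define f where "f = Abs_fps (\<lambda>n. complex_of_real (P n))"
  define g where "g = Abs_fps (\<lambda>n. complex_of_real (Q n))"
  have rad: "fps_conv_radius (Abs_fps (\<lambda>n. complex_of_real (R n))) \<ge> ereal (1 + t0)"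
    if "summable (\<lambda>n. R n * (1 + t0) ^ n)" for R
  proof -
    have "summable (\<lambda>n. complex_of_real (R n) * complex_of_real (1 + t0) ^ n)"
      using summable_of_real[OF that, where 'a=complex] by simp
    from conv_radius_geI[OF this] show ?thesis using t0 unfolding fps_conv_radius_def
      by (simp del: of_real_add)
  qed
  have radf: "fps_conv_radius f \<ge> ereal (1 + t0)" "fps_conv_radius g \<ge> ereal (1 + t0)"
    unfolding f_def g_def using real[of P t0] real[of Q t0] fin[of t0] t0 P by (auto intro!: rad)
  have eval: "eval_fps (Abs_fps (\<lambda>n. complex_of_real (R n))) (complex_of_real x) = complex_of_real (\<Sum>n. R n * x ^ n)"
    if "summable (\<lambda>n. R n * x ^ n)" for R x
    using suminf_of_real[OF that, where 'a=complex] by (simp add: eval_fps_def)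
  have agree: "eval_fps f (complex_of_real (1 + t)) = eval_fps g (complex_of_real (1 + t))"
    if t: "0 \<le> t" "t \<le> t0" for t
  proof -
    have "(\<Sum>n. p n * ennreal ((1 + t) ^ n)) = (\<Sum>n. q n * ennreal ((1 + t) ^ n))"
      using t eq by (simp add: pgf_eq_factorial_moments)
    then have "(\<Sum>n. P n * (1 + t) ^ n) = (\<Sum>n. Q n * (1 + t) ^ n)"
      using real[of P t] real[of Q t] fin[of t] t P by auto
    then show ?thesis
      unfolding f_def g_def using real[of P t] real[of Q t] fin[of t] t P by (simp add: eval del: of_real_add)
  qed
  let ?S = "ball (0::complex) (1 + t0)"
  have sub: "?S \<subseteq> eball 0 (fps_conv_radius f)" "?S \<subseteq> eball 0 (fps_conv_radius g)"
    using radf by (auto simp: eball_def dist_norm intro: less_le_trans[of _ "ereal (1 + t0)"])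
  have zero: "eval_fps f z - eval_fps g z = 0" if "z \<in> ?S" for z
  proof (rule analytic_continuation[of "\<lambda>z. eval_fps f z - eval_fps g z" ?S "(\<lambda>t. complex_of_real (1 + t)) ` {0<..<t0}" 1])
    show "(\<lambda>z. eval_fps f z - eval_fps g z) holomorphic_on ?S"
      using sub by (intro holomorphic_intros) auto
    show "(\<lambda>t. complex_of_real (1 + t)) ` {0<..<t0} \<subseteq> ?S"
      by (auto simp del: of_real_add)
    show "(1::complex) islimpt (\<lambda>t. complex_of_real (1 + t)) ` {0<..<t0}"
      unfolding islimpt_sequential
    proof (intro exI conjI)
      show "\<forall>n. complex_of_real (1 + t0 / (2 + real n)) \<in> (\<lambda>t. complex_of_real (1 + t)) ` {0<..<t0} - {1}"
      proof
        fix n :: nat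
        have *: "t0 / (2 + real n) \<in> {0<..<t0}" using t0 by (auto simp: field_simps add_pos_nonneg)
        then have "complex_of_real (1 + t0 / (2 + real n)) \<noteq> 1"
          by (metis add_cancel_left_right greaterThanLessThan_iff less_irrefl of_real_eq_1_iff)
        with * show "complex_of_real (1 + t0 / (2 + real n)) \<in> (\<lambda>t. complex_of_real (1 + t)) ` {0<..<t0} - {1}"
          by (intro DiffI imageI) auto
      qed
      \<comment> \<open>the points \<open>1 + t0 / (n + 2)\<close> accumulate at \<open>1\<close>\<close>
      have "(\<lambda>n. 1 + t0 / (2 + real n)) \<longlonglongrightarrow> 1" by real_asymp
      from tendsto_of_real[OF this, where 'a=complex]
      show "(\<lambda>n. complex_of_real (1 + t0 / (2 + real n))) \<longlonglongrightarrow> 1" by simp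
    qed
  qed (use that agree t0 in auto)
  have "f = g"
  proof (rule eval_fps_eqD)
    show "fps_conv_radius f > 0" "fps_conv_radius g > 0"
      using radf t0 by (auto intro: less_le_trans[of _ "ereal (1 + t0)"])
    have "eventually (\<lambda>z. z \<in> ?S) (nhds 0)"
      using t0 by (intro eventually_nhds_in_open) auto
    then show "eventually (\<lambda>z. eval_fps f z = eval_fps g z) (nhds 0)"
      by eventually_elim (use zero in auto)
  qed
  then have "complex_of_real (P n) = complex_of_real (Q n)"
    unfolding f_def g_def by (metis fps_nth_Abs_fps)
  then show "p n = q n" using P by simp
qed


lemma prod_indicator_eq:
  assumes "finite R"
  shows "(\<Prod>i\<in>R. indicator {n i} (x i) :: ennreal) = indicator {x. \<forall>i\<in>R. x i = n i} x"
  using assms by (induction R) (auto simp: indicator_def)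

text \<open>The coordinates are treated one at a time: \<open>W V U m\<close> carries the indicators of \<open>x i = n i\<close> for the
  coordinates \<open>i \<in> V\<close> already treated and falling factorials for those in \<open>U\<close>. The one-dimensional
  result, applied with \<open>W\<close> as a weight, replaces the falling factorials of one further coordinate by
  an indicator. Indicators are at most \<open>1\<close>, which is the falling factorial of order \<open>0\<close>, so the
  moment bound persists.\<close>

lemma mixed_factorial_moments_determine:
  fixes X :: "'a \<Rightarrow> 'i \<Rightarrow> nat" and Y :: "'b \<Rightarrow> 'i \<Rightarrow> nat"
  assumes R: "finite R"
    and X [measurable]: "\<And>i. i \<in> R \<Longrightarrow> (\<lambda>\<omega>. X \<omega> i) \<in> measurable M (count_space UNIV)"
    and Y [measurable]: "\<And>i. i \<in> R \<Longrightarrow> (\<lambda>\<omega>. Y \<omega> i) \<in> measurable N (count_space UNIV)"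
    and eq: "\<And>m. (\<integral>\<^sup>+\<omega>. (\<Prod>i\<in>R. of_nat (ffact (X \<omega> i) (m i))) \<partial>M) = (\<integral>\<^sup>+\<omega>. (\<Prod>i\<in>R. of_nat (ffact (Y \<omega> i) (m i))) \<partial>N)"
    and bound: "\<And>m. (\<integral>\<^sup>+\<omega>. (\<Prod>i\<in>R. of_nat (ffact (Y \<omega> i) (m i))) \<partial>N) \<le> ennreal (C ^ (\<Sum>i\<in>R. m i) * fact (\<Sum>i\<in>R. m i))"
    and C: "C > 0"
  shows "emeasure M {\<omega>\<in>space M. \<forall>i\<in>R. X \<omega> i = n i} = emeasure N {\<omega>\<in>space N. \<forall>i\<in>R. Y \<omega> i = n i}"
proof -
  define W :: "'i set \<Rightarrow> 'i set \<Rightarrow> ('i \<Rightarrow> nat) \<Rightarrow> ('i \<Rightarrow> nat) \<Rightarrow> ennreal" where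
    "W = (\<lambda>V U m x. (\<Prod>i\<in>V. indicator {n i} (x i)) * (\<Prod>i\<in>U. of_nat (ffact (x i) (m i))))"
  have WX [measurable]: "(\<lambda>\<omega>. W V U m (X \<omega>)) \<in> borel_measurable M" if "V \<subseteq> R" "U \<subseteq> R" for V U m
    unfolding W_def using that by (intro borel_measurable_times_ennreal borel_measurable_prod_ennreal) (auto intro!: measurable_compose[OF X])
  have WY [measurable]: "(\<lambda>\<omega>. W V U m (Y \<omega>)) \<in> borel_measurable N" if "V \<subseteq> R" "U \<subseteq> R" for V U m
    unfolding W_def using that by (intro borel_measurable_times_ennreal borel_measurable_prod_ennreal) (auto intro!: measurable_compose[OF Y])
  have slice: "(\<Sum>k. (\<integral>\<^sup>+\<omega>. W V U m (Z \<omega>) * indicator {k} (Z \<omega> v) \<partial>L) * of_nat (ffact k j)) = (\<integral>\<^sup>+\<omega>. W V U m (Z \<omega>) * of_nat (ffact (Z \<omega> v) j) \<partial>L)"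
    if [measurable]: "(\<lambda>\<omega>. W V U m (Z \<omega>)) \<in> borel_measurable L" "(\<lambda>\<omega>. Z \<omega> v) \<in> measurable L (count_space UNIV)"
    for V U m v j and L :: "'c measure" and Z
  proof -
    have [measurable]: "(\<lambda>\<omega>. indicator {k} (Z \<omega> v) :: ennreal) \<in> borel_measurable L" for k
      by (rule measurable_compose[OF that(2)]) simp
    have "(\<Sum>k. (\<integral>\<^sup>+\<omega>. W V U m (Z \<omega>) * indicator {k} (Z \<omega> v) \<partial>L) * of_nat (ffact k j)) =
       (\<Sum>k. (\<integral>\<^sup>+\<omega>. W V U m (Z \<omega>) * indicator {k} (Z \<omega> v) * of_nat (ffact k j) \<partial>L))"
      by (intro suminf_cong nn_integral_multc[symmetric]) simp
    also have "\<dots> = (\<integral>\<^sup>+\<omega>. (\<Sum>k. W V U m (Z \<omega>) * indicator {k} (Z \<omega> v) * of_nat (ffact k j)) \<partial>L)"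
      by (rule nn_integral_suminf[symmetric]) simp
    also have "\<dots> = (\<integral>\<^sup>+\<omega>. W V U m (Z \<omega>) * of_nat (ffact (Z \<omega> v) j) \<partial>L)"
    proof (rule nn_integral_cong)
      fix \<omega>
      have "(\<Sum>k. W V U m (Z \<omega>) * indicator {k} (Z \<omega> v) * of_nat (ffact k j)) = (\<Sum>k\<in>{Z \<omega> v}. W V U m (Z \<omega>) * indicator {k} (Z \<omega> v) * of_nat (ffact k j))"
        by (rule suminf_finite) auto
      then show "(\<Sum>k. W V U m (Z \<omega>) * indicator {k} (Z \<omega> v) * of_nat (ffact k j)) = W V U m (Z \<omega>) * of_nat (ffact (Z \<omega> v) j)"
        by simp
    qed
    finally show ?thesis .
  qed
  have claim: "\<forall>m. (\<integral>\<^sup>+\<omega>. W V (R - V) m (X \<omega>) \<partial>M) = (\<integral>\<^sup>+\<omega>. W V (R - V) m (Y \<omega>) \<partial>N)" if "V \<subseteq> R" for V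
    using finite_subset[OF that R] that
  proof (induction V rule: finite_subset_induct')
    case empty
    then show ?case using eq by (simp add: W_def)
  next
    case (insert v V)
    show ?case
    proof
      fix m
      let ?U = "R - insert v V"
      have v: "v \<in> R" "R - V = insert v ?U" "v \<notin> ?U" "V \<subseteq> R" "?U \<subseteq> R" using insert by auto
      have split: "W V (R - V) (m(v := j)) x = W V ?U m x * of_nat (ffact (x v) j)" for j x
      proof -
        have "(\<Prod>i\<in>?U. of_nat (ffact (x i) ((m(v := j)) i))) = (\<Prod>i\<in>?U. of_nat (ffact (x i) (m i)) :: ennreal)"
          by (intro prod.cong) auto
        then show ?thesis unfolding W_def by (subst v(2), subst prod.insert) (use R in \<open>auto simp: mult_ac\<close>)
      qed
      have slice2: "W (insert v V) ?U m x = W V ?U m x * indicator {n v} (x v)" for x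
        unfolding W_def by (subst prod.insert) (use insert.hyps in \<open>auto simp: mult_ac\<close>)
      let ?p = "\<lambda>k. \<integral>\<^sup>+\<omega>. W V ?U m (X \<omega>) * indicator {k} (X \<omega> v) \<partial>M"
      let ?q = "\<lambda>k. \<integral>\<^sup>+\<omega>. W V ?U m (Y \<omega>) * indicator {k} (Y \<omega> v) \<partial>N"
      have "?p = ?q"
      proof (rule factorial_moments_determine_sequence[where C = C and M = "\<Sum>i\<in>?U. m i"])
        fix j
        have p: "(\<Sum>k. ?p k * of_nat (ffact k j)) = (\<integral>\<^sup>+\<omega>. W V (R - V) (m(v := j)) (X \<omega>) \<partial>M)"
          unfolding split by (rule slice) (use v in auto)
        have q: "(\<Sum>k. ?q k * of_nat (ffact k j)) = (\<integral>\<^sup>+\<omega>. W V (R - V) (m(v := j)) (Y \<omega>) \<partial>N)"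
          unfolding split by (rule slice) (use v in auto)
        show "(\<Sum>k. ?p k * of_nat (ffact k j)) = (\<Sum>k. ?q k * of_nat (ffact k j))"
          unfolding p q using insert.IH v by blast
        let ?m = "\<lambda>i. if i \<in> V then 0 else (m(v := j)) i"
        have "(\<integral>\<^sup>+\<omega>. W V (R - V) (m(v := j)) (Y \<omega>) \<partial>N) \<le> (\<integral>\<^sup>+\<omega>. (\<Prod>i\<in>R. of_nat (ffact (Y \<omega> i) (?m i))) \<partial>N)"
        proof (rule nn_integral_mono)
          fix \<omega>
          have "W V (R - V) (m(v := j)) (Y \<omega>) \<le> 1 * (\<Prod>i\<in>R - V. of_nat (ffact (Y \<omega> i) ((m(v := j)) i)))"
            unfolding W_def by (intro mult_right_mono prod_le_1) (auto simp: indicator_def)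
          also have "\<dots> = (\<Prod>i\<in>R. of_nat (ffact (Y \<omega> i) (?m i)))"
            unfolding mult_1 by (rule prod.mono_neutral_cong_left) (use R in auto)
          finally show "W V (R - V) (m(v := j)) (Y \<omega>) \<le> (\<Prod>i\<in>R. of_nat (ffact (Y \<omega> i) (?m i)))" .
        qed
        also have "\<dots> \<le> ennreal (C ^ (\<Sum>i\<in>R. ?m i) * fact (\<Sum>i\<in>R. ?m i))" by (rule bound)
        also have "(\<Sum>i\<in>R. ?m i) = (\<Sum>i\<in>?U. m i) + j"
        proof -
          have "(\<Sum>i\<in>R. ?m i) = (\<Sum>i\<in>R - V. (m(v := j)) i)"
            by (rule sum.mono_neutral_cong_right) (use R in auto)
          also have "\<dots> = j + (\<Sum>i\<in>?U. (m(v := j)) i)"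
            by (subst v(2), subst sum.insert) (use R in auto)
          also have "(\<Sum>i\<in>?U. (m(v := j)) i) = (\<Sum>i\<in>?U. m i)" by (rule sum.cong) auto
          finally show ?thesis by simp
        qed
        finally show "(\<Sum>k. ?q k * of_nat (ffact k j)) \<le> ennreal (C ^ ((\<Sum>i\<in>?U. m i) + j) * fact ((\<Sum>i\<in>?U. m i) + j))"
          unfolding q .
      qed (rule C)
      from fun_cong[OF this, of "n v"]
      show "(\<integral>\<^sup>+\<omega>. W (insert v V) ?U m (X \<omega>) \<partial>M) = (\<integral>\<^sup>+\<omega>. W (insert v V) ?U m (Y \<omega>) \<partial>N)"
        unfolding slice2 .
    qed
  qed
  have fin: "(\<integral>\<^sup>+\<omega>. W R {} (\<lambda>_. 0) (Z \<omega>) \<partial>L) = emeasure L {\<omega>\<in>space L. \<forall>i\<in>R. Z \<omega> i = n i}"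
    if [measurable]: "\<And>i. i \<in> R \<Longrightarrow> (\<lambda>\<omega>. Z \<omega> i) \<in> measurable L (count_space UNIV)" for L :: "'c measure" and Z
  proof -
    have [measurable]: "{\<omega>\<in>space L. \<forall>i\<in>R. Z \<omega> i = n i} \<in> sets L"
      using R by (intro sets.sets_Collect_finite_All) (auto intro!: predE simp: pred_def)
    have "(\<integral>\<^sup>+\<omega>. W R {} (\<lambda>_. 0) (Z \<omega>) \<partial>L) = (\<integral>\<^sup>+\<omega>. indicator {\<omega>\<in>space L. \<forall>i\<in>R. Z \<omega> i = n i} \<omega> \<partial>L)"
      unfolding W_def prod_indicator_eq[OF R] by (intro nn_integral_cong) (simp add: indicator_def)
    then show ?thesis by simp
  qed
  show ?thesis
    using claim[of R] fin[of X M, OF X] fin[of Y N, OF Y] by simp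
qed

text \<open>Up to null sets, both vectors take values in the countable set of integer vectors, where a law is
  given by its point masses.\<close>

lemma distr_eq_of_point_masses:
  fixes F :: "'i \<Rightarrow> 'a \<Rightarrow> ennreal" and G :: "'i \<Rightarrow> 'b \<Rightarrow> ennreal"
  assumes R: "finite R"
    and X [measurable]: "\<And>i. i \<in> R \<Longrightarrow> (\<lambda>\<omega>. X \<omega> i) \<in> measurable M (count_space UNIV)"
    and Y [measurable]: "\<And>i. i \<in> R \<Longrightarrow> (\<lambda>\<omega>. Y \<omega> i) \<in> measurable N (count_space UNIV)"
    and Fm [measurable]: "\<And>i. i \<in> R \<Longrightarrow> F i \<in> borel_measurable M"
    and Gm [measurable]: "\<And>i. i \<in> R \<Longrightarrow> G i \<in> borel_measurable N"
    and F: "\<And>i. i \<in> R \<Longrightarrow> AE \<omega> in M. F i \<omega> = of_nat (X \<omega> i)"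
    and G: "\<And>i. i \<in> R \<Longrightarrow> AE \<omega> in N. G i \<omega> = of_nat (Y \<omega> i)"
    and eq: "\<And>n. emeasure M {\<omega>\<in>space M. \<forall>i\<in>R. X \<omega> i = n i} = emeasure N {\<omega>\<in>space N. \<forall>i\<in>R. Y \<omega> i = n i}"
  shows "distr M (PiM R (\<lambda>_. borel)) (\<lambda>\<omega>. \<lambda>i\<in>R. F i \<omega>) = distr N (PiM R (\<lambda>_. borel)) (\<lambda>\<omega>. \<lambda>i\<in>R. G i \<omega>)"
proof -
  let ?A = "PiE R (\<lambda>_. UNIV :: nat set)"
  let ?h = "\<lambda>z. \<lambda>i\<in>R. of_nat (z i) :: ennreal"
  have cA: "countable ?A" using R by (rule countable_PiE) auto
  have set: "(\<lambda>\<omega>. \<lambda>i\<in>R. Z \<omega> i) -` {n} \<inter> space L = {\<omega>\<in>space L. \<forall>i\<in>R. Z \<omega> i = n i}" if "n \<in> ?A"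
    for Z :: "'c \<Rightarrow> 'i \<Rightarrow> nat" and L n
    using that by (auto simp: fun_eq_iff PiE_iff extensional_def restrict_def)
  have Zm: "(\<lambda>\<omega>. \<lambda>i\<in>R. Z \<omega> i) \<in> measurable L (count_space ?A)"
    if [measurable]: "\<And>i. i \<in> R \<Longrightarrow> (\<lambda>\<omega>. Z \<omega> i) \<in> measurable L (count_space UNIV)" for Z :: "'c \<Rightarrow> 'i \<Rightarrow> nat" and L
    unfolding measurable_count_space_eq_countable[OF cA]
  proof (intro conjI ballI)
    show "(\<lambda>\<omega>. \<lambda>i\<in>R. Z \<omega> i) \<in> space L \<rightarrow> ?A" by auto
    fix n assume n: "n \<in> ?A"
    show "(\<lambda>\<omega>. \<lambda>i\<in>R. Z \<omega> i) -` {n} \<inter> space L \<in> sets L"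
      unfolding set[OF n] using R by (intro sets.sets_Collect_finite_All) (auto intro!: predE simp: pred_def)
  qed
  have pm: "emeasure (distr L (count_space ?A) (\<lambda>\<omega>. \<lambda>i\<in>R. Z \<omega> i)) {n} = emeasure L {\<omega>\<in>space L. \<forall>i\<in>R. Z \<omega> i = n i}"
    if Z: "\<And>i. i \<in> R \<Longrightarrow> (\<lambda>\<omega>. Z \<omega> i) \<in> measurable L (count_space UNIV)" and n: "n \<in> ?A" for Z :: "'c \<Rightarrow> 'i \<Rightarrow> nat" and L n
  proof -
    have m: "(\<lambda>\<omega>. \<lambda>i\<in>R. Z \<omega> i) \<in> measurable L (count_space ?A)" by (rule Zm) (rule Z)
    have "{n} \<in> sets (count_space ?A)" using n by simp
    from emeasure_distr[OF m this] show ?thesis unfolding set[OF n] .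
  qed
  have hm: "?h \<in> measurable (count_space ?A) (PiM R (\<lambda>_. borel))"
    by (intro measurable_restrict) simp
  have push: "distr L (PiM R (\<lambda>_. borel)) (\<lambda>\<omega>. \<lambda>i\<in>R. H i \<omega>) = distr (distr L (count_space ?A) (\<lambda>\<omega>. \<lambda>i\<in>R. Z \<omega> i)) (PiM R (\<lambda>_. borel)) ?h"
    if Z: "\<And>i. i \<in> R \<Longrightarrow> (\<lambda>\<omega>. Z \<omega> i) \<in> measurable L (count_space UNIV)"
      and Hm: "\<And>i. i \<in> R \<Longrightarrow> H i \<in> borel_measurable L"
      and H: "\<And>i. i \<in> R \<Longrightarrow> AE \<omega> in L. H i \<omega> = of_nat (Z \<omega> i)"
    for Z :: "'c \<Rightarrow> 'i \<Rightarrow> nat" and L H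
  proof -
    have m: "(\<lambda>\<omega>. \<lambda>i\<in>R. Z \<omega> i) \<in> measurable L (count_space ?A)" by (rule Zm) (rule Z)
    have "AE \<omega> in L. \<forall>i\<in>R. H i \<omega> = of_nat (Z \<omega> i)"
      using R H by (subst AE_ball_countable) (auto simp: countable_finite)
    then have ae: "AE \<omega> in L. (\<lambda>i\<in>R. H i \<omega>) = ?h (\<lambda>i\<in>R. Z \<omega> i)"
      by eventually_elim (auto simp: restrict_def)
    have "distr L (PiM R (\<lambda>_. borel)) (\<lambda>\<omega>. \<lambda>i\<in>R. H i \<omega>) = distr L (PiM R (\<lambda>_. borel)) (\<lambda>\<omega>. ?h (\<lambda>i\<in>R. Z \<omega> i))"
      by (rule distr_cong_AE[OF refl refl ae])
         (use Hm measurable_compose[OF m hm] in \<open>auto intro!: measurable_restrict\<close>)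
    also have "\<dots> = distr (distr L (count_space ?A) (\<lambda>\<omega>. \<lambda>i\<in>R. Z \<omega> i)) (PiM R (\<lambda>_. borel)) ?h"
      by (subst distr_distr[OF hm m]) (simp_all add: comp_def)
    finally show ?thesis .
  qed
  have "distr M (count_space ?A) (\<lambda>\<omega>. \<lambda>i\<in>R. X \<omega> i) = distr N (count_space ?A) (\<lambda>\<omega>. \<lambda>i\<in>R. Y \<omega> i)"
  proof (rule measure_eqI_countable[where A = ?A])
    fix n assume n: "n \<in> ?A"
    show "emeasure (distr M (count_space ?A) (\<lambda>\<omega>. \<lambda>i\<in>R. X \<omega> i)) {n} = emeasure (distr N (count_space ?A) (\<lambda>\<omega>. \<lambda>i\<in>R. Y \<omega> i)) {n}"
      using pm[OF X n] pm[OF Y n] eq[of n] by (simp only:)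
  qed (auto simp: cA)
  then show ?thesis
    using push[OF X Fm F] push[OF Y Gm G] by simp
qed

section \<open>Geometric totals with multinomial colours\<close>

text \<open>A choice of \<open>m\<close> distinct individuals in order either avoids the last individual or puts it in one
  of the \<open>m\<close> positions.\<close>

lemma ffact_Suc_left: "ffact (Suc y) m = ffact y m + m * ffact y (m - 1)"
proof (cases m)
  case (Suc k)
  show ?thesis unfolding Suc
  proof (induction k)
    case (Suc k)
    have "ffact (Suc y) (Suc (Suc k)) = (ffact y (Suc k) + Suc k * ffact y k) * (y - k)"
      using Suc by (subst ffact_Suc) simp
    also have "\<dots> = ffact y (Suc k) * (y - k) + Suc k * ffact y (Suc k)"
      by (simp only: ffact_Suc distrib_right mult.assoc)
    also have "ffact y (Suc k) * (y - k) = ffact y (Suc k) * (y - Suc k) + ffact y (Suc k)"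
    proof (cases "k < y")
      case True
      then have "y - k = Suc (y - Suc k)" by simp
      then show ?thesis by simp
    next
      case False
      then show ?thesis by (simp add: ffact_eq_0)
    qed
    finally have "ffact (Suc y) (Suc (Suc k)) = ffact y (Suc k) * (y - Suc k) + ffact y (Suc k) + Suc k * ffact y (Suc k)" .
    also have "\<dots> = ffact y (Suc (Suc k)) + Suc (Suc k) * ffact y (Suc (Suc k) - 1)"
      by (simp add: ffact_Suc[of y "Suc k"])
    finally show ?case .
  qed (simp add: ffact_Suc)
qed simp

text \<open>One more individual of colour \<open>j\<close> is either left out or assigned to exactly one \<open>u\<close> of colour \<open>j\<close>.\<close>

lemma colour_ffact_increment:
  assumes "finite U"
  shows "colour_ffact (y(j := Suc (y j))) c U =
    colour_ffact y c U + (\<Sum>u\<in>{u\<in>U. c u = j}. colour_ffact y c (U - {u}))"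
proof -
  let ?C = "insert j (c ` U)"
  let ?m = "\<lambda>i. card {u\<in>U. c u = i}"
  let ?rest = "\<Prod>i\<in>?C - {j}. ffact (y i) (?m i)"
  have C: "finite ?C" "c ` U \<subseteq> ?C" "j \<in> ?C" using assms by auto
  have 1: "colour_ffact (y(j := Suc (y j))) c U = ffact (Suc (y j)) (?m j) * ?rest"
    by (subst colour_ffact_superset[OF C(1,2)], subst prod.remove[OF C(1,3)]) simp
  have 2: "colour_ffact y c U = ffact (y j) (?m j) * ?rest"
    by (subst colour_ffact_superset[OF C(1,2)], subst prod.remove[OF C(1,3)]) simp
  have 3: "colour_ffact y c (U - {u}) = ffact (y j) (?m j - 1) * ?rest" if "u \<in> {u\<in>U. c u = j}" for u
  proof -
    have C': "c ` (U - {u}) \<subseteq> ?C" by auto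
    have e: "{w\<in>U - {u}. c w = i} = (if i = j then {w\<in>U. c w = j} - {u} else {w\<in>U. c w = i})" for i
      using that by auto
    have cd: "card ({w\<in>U. c w = j} - {u}) = ?m j - 1" using that assms by (subst card_Diff_singleton) auto
    have "(\<Prod>i\<in>?C - {j}. ffact (y i) (card {w\<in>U - {u}. c w = i})) = ?rest"
    proof (rule prod.cong[OF refl])
      fix i assume "i \<in> ?C - {j}"
      then have "i \<noteq> j" by auto
      then show "ffact (y i) (card {w\<in>U - {u}. c w = i}) = ffact (y i) (?m i)"
        unfolding e by simp
    qed
    moreover have "card {w\<in>U - {u}. c w = j} = ?m j - 1" unfolding e using cd by simp
    ultimately show ?thesis
      by (subst colour_ffact_superset[OF C(1) C'], subst prod.remove[OF C(1,3)]) simp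
  qed
  have "(\<Sum>u\<in>{u\<in>U. c u = j}. colour_ffact y c (U - {u})) = ?m j * (ffact (y j) (?m j - 1) * ?rest)"
    by (simp add: 3)
  with 1 2 show ?thesis by (simp add: ffact_Suc_left algebra_simps)
qed

text \<open>The colour counts of \<open>N\<close> independent draws from \<open>\<kappa>\<close>, one draw at a time. The recursion makes
  the moments and the point probabilities accessible by induction on \<open>N\<close>.\<close>

primrec multinomial_pmf :: "'c pmf \<Rightarrow> nat \<Rightarrow> ('c \<Rightarrow> nat) pmf" where
  "multinomial_pmf \<kappa> 0 = return_pmf (\<lambda>_. 0)"
| "multinomial_pmf \<kappa> (Suc N) =
     bind_pmf \<kappa> (\<lambda>j. map_pmf (\<lambda>n. n(j := Suc (n j))) (multinomial_pmf \<kappa> N))"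

text \<open>Conditioning on the last draw: it is either not used, or it serves one \<open>u \<in> U\<close>, which requires
  the colour \<open>c u\<close>.\<close>

lemma nn_integral_multinomial_colour_ffact:
  assumes "finite U"
  shows "(\<integral>\<^sup>+n. of_nat (colour_ffact n c U) \<partial>measure_pmf (multinomial_pmf \<kappa> N)) =
    of_nat (ffact N (card U)) * (\<Prod>u\<in>U. ennreal (pmf \<kappa> (c u)))"
  using assms
proof (induction N arbitrary: U)
  case 0
  show ?case
  proof (cases "U = {}")
    case False
    then obtain u0 where "u0 \<in> U" by auto
    then have "colour_ffact (\<lambda>_. 0) c U = 0"
      using 0 by (intro colour_ffact_eq_0[of U u0]) (auto simp: card_gt_0_iff)
    moreover have "ffact 0 (card U) = 0" using False 0 by (intro ffact_eq_0) (simp add: card_gt_0_iff)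
    ultimately show ?thesis by simp
  qed simp
next
  case (Suc N)
  let ?E = "\<lambda>U. \<integral>\<^sup>+n. of_nat (colour_ffact n c U) \<partial>measure_pmf (multinomial_pmf \<kappa> N)"
  let ?p = "\<lambda>u. ennreal (pmf \<kappa> (c u))"
  have "(\<integral>\<^sup>+n. of_nat (colour_ffact n c U) \<partial>measure_pmf (multinomial_pmf \<kappa> (Suc N))) =
     (\<integral>\<^sup>+j. \<integral>\<^sup>+n. (of_nat (colour_ffact n c U) + (\<Sum>u\<in>U. indicator {c u} j * of_nat (colour_ffact n c (U - {u})))) \<partial>measure_pmf (multinomial_pmf \<kappa> N) \<partial>measure_pmf \<kappa>)"
  proof -
    have "(\<Sum>u\<in>{u\<in>U. c u = j}. of_nat (colour_ffact n c (U - {u}))) = (\<Sum>u\<in>U. indicator {c u} j * of_nat (colour_ffact n c (U - {u})) :: ennreal)" for j n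
      by (rule sum.mono_neutral_cong_left) (use Suc.prems in \<open>auto simp: indicator_def\<close>)
    then show ?thesis using Suc.prems
      by (simp add: colour_ffact_increment)
  qed
  also have "\<dots> = (\<integral>\<^sup>+j. ?E U + (\<Sum>u\<in>U. indicator {c u} j * ?E (U - {u})) \<partial>measure_pmf \<kappa>)"
    by (simp add: nn_integral_add nn_integral_sum nn_integral_cmult)
  also have "\<dots> = ?E U + (\<Sum>u\<in>U. ?p u * ?E (U - {u}))"
    by (simp add: nn_integral_add nn_integral_sum nn_integral_multc emeasure_pmf_single)
  also have "\<dots> = of_nat (ffact N (card U)) * (\<Prod>u\<in>U. ?p u) + (\<Sum>u\<in>U. of_nat (ffact N (card U - 1)) * (\<Prod>u\<in>U. ?p u))"
  proof -
    have "?p u * ?E (U - {u}) = of_nat (ffact N (card U - 1)) * (\<Prod>u\<in>U. ?p u)" if "u \<in> U" for u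
      using that Suc.prems Suc.IH[of "U - {u}"] by (simp add: prod.remove[of U u] mult_ac)
    then show ?thesis using Suc by simp
  qed
  also have "\<dots> = of_nat (ffact (Suc N) (card U)) * (\<Prod>u\<in>U. ?p u)"
    by (simp add: ffact_Suc_left algebra_simps)
  finally show ?case .
qed

lemma set_multinomial_pmf:
  assumes "finite R" "set_pmf \<kappa> \<subseteq> R" "n \<in> set_pmf (multinomial_pmf \<kappa> N)"
  shows "(\<Sum>i\<in>R. n i) = N" "\<And>i. i \<notin> R \<Longrightarrow> n i = 0"
proof -
  have "(\<Sum>i\<in>R. n i) = N \<and> (\<forall>i. i \<notin> R \<longrightarrow> n i = 0)"
    using assms(3)
  proof (induction N arbitrary: n)
    case (Suc N)
    then obtain j n' where j: "j \<in> set_pmf \<kappa>" "n' \<in> set_pmf (multinomial_pmf \<kappa> N)" "n = n'(j := Suc (n' j))"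
      by auto
    with assms have "j \<in> R" by auto
    then show ?case using Suc.IH[OF j(2)] assms(1) j(3)
      by (auto simp: sum.remove[of R j])
  qed simp
  then show "(\<Sum>i\<in>R. n i) = N" "\<And>i. i \<notin> R \<Longrightarrow> n i = 0" by auto
qed

text \<open>The last draw has colour \<open>j\<close> with conditional probability \<open>n j / (N + 1)\<close>, and these fractions add
  up to \<open>1\<close>.\<close>

lemma pmf_multinomial:
  assumes "finite R" "set_pmf \<kappa> \<subseteq> R" "(\<Sum>i\<in>R. n i) = N" "\<And>i. i \<notin> R \<Longrightarrow> n i = 0"
  shows "pmf (multinomial_pmf \<kappa> N) n = fact N / (\<Prod>i\<in>R. fact (n i)) * (\<Prod>i\<in>R. pmf \<kappa> i ^ n i)"
  using assms(3,4)
proof (induction N arbitrary: n)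
  case 0
  have "n i = 0" for i
    by (cases "i \<in> R") (use 0 assms(1) in auto)
  then have "n = (\<lambda>_. 0)" by auto
  then show ?case by simp
next
  case (Suc N)
  let ?c = "fact N / (\<Prod>i\<in>R. fact (n i)) * (\<Prod>i\<in>R. pmf \<kappa> i ^ n i)"
  have step: "pmf \<kappa> j * pmf (map_pmf (\<lambda>n. n(j := Suc (n j))) (multinomial_pmf \<kappa> N)) n = real (n j) * ?c"
    if j: "j \<in> R" for j
  proof (cases "n j = 0")
    case True
    have "n \<notin> (\<lambda>n. n(j := Suc (n j))) ` set_pmf (multinomial_pmf \<kappa> N)"
    proof
      assume "n \<in> (\<lambda>n. n(j := Suc (n j))) ` set_pmf (multinomial_pmf \<kappa> N)"
      then obtain m where "n = m(j := Suc (m j))" by blast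
      then have "n j = Suc (m j)" by simp
      with True show False by simp
    qed
    then show ?thesis using True by (simp add: pmf_map_outside)
  next
    case False
    define n' where "n' = n(j := n j - 1)"
    have n: "n = n'(j := Suc (n' j))" using False by (auto simp: n'_def)
    have inj: "inj (\<lambda>n :: _ \<Rightarrow> nat. n(j := Suc (n j)))"
    proof (rule injI)
      fix x y :: "_ \<Rightarrow> nat" assume *: "x(j := Suc (x j)) = y(j := Suc (y j))"
      show "x = y"
      proof
        fix k show "x k = y k" using fun_cong[OF *, of k] by (cases "k = j") auto
      qed
    qed
    have "pmf (map_pmf (\<lambda>n. n(j := Suc (n j))) (multinomial_pmf \<kappa> N)) n = pmf (multinomial_pmf \<kappa> N) n'"
      by (subst n) (rule pmf_map_inj'[OF inj, of _ n'])
    also have "\<dots> = fact N / (\<Prod>i\<in>R. fact (n' i)) * (\<Prod>i\<in>R. pmf \<kappa> i ^ n' i)"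
    proof (rule Suc.IH)
      show "(\<Sum>i\<in>R. n' i) = N"
        using Suc.prems(1) j assms(1) by (subst (asm) n) (simp add: sum.remove[of R j])
      show "n' i = 0" if "i \<notin> R" for i using Suc.prems(2)[OF that] that j by (auto simp: n'_def)
    qed
    finally have e: "pmf (map_pmf (\<lambda>n. n(j := Suc (n j))) (multinomial_pmf \<kappa> N)) n = fact N / (\<Prod>i\<in>R. fact (n' i)) * (\<Prod>i\<in>R. pmf \<kappa> i ^ n' i)" .
    have f1: "(\<Prod>i\<in>R. fact (n i)) = real (n j) * (\<Prod>i\<in>R. fact (n' i))"
    proof -
      have "(\<Prod>i\<in>R. fact (n i)) = fact (n j) * (\<Prod>i\<in>R - {j}. fact (n' i) :: real)"
        by (subst prod.remove[OF assms(1) j]) (simp add: n'_def)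
      also have "fact (n j) = real (n j) * fact (n' j)"
        using False by (simp add: n'_def fact_reduce)
      finally show ?thesis by (subst (2) prod.remove[OF assms(1) j]) simp
    qed
    have f2: "(\<Prod>i\<in>R. pmf \<kappa> i ^ n i) = pmf \<kappa> j * (\<Prod>i\<in>R. pmf \<kappa> i ^ n' i)"
    proof -
      have "(\<Prod>i\<in>R. pmf \<kappa> i ^ n i) = pmf \<kappa> j ^ n j * (\<Prod>i\<in>R - {j}. pmf \<kappa> i ^ n' i)"
        by (subst prod.remove[OF assms(1) j]) (simp add: n'_def)
      also have "pmf \<kappa> j ^ n j = pmf \<kappa> j * pmf \<kappa> j ^ n' j"
        using False by (simp add: n'_def power_eq_if)
      finally show ?thesis by (subst (2) prod.remove[OF assms(1) j]) simp
    qed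
    show ?thesis unfolding e f1 f2 using False by simp
  qed
  have "pmf (multinomial_pmf \<kappa> (Suc N)) n = (\<Sum>j\<in>R. pmf \<kappa> j * pmf (map_pmf (\<lambda>n. n(j := Suc (n j))) (multinomial_pmf \<kappa> N)) n)"
    by (simp add: pmf_bind) (subst integral_measure_pmf[of R], use assms in auto)
  also have "\<dots> = (\<Sum>j\<in>R. real (n j)) * ?c"
    unfolding sum_distrib_right by (rule sum.cong[OF refl], rule step)
  also have "(\<Sum>j\<in>R. real (n j)) = real (Suc N)" using arg_cong[OF Suc.prems(1), of real] by simp
  finally show ?case by simp
qed

text \<open>Shifting the summation index and using \<open>ffact_Suc_left\<close> shows that the moment \<open>L\<close> of order \<open>m + 1\<close>
  satisfies \<open>L = q * (L + (m + 1) * g)\<close>, where \<open>g\<close> is the moment of order \<open>m\<close>. The same identity for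
  partial sums, which increase, bounds them and yields convergence.\<close>

lemma geometric_factorial_moment_sums:
  fixes q :: real
  assumes q: "0 < q" "q < 1"
  shows "(\<lambda>N. real (ffact N m) * (q ^ N * (1 - q))) sums (fact m * (q / (1 - q)) ^ m)"
proof (induction m)
  case 0
  have "(\<lambda>N. q ^ N * (1 - q)) sums (1 / (1 - q) * (1 - q))"
    using q by (intro sums_mult2 geometric_sums) auto
  then show ?case using q by simp
next
  case (Suc m)
  let ?s = "\<lambda>m R. \<Sum>N<R. real (ffact N m) * (q ^ N * (1 - q))"
  let ?g = "fact m * (q / (1 - q)) ^ m"
  have rec: "?s (Suc m) (Suc R) = q * (?s (Suc m) R + Suc m * ?s m R)" for R
  proof -
    have "?s (Suc m) (Suc R) = (\<Sum>N<R. real (ffact (Suc N) (Suc m)) * (q ^ Suc N * (1 - q)))"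
      by (subst sum.lessThan_Suc_shift) (simp add: ffact_eq_0)
    also have "\<dots> = (\<Sum>N<R. q * (real (ffact N (Suc m)) * (q ^ N * (1 - q)) + Suc m * (real (ffact N m) * (q ^ N * (1 - q)))))"
      by (intro sum.cong refl) (simp add: ffact_Suc_left algebra_simps)
    also have "\<dots> = q * (?s (Suc m) R + Suc m * ?s m R)"
      by (simp only: sum_distrib_left[symmetric] sum.distrib)
    finally show ?thesis .
  qed
  have le: "?s m R \<le> ?g" for R
    using sum_le_suminf[OF sums_summable[OF Suc], of "{..<R}"] sums_unique[OF Suc] q by simp
  have mono: "?s (Suc m) R \<le> ?s (Suc m) (Suc R)" for R
    using q by simp
  have bnd: "?s (Suc m) R \<le> q * Suc m * ?g / (1 - q)" for R
  proof -
    have "?s (Suc m) R \<le> q * (?s (Suc m) R + Suc m * ?s m R)"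
      using mono[of R] unfolding rec .
    also have "\<dots> \<le> q * (?s (Suc m) R + Suc m * ?g)"
      using q le[of R] by (intro mult_left_mono add_mono) auto
    finally have "(1 - q) * ?s (Suc m) R \<le> q * Suc m * ?g" by (simp add: algebra_simps)
    then show ?thesis using q by (simp add: field_simps)
  qed
  have "summable (\<lambda>N. real (ffact N (Suc m)) * (q ^ N * (1 - q)))"
    by (rule bounded_imp_summable[where B = "q * Suc m * ?g / (1 - q)"])
       (use q bnd in \<open>auto simp: lessThan_Suc_atMost[symmetric] simp del: sum.lessThan_Suc\<close>)
  then obtain L where L: "(\<lambda>N. real (ffact N (Suc m)) * (q ^ N * (1 - q))) sums L" by auto
  then have "(\<lambda>R. ?s (Suc m) (Suc R)) \<longlonglongrightarrow> L"
    unfolding sums_def by (rule LIMSEQ_Suc)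
  moreover have "(\<lambda>R. q * (?s (Suc m) R + Suc m * ?s m R)) \<longlonglongrightarrow> q * (L + Suc m * ?g)"
    using L Suc unfolding sums_def by (intro tendsto_intros)
  ultimately have "L = q * (L + Suc m * ?g)" unfolding rec by (rule LIMSEQ_unique)
  then have "(1 - q) * L = q * (Suc m * ?g)" by (simp add: algebra_simps)
  then have "L = fact (Suc m) * (q / (1 - q)) ^ Suc m" using q by (simp add: field_simps)
  with L show ?case by simp
qed

text \<open>\<open>geometric_pmf p\<close> has mean \<open>(1 - p) / p\<close>, so mean \<open>l\<close> means \<open>p = 1 / (1 + l)\<close>.\<close>

definition geometric_multinomial_pmf :: "real \<Rightarrow> 'c pmf \<Rightarrow> ('c \<Rightarrow> nat) pmf" where
  "geometric_multinomial_pmf l \<kappa> = bind_pmf (geometric_pmf (1 / (1 + l))) (multinomial_pmf \<kappa>)"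

lemma nn_integral_geometric_multinomial_colour_ffact:
  assumes "finite U" "l > 0"
  shows "(\<integral>\<^sup>+n. of_nat (colour_ffact n c U) \<partial>measure_pmf (geometric_multinomial_pmf l \<kappa>)) =
    ennreal (fact (card U) * (\<Prod>u\<in>U. l * pmf \<kappa> (c u)))"
proof -
  let ?p = "1 / (1 + l)" and ?q = "l / (1 + l)"
  have p: "0 < ?p" "?p \<le> 1" "1 - ?p = ?q" "0 < ?q" "?q < 1" "1 - ?q = ?p" "?q / ?p = l"
    using assms by (auto simp: field_simps)
  have "(\<integral>\<^sup>+N. of_nat (ffact N (card U)) \<partial>measure_pmf (geometric_pmf ?p)) = (\<Sum>N. ennreal (real (ffact N (card U)) * (?q ^ N * ?p)))"
  proof -
    have "pmf (geometric_pmf ?p) N = ?q ^ N * ?p" for N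
    proof -
      have "pmf (geometric_pmf ?p) N = (1 - ?p) ^ N * ?p"
        by (rule pmf_geometric) (use p(1,2) in auto)
      then show ?thesis unfolding p(3) .
    qed
    moreover have "ennreal (?q ^ N * ?p) * of_nat (ffact N (card U)) = ennreal (real (ffact N (card U)) * (?q ^ N * ?p))" for N
      unfolding ennreal_of_nat_eq_real_of_nat by (subst ennreal_mult[symmetric]) (use p in \<open>auto simp: mult.commute\<close>)
    ultimately show ?thesis
      unfolding nn_integral_measure_pmf nn_integral_count_space_nat by simp
  qed
  also have "\<dots> = ennreal (fact (card U) * l ^ card U)"
    using geometric_factorial_moment_sums[of ?q "card U"] p by (intro suminf_ennreal_eq) auto
  finally have g: "(\<integral>\<^sup>+N. of_nat (ffact N (card U)) \<partial>measure_pmf (geometric_pmf ?p)) = ennreal (fact (card U) * l ^ card U)" .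
  have "(\<integral>\<^sup>+n. of_nat (colour_ffact n c U) \<partial>measure_pmf (geometric_multinomial_pmf l \<kappa>)) =
     ennreal (fact (card U) * l ^ card U) * (\<Prod>u\<in>U. ennreal (pmf \<kappa> (c u)))"
    unfolding geometric_multinomial_pmf_def
    using assms by (simp add: nn_integral_multinomial_colour_ffact nn_integral_multc g)
  also have "\<dots> = ennreal (fact (card U) * l ^ card U * (\<Prod>u\<in>U. pmf \<kappa> (c u)))"
    using assms by (simp add: prod_ennreal ennreal_mult prod_nonneg)
  finally show ?thesis by (simp add: prod.distrib mult_ac)
qed

lemma measure_geometric_multinomial_total:
  assumes "finite R" "set_pmf \<kappa> \<subseteq> R" "l > 0"
  shows "measure_pmf.prob (geometric_multinomial_pmf l \<kappa>) {n. (\<Sum>i\<in>R. n i) = s} = (l / (l + 1)) ^ s * (1 / (l + 1))"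
proof -
  have "map_pmf (\<lambda>n. \<Sum>i\<in>R. n i) (multinomial_pmf \<kappa> N) = return_pmf N" for N
  proof -
    have "map_pmf (\<lambda>n. \<Sum>i\<in>R. n i) (multinomial_pmf \<kappa> N) = map_pmf (\<lambda>n. N) (multinomial_pmf \<kappa> N)"
      by (rule map_pmf_cong) (use set_multinomial_pmf(1)[OF assms(1,2)] in auto)
    then show ?thesis by (simp add: map_pmf_const)
  qed
  then have "map_pmf (\<lambda>n. \<Sum>i\<in>R. n i) (geometric_multinomial_pmf l \<kappa>) = geometric_pmf (1 / (1 + l))"
    by (simp add: geometric_multinomial_pmf_def map_bind_pmf bind_return_pmf')
  then have "pmf (geometric_pmf (1 / (1 + l))) s = measure_pmf.prob (geometric_multinomial_pmf l \<kappa>) ((\<lambda>n. \<Sum>i\<in>R. n i) -` {s})"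
    by (simp flip: pmf_map)
  then have "pmf (geometric_pmf (1 / (1 + l))) s = measure_pmf.prob (geometric_multinomial_pmf l \<kappa>) {n. (\<Sum>i\<in>R. n i) = s}"
    by (simp add: vimage_def)
  moreover have "pmf (geometric_pmf (1 / (1 + l))) s = (1 - 1 / (1 + l)) ^ s * (1 / (1 + l))"
    using assms by (intro pmf_geometric) auto
  moreover have "1 - 1 / (1 + l) = l / (l + 1)" using assms by (simp add: field_simps)
  ultimately show ?thesis by (simp add: add.commute)
qed

lemma measure_geometric_multinomial_point:
  assumes "finite R" "set_pmf \<kappa> \<subseteq> R" "l > 0" "(\<Sum>i\<in>R. n i) = N"
  shows "measure_pmf.prob (geometric_multinomial_pmf l \<kappa>) {x. \<forall>i\<in>R. x i = n i} =
    (l / (l + 1)) ^ N * (1 / (l + 1)) * (fact N / (\<Prod>i\<in>R. fact (n i)) * (\<Prod>i\<in>R. pmf \<kappa> i ^ n i))"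
proof -
  define n' where "n' = (\<lambda>i. if i \<in> R then n i else 0)"
  have n': "(\<Sum>i\<in>R. n' i) = N" "\<And>i. i \<notin> R \<Longrightarrow> n' i = 0"
    using assms(4) by (auto simp: n'_def)
  have "measure_pmf.prob (geometric_multinomial_pmf l \<kappa>) {x. \<forall>i\<in>R. x i = n i} = measure_pmf.prob (geometric_multinomial_pmf l \<kappa>) {n'}"
  proof (rule measure_pmf.finite_measure_eq_AE)
    show "AE x in measure_pmf (geometric_multinomial_pmf l \<kappa>). (x \<in> {x. \<forall>i\<in>R. x i = n i}) = (x \<in> {n'})"
    proof (rule AE_pmfI)
      fix x assume "x \<in> set_pmf (geometric_multinomial_pmf l \<kappa>)"
      then have "x i = 0" if "i \<notin> R" for i
        using set_multinomial_pmf(2)[OF assms(1,2) _ that] by (auto simp: geometric_multinomial_pmf_def)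
      then show "(x \<in> {x. \<forall>i\<in>R. x i = n i}) = (x \<in> {n'})"
        by (auto simp: n'_def fun_eq_iff)
    qed
  qed auto
  also have "\<dots> = pmf (geometric_multinomial_pmf l \<kappa>) n'" by (simp add: pmf.rep_eq)
  also have "\<dots> = measure_pmf.expectation (geometric_pmf (1 / (1 + l))) (\<lambda>M. pmf (multinomial_pmf \<kappa> M) n')"
    by (simp add: geometric_multinomial_pmf_def pmf_bind)
  also have "\<dots> = measure_pmf.expectation (geometric_pmf (1 / (1 + l))) (\<lambda>M. indicator {N} M * pmf (multinomial_pmf \<kappa> N) n')"
  proof (rule Bochner_Integration.integral_cong[OF refl])
    fix M
    have "pmf (multinomial_pmf \<kappa> M) n' = 0" if "M \<noteq> N"
      using set_multinomial_pmf(1)[OF assms(1,2), of n' M] n' that by (auto simp: set_pmf_iff)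
    then show "pmf (multinomial_pmf \<kappa> M) n' = indicator {N} M * pmf (multinomial_pmf \<kappa> N) n'"
      by (auto simp: indicator_def)
  qed
  also have "\<dots> = pmf (geometric_pmf (1 / (1 + l))) N * pmf (multinomial_pmf \<kappa> N) n'"
    by (simp add: pmf.rep_eq)
  also have "pmf (geometric_pmf (1 / (1 + l))) N = (l / (l + 1)) ^ N * (1 / (l + 1))"
  proof -
    have "pmf (geometric_pmf (1 / (1 + l))) N = (1 - 1 / (1 + l)) ^ N * (1 / (1 + l))"
      using assms by (intro pmf_geometric) auto
    moreover have "1 - 1 / (1 + l) = l / (l + 1)" using assms by (simp add: field_simps)
    ultimately show ?thesis by (simp add: add.commute)
  qed
  also have "pmf (multinomial_pmf \<kappa> N) n' = fact N / (\<Prod>i\<in>R. fact (n i)) * (\<Prod>i\<in>R. pmf \<kappa> i ^ n i)"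
    using pmf_multinomial[OF assms(1,2) n'] by (simp add: n'_def)
  finally show ?thesis .
qed

section \<open>Square-integrable functions and Bessel inequality\<close>

text \<open>Square-integrability and the inner product on the whole space; functions on a subset are treated by
  multiplying them with its indicator.\<close>

abbreviation L2s :: "'a measure \<Rightarrow> ('a \<Rightarrow> complex) \<Rightarrow> bool" where
  "L2s M \<equiv> L2 M UNIV"

abbreviation ip :: "'a measure \<Rightarrow> ('a \<Rightarrow> complex) \<Rightarrow> ('a \<Rightarrow> complex) \<Rightarrow> complex" where
  "ip M \<equiv> L2_inner M UNIV"

definition nsq :: "'a measure \<Rightarrow> ('a \<Rightarrow> complex) \<Rightarrow> real" where
  "nsq M f = (LINT x|M. (cmod (f x))\<^sup>2)"

lemma L2s_iff: "L2s M f \<longleftrightarrow> f \<in> borel_measurable M \<and> integrable M (\<lambda>x. (cmod (f x))\<^sup>2)"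
  by (simp add: L2_def set_borel_measurable_def set_integrable_def)

lemma ip_eq: "ip M f g = (LINT x|M. f x * cnj (g x))"
  by (simp add: L2_inner_def set_lebesgue_integral_def)

lemma L2sD:
  assumes "L2s M f"
  shows "f \<in> borel_measurable M" "integrable M (\<lambda>x. (cmod (f x))\<^sup>2)"
  using assms by (simp_all add: L2s_iff)

lemma cmod_mult_le: "cmod (a * b) \<le> ((cmod a)\<^sup>2 + (cmod b)\<^sup>2) / 2"
  using sum_squares_bound[of "cmod a" "cmod b"] by (simp add: norm_mult)

lemma L2s_integrable_mult:
  assumes "L2s M f" "L2s M g"
  shows "integrable M (\<lambda>x. f x * g x)"
proof (rule Bochner_Integration.integrable_bound)
  note [measurable] = L2sD(1)[OF assms(1)] L2sD(1)[OF assms(2)]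
  show "(\<lambda>x. f x * g x) \<in> borel_measurable M" by simp
  show "integrable M (\<lambda>x. ((cmod (f x))\<^sup>2 + (cmod (g x))\<^sup>2) / 2)"
    using L2sD(2)[OF assms(1)] L2sD(2)[OF assms(2)] by simp
  show "AE x in M. cmod (f x * g x) \<le> norm (((cmod (f x))\<^sup>2 + (cmod (g x))\<^sup>2) / 2)"
  proof (intro AE_I2)
    fix x show "cmod (f x * g x) \<le> norm (((cmod (f x))\<^sup>2 + (cmod (g x))\<^sup>2) / 2)"
      using cmod_mult_le[of "f x" "g x"] by simp
  qed
qed

lemma L2s_cnj: "L2s M f \<Longrightarrow> L2s M (\<lambda>x. cnj (f x))"
  unfolding L2s_iff by (auto intro: borel_measurable_continuous_on simp: measurable_compose[OF _ borel_measurable_continuous_onI[of cnj], OF _ continuous_on_cnj[OF continuous_on_id]])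

lemma L2s_integrable:
  assumes "L2s M f" "L2s M g"
  shows "integrable M (\<lambda>x. f x * cnj (g x))"
  using L2s_integrable_mult[OF assms(1) L2s_cnj[OF assms(2)]] .

lemma L2s_add:
  assumes "L2s M f" "L2s M g"
  shows "L2s M (\<lambda>x. f x + g x)"
  unfolding L2s_iff
proof
  note [measurable] = L2sD(1)[OF assms(1)] L2sD(1)[OF assms(2)]
  show m: "(\<lambda>x. f x + g x) \<in> borel_measurable M" by simp
  show "integrable M (\<lambda>x. (cmod (f x + g x))\<^sup>2)"
  proof (rule Bochner_Integration.integrable_bound)
    show "integrable M (\<lambda>x. 2 * (cmod (f x))\<^sup>2 + 2 * (cmod (g x))\<^sup>2)"
      using L2sD(2)[OF assms(1)] L2sD(2)[OF assms(2)] by simp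
    show "AE x in M. norm ((cmod (f x + g x))\<^sup>2) \<le> norm (2 * (cmod (f x))\<^sup>2 + 2 * (cmod (g x))\<^sup>2)"
    proof (intro AE_I2)
      fix x
      have "(cmod (f x + g x))\<^sup>2 \<le> (cmod (f x) + cmod (g x))\<^sup>2"
        by (intro power_mono norm_triangle_ineq) auto
      also have "\<dots> \<le> 2 * (cmod (f x))\<^sup>2 + 2 * (cmod (g x))\<^sup>2"
        using sum_squares_bound[of "cmod (f x)" "cmod (g x)"] by (simp add: power2_sum)
      finally show "norm ((cmod (f x + g x))\<^sup>2) \<le> norm (2 * (cmod (f x))\<^sup>2 + 2 * (cmod (g x))\<^sup>2)" by simp
    qed
  qed simp
qed

lemma L2s_cmult: "L2s M f \<Longrightarrow> L2s M (\<lambda>x. c * f x)"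
  unfolding L2s_iff by (auto simp: norm_mult power_mult_distrib)

lemma L2s_zero: "L2s M (\<lambda>x. 0)"
  by (simp add: L2s_iff)

lemma L2s_sum:
  assumes "\<And>i. i \<in> F \<Longrightarrow> L2s M (f i)"
  shows "L2s M (\<lambda>x. \<Sum>i\<in>F. f i x)"
  using assms by (induction F rule: infinite_finite_induct) (auto intro: L2s_add L2s_zero)

lemma L2s_diff: "L2s M f \<Longrightarrow> L2s M g \<Longrightarrow> L2s M (\<lambda>x. f x - g x)"
  using L2s_add[of M f "\<lambda>x. (-1) * g x"] L2s_cmult[of M g "-1"] by simp

lemma L2s_indicator:
  assumes "A \<in> sets M" "L2s M f"
  shows "L2s M (\<lambda>x. indicator A x * f x)"
  unfolding L2s_iff
proof
  have "(\<lambda>x. (cmod (indicator A x * f x))\<^sup>2) = (\<lambda>x. indicator A x *\<^sub>R (cmod (f x))\<^sup>2)"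
    by (auto simp: indicator_def)
  then show "integrable M (\<lambda>x. (cmod (indicator A x * f x))\<^sup>2)"
    using integrable_mult_indicator[OF assms(1) L2sD(2)[OF assms(2)]] by simp
  show "(\<lambda>x. indicator A x * f x) \<in> borel_measurable M"
    using assms L2sD(1)[OF assms(2)] by measurable
qed

lemma ip_add_left: "L2s M f \<Longrightarrow> L2s M g \<Longrightarrow> L2s M h \<Longrightarrow> ip M (\<lambda>x. f x + g x) h = ip M f h + ip M g h"
  unfolding ip_eq by (simp add: L2s_integrable distrib_right)

lemma ip_cmult_left: "ip M (\<lambda>x. c * f x) h = c * ip M f h"
  unfolding ip_eq by (simp add: mult.assoc)

lemma ip_commute: "ip M f g = cnj (ip M g f)"
  unfolding ip_eq by (subst Bochner_Integration.integral_cnj[symmetric]) (simp add: mult.commute)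

lemma ip_add_right: "L2s M f \<Longrightarrow> L2s M g \<Longrightarrow> L2s M h \<Longrightarrow> ip M h (\<lambda>x. f x + g x) = ip M h f + ip M h g"
  unfolding ip_eq by (simp add: L2s_integrable distrib_left)

lemma ip_cmult_right: "ip M h (\<lambda>x. c * f x) = cnj c * ip M h f"
  unfolding ip_eq by (simp add: mult.left_commute)

lemma ip_sum_left:
  assumes "\<And>i. i \<in> F \<Longrightarrow> L2s M (f i)" "L2s M h"
  shows "ip M (\<lambda>x. \<Sum>i\<in>F. f i x) h = (\<Sum>i\<in>F. ip M (f i) h)"
  using assms(1)
proof (induction F rule: infinite_finite_induct)
  case (insert x F)
  then show ?case using assms(2) by (simp add: ip_add_left L2s_sum)
qed (simp_all add: ip_eq)

lemma ip_sum_right: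
  assumes "\<And>i. i \<in> F \<Longrightarrow> L2s M (f i)" "L2s M h"
  shows "ip M h (\<lambda>x. \<Sum>i\<in>F. f i x) = (\<Sum>i\<in>F. ip M h (f i))"
  using assms(1)
proof (induction F rule: infinite_finite_induct)
  case (insert x F)
  then show ?case using assms(2) by (simp add: ip_add_right L2s_sum)
qed (simp_all add: ip_eq)

lemma ip_diff_left: "L2s M f \<Longrightarrow> L2s M g \<Longrightarrow> L2s M h \<Longrightarrow> ip M (\<lambda>x. f x - g x) h = ip M f h - ip M g h"
  using ip_add_left[of M f "\<lambda>x. (-1) * g x" h] ip_cmult_left[of M "-1" g h] L2s_cmult[of M g "-1"] by simp

lemma ip_diff_right: "L2s M f \<Longrightarrow> L2s M g \<Longrightarrow> L2s M h \<Longrightarrow> ip M h (\<lambda>x. f x - g x) = ip M h f - ip M h g"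
  using ip_add_right[of M f "\<lambda>x. (-1) * g x" h] ip_cmult_right[of M h "-1" g] L2s_cmult[of M g "-1"] by simp

lemma ip_cong_AE:
  assumes "L2s M f" "L2s M f'" "L2s M g" "L2s M g'" "AE x in M. f x = f' x" "AE x in M. g x = g' x"
  shows "ip M f g = ip M f' g'"
  unfolding ip_eq
proof (rule integral_cong_AE)
  show "(\<lambda>x. f x * cnj (g x)) \<in> borel_measurable M" "(\<lambda>x. f' x * cnj (g' x)) \<in> borel_measurable M"
    using L2s_integrable assms by (auto intro: borel_measurable_integrable)
  show "AE x in M. f x * cnj (g x) = f' x * cnj (g' x)"
    using assms(5,6) by eventually_elim auto
qed

lemma ip_self: "ip M f f = of_real (nsq M f)"
  unfolding ip_eq nsq_def by (simp add: complex_norm_square[symmetric] flip: of_real_power)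

lemma nsq_nonneg [simp]: "nsq M f \<ge> 0"
  by (simp add: nsq_def)

lemma nsq_eq_0_iff: "L2s M f \<Longrightarrow> nsq M f = 0 \<longleftrightarrow> (AE x in M. f x = 0)"
  unfolding nsq_def by (subst integral_nonneg_eq_0_iff_AE) (auto dest: L2sD)

lemma nsq_cong_AE: "L2s M f \<Longrightarrow> L2s M g \<Longrightarrow> AE x in M. f x = g x \<Longrightarrow> nsq M f = nsq M g"
  using ip_cong_AE[of M f g f g] by (simp add: ip_self)

lemma nsq_add_cmult:
  assumes "L2s M f" "L2s M g"
  shows "nsq M (\<lambda>x. f x + z * g x) = nsq M f + 2 * Re (cnj z * ip M f g) + (cmod z)\<^sup>2 * nsq M g"
proof -
  have zg: "L2s M (\<lambda>x. z * g x)" using assms L2s_cmult by blast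
  have "complex_of_real (nsq M (\<lambda>x. f x + z * g x)) = ip M f f + z * ip M g f + (cnj z * ip M f g + z * cnj z * ip M g g)"
    unfolding ip_self[symmetric] using assms zg L2s_add[OF assms(1) zg]
    by (simp add: ip_add_left ip_add_right ip_cmult_left ip_cmult_right algebra_simps)
  also have "z * ip M g f = cnj (cnj z * ip M f g)" by (simp add: ip_commute[of M g f])
  finally have "nsq M (\<lambda>x. f x + z * g x) = Re (ip M f f + cnj (cnj z * ip M f g) + (cnj z * ip M f g + z * cnj z * ip M g g))"
    by (metis Re_complex_of_real)
  also have "z * cnj z * ip M g g = of_real ((cmod z)\<^sup>2 * nsq M g)"
    by (simp only: ip_self of_real_mult complex_norm_square)
  finally show ?thesis by (simp add: ip_self)
qed

lemma nsq_cmult: "nsq M (\<lambda>x. c * f x) = (cmod c)\<^sup>2 * nsq M f"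
  by (simp add: nsq_def norm_mult power_mult_distrib)

text \<open>Choosing \<open>z = - t * w\<close> with a small \<open>t > 0\<close> makes the linear term dominate. This is how first-order
  conditions are read off at a maximum of a quadratic form.\<close>

lemma nonneg_quadratic_imp_zero:
  fixes w :: complex and c :: real
  assumes "\<And>z. 0 \<le> 2 * Re (cnj z * w) + (cmod z)\<^sup>2 * c"
  shows "w = 0"
proof (rule ccontr)
  assume "w \<noteq> 0"
  then have w: "(cmod w)\<^sup>2 > 0" by simp
  \<comment> \<open>small enough for \<open>t * c < 2\<close>\<close>
  define t where "t = 1 / (\<bar>c\<bar> + 1)"
  have t: "t > 0" "t * c < 2" by (auto simp: t_def field_simps)
  have "Re (cnj (- of_real t * w) * w) = - t * (cmod w)\<^sup>2"
    by (simp add: cmod_power2) (simp add: power2_eq_square algebra_simps)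
  moreover have "(cmod (- of_real t * w))\<^sup>2 = t\<^sup>2 * (cmod w)\<^sup>2"
    by (simp add: norm_mult power_mult_distrib)
  ultimately have "0 \<le> 2 * (- t * (cmod w)\<^sup>2) + t\<^sup>2 * (cmod w)\<^sup>2 * c"
    using assms[of "- of_real t * w"] by simp
  also have "\<dots> = (t * (cmod w)\<^sup>2) * (t * c - 2)" by (simp add: power2_eq_square algebra_simps)
  also have "\<dots> < 0" using t w by (intro mult_pos_neg mult_pos_pos) auto
  finally show False by simp
qed

lemma Cauchy_Schwarz_ip:
  assumes "L2s M f" "L2s M g"
  shows "(cmod (ip M f g))\<^sup>2 \<le> nsq M f * nsq M g"
proof (cases "nsq M g = 0")
  case True
  have "ip M f g = 0"
  proof -
    have "ip M f g = ip M f (\<lambda>_. 0)"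
      using True assms by (intro ip_cong_AE) (auto simp: nsq_eq_0_iff L2s_zero)
    then show ?thesis by (simp add: ip_eq)
  qed
  then show ?thesis by simp
next
  case False
  then have pos: "nsq M g > 0" using nsq_nonneg[of M g] by linarith
  define z where "z = - ip M f g / of_real (nsq M g)"
  have "0 \<le> nsq M (\<lambda>x. f x + z * g x)" by simp
  also have "\<dots> = nsq M f + 2 * Re (cnj z * ip M f g) + (cmod z)\<^sup>2 * nsq M g"
    by (rule nsq_add_cmult[OF assms])
  also have "cnj z * ip M f g = of_real (- (cmod (ip M f g))\<^sup>2 / nsq M g)"
    by (simp add: z_def complex_norm_square mult.commute flip: of_real_power)
  also have "(cmod z)\<^sup>2 * nsq M g = (cmod (ip M f g))\<^sup>2 / nsq M g"
    using pos by (simp add: z_def norm_divide power2_eq_square)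
  finally show ?thesis using pos by (simp add: field_simps)
qed

abbreviation ortho :: "'a measure \<Rightarrow> nat set \<Rightarrow> (nat \<Rightarrow> 'a \<Rightarrow> complex) \<Rightarrow> bool" where
  "ortho M \<equiv> L2_orthonormal M UNIV"

lemma orthoD:
  assumes "ortho M I e"
  shows "\<And>k. k \<in> I \<Longrightarrow> L2s M (e k)" "\<And>k l. k \<in> I \<Longrightarrow> l \<in> I \<Longrightarrow> ip M (e k) (e l) = (if k = l then 1 else 0)"
  using assms by (auto simp: L2_orthonormal_def)

lemma nsq_orthonormal:
  assumes "ortho M I e" "k \<in> I"
  shows "nsq M (e k) = 1"
proof -
  have "complex_of_real (nsq M (e k)) = 1" using orthoD(2)[OF assms(1,2,2)] by (simp add: ip_self)
  then show ?thesis by simp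
qed

text \<open>Pythagoras: subtracting the projection onto one more member \<open>e a\<close> lowers the squared norm by the
  square of the coefficient.\<close>

lemma nsq_residual:
  assumes e: "ortho M I e" and F: "finite F" "F \<subseteq> I" and f: "L2s M f"
  shows "nsq M (\<lambda>x. f x - (\<Sum>k\<in>F. ip M f (e k) * e k x)) = nsq M f - (\<Sum>k\<in>F. (cmod (ip M f (e k)))\<^sup>2)"
  using F
proof (induction F)
  case (insert a F)
  let ?g = "\<lambda>x. f x - (\<Sum>k\<in>F. ip M f (e k) * e k x)"
  let ?c = "ip M f (e a)"
  have ea: "L2s M (e a)" using insert orthoD(1)[OF e] by auto
  have s: "L2s M (\<lambda>x. \<Sum>k\<in>F. ip M f (e k) * e k x)"
    by (intro L2s_sum L2s_cmult) (use insert orthoD(1)[OF e] in auto)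
  have "ip M ?g (e a) = ?c - (\<Sum>k\<in>F. ip M f (e k) * ip M (e k) (e a))"
    by (subst ip_diff_left[OF f s ea], subst ip_sum_left) (use insert orthoD(1)[OF e] ea in \<open>auto simp: ip_cmult_left intro!: L2s_cmult\<close>)
  also have "(\<Sum>k\<in>F. ip M f (e k) * ip M (e k) (e a)) = 0"
  proof (rule sum.neutral, rule ballI)
    fix k assume "k \<in> F"
    then have "k \<in> I" "a \<in> I" "k \<noteq> a" using insert by auto
    then show "ip M f (e k) * ip M (e k) (e a) = 0" using orthoD(2)[OF e] by simp
  qed
  finally have ga: "ip M ?g (e a) = ?c" by simp
  have na: "nsq M (e a) = 1" by (rule nsq_orthonormal[OF e]) (use insert in simp)
  have "nsq M (\<lambda>x. f x - (\<Sum>k\<in>insert a F. ip M f (e k) * e k x)) = nsq M (\<lambda>x. ?g x + (- ?c) * e a x)"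
    using insert by (simp add: algebra_simps)
  also have "\<dots> = nsq M ?g + 2 * Re (cnj (- ?c) * ?c) + (cmod (- ?c))\<^sup>2 * 1"
    using nsq_add_cmult[OF L2s_diff[OF f s] ea, of "- ?c"] unfolding ga na .
  also have "cnj (- ?c) * ?c = - of_real ((cmod ?c)\<^sup>2)"
    by (simp only: complex_norm_square) (simp add: mult.commute)
  finally show ?case using insert by simp
qed simp

lemma Bessel:
  assumes "ortho M I e" "finite F" "F \<subseteq> I" "L2s M f"
  shows "(\<Sum>k\<in>F. (cmod (ip M f (e k)))\<^sup>2) \<le> nsq M f"
  using nsq_residual[OF assms] nsq_nonneg[of M "\<lambda>x. f x - (\<Sum>k\<in>F. ip M f (e k) * e k x)"] by linarith

section \<open>Completeness and Parseval identity\<close>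

lemma ip_orthonormal_sum:
  assumes e: "ortho M I e" and F: "finite F" "F \<subseteq> I" and i: "i \<in> I"
  shows "ip M (\<lambda>x. \<Sum>k\<in>F. c k * e k x) (e i) = (if i \<in> F then c i else 0)"
proof -
  have "ip M (\<lambda>x. \<Sum>k\<in>F. c k * e k x) (e i) = (\<Sum>k\<in>F. c k * ip M (e k) (e i))"
    by (subst ip_sum_left) (use F i orthoD(1)[OF e] in \<open>auto simp: ip_cmult_left intro!: L2s_cmult\<close>)
  also have "\<dots> = (\<Sum>k\<in>F. if k = i then c i else 0)"
    by (rule sum.cong) (use F i orthoD(2)[OF e] in \<open>auto dest: subsetD\<close>)
  finally show ?thesis using F by (simp add: sum.delta)
qed

lemma nsq_orthonormal_sum:
  assumes e: "ortho M I e" and F: "finite F" "F \<subseteq> I"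
  shows "nsq M (\<lambda>x. \<Sum>k\<in>F. c k * e k x) = (\<Sum>k\<in>F. (cmod (c k))\<^sup>2)"
proof -
  let ?g = "\<lambda>x. \<Sum>k\<in>F. c k * e k x"
  have g: "L2s M ?g" by (intro L2s_sum L2s_cmult) (use F orthoD(1)[OF e] in auto)
  have *: "ip M ?g (e k) = c k" if "k \<in> F" for k
    using ip_orthonormal_sum[OF e F, of k c] that F by auto
  have "(\<Sum>k\<in>F. ip M ?g (e k) * e k x) = ?g x" for x
    by (rule sum.cong) (use * in auto)
  moreover have "(\<Sum>k\<in>F. (cmod (ip M ?g (e k)))\<^sup>2) = (\<Sum>k\<in>F. (cmod (c k))\<^sup>2)"
    by (rule sum.cong) (use * in auto)
  ultimately have "nsq M (\<lambda>x. ?g x - ?g x) = nsq M ?g - (\<Sum>k\<in>F. (cmod (c k))\<^sup>2)"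
    using nsq_residual[OF e F g] by simp
  then show ?thesis by (simp add: nsq_def)
qed

lemma nn_integral_nsq: "L2s M f \<Longrightarrow> (\<integral>\<^sup>+x. ennreal ((cmod (f x))\<^sup>2) \<partial>M) = ennreal (nsq M f)"
  unfolding nsq_def by (rule nn_integral_eq_integral) (auto dest: L2sD)

lemma L2s_of_nn_integral:
  assumes "f \<in> borel_measurable M" "(\<integral>\<^sup>+x. ennreal ((cmod (f x))\<^sup>2) \<partial>M) \<le> ennreal c" "c \<ge> 0"
  shows "L2s M f" "nsq M f \<le> c"
proof -
  have "(\<integral>\<^sup>+x. ennreal ((cmod (f x))\<^sup>2) \<partial>M) < \<infinity>"
    using assms(2) by (simp add: le_less_trans)
  then show f: "L2s M f" unfolding L2s_iff using assms(1)
    by (auto intro!: integrableI_bounded)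
  show "nsq M f \<le> c"
    using assms(2,3) unfolding nn_integral_nsq[OF f] by simp
qed

lemma Bessel_summable:
  assumes "ortho M I e" "L2s M f"
  shows "summable (\<lambda>i. if i \<in> I then (cmod (ip M f (e i)))\<^sup>2 else 0)"
    and "(\<Sum>i. if i \<in> I then (cmod (ip M f (e i)))\<^sup>2 else 0) \<le> nsq M f"
proof -
  let ?a = "\<lambda>i. if i \<in> I then (cmod (ip M f (e i)))\<^sup>2 else 0"
  have bnd: "(\<Sum>i<n. ?a i) \<le> nsq M f" for n
  proof -
    have "(\<Sum>i<n. ?a i) = (\<Sum>i\<in>{i\<in>I. i < n}. (cmod (ip M f (e i)))\<^sup>2)"
      by (rule sum.mono_neutral_cong_right) auto
    also have "\<dots> \<le> nsq M f" by (rule Bessel[OF assms(1) _ _ assms(2)]) auto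
    finally show ?thesis .
  qed
  show s: "summable ?a"
    by (rule bounded_imp_summable[where B = "nsq M f"]) (use bnd in \<open>auto simp: lessThan_Suc_atMost[symmetric] simp del: sum.lessThan_Suc\<close>)
  show "(\<Sum>i. ?a i) \<le> nsq M f"
    by (rule suminf_le_const[OF s]) (rule bnd)
qed

lemma fast_subsequence:
  fixes a :: "nat \<Rightarrow> real"
  assumes "summable a" "\<And>i. a i \<ge> 0"
  obtains r where "strict_mono r" "\<And>k m. r k \<le> m \<Longrightarrow> (\<Sum>i\<in>{r k..<m}. a i) \<le> (1 / 4) ^ k"
proof -
  have ex: "\<exists>N. \<forall>m. (\<Sum>i\<in>{N..<m}. a i) \<le> (1 / 4) ^ k" for k
  proof -
    obtain N where N: "\<And>m n. m \<ge> N \<Longrightarrow> norm (sum a {m..<n}) < (1 / 4) ^ k"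
      using assms(1) unfolding summable_Cauchy by (metis zero_less_divide_1_iff zero_less_numeral zero_less_power)
    then show ?thesis by (metis abs_le_D1 less_imp_le order_refl real_norm_def)
  qed
  then obtain N where N: "\<And>k m. (\<Sum>i\<in>{N k..<m}. a i) \<le> (1 / 4) ^ k" by metis
  \<comment> \<open>a strictly increasing choice with \<open>r k \<ge> N k\<close>\<close>
  define r where "r k = (\<Sum>j\<le>k. Suc (N j))" for k
  show ?thesis
  proof
    show "strict_mono r" unfolding strict_mono_Suc_iff by (simp add: r_def)
    fix k m
    have "N k \<le> r k" by (cases k) (auto simp: r_def)
    then have "(\<Sum>i\<in>{r k..<m}. a i) \<le> (\<Sum>i\<in>{N k..<m}. a i)"
      by (intro sum_mono2) (use assms in auto)
    with N[of k m] show "(\<Sum>i\<in>{r k..<m}. a i) \<le> (1 / 4) ^ k" by linarith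
  qed
qed

text \<open>The increments \<open>d k\<close> satisfy \<open>cmod (d k) \<le> ((1/2) ^ k + 2 ^ k * (cmod (d k))\<^sup>2) / 2\<close>, and the
  weighted squares on the right have a finite integral, so they are summable at almost every point.\<close>

lemma AE_convergent_of_fast_L2:
  assumes s: "\<And>k. L2s M (s k)" and fast: "\<And>k. nsq M (\<lambda>x. s (Suc k) x - s k x) \<le> (1 / 4) ^ k"
  shows "AE x in M. convergent (\<lambda>k. s k x)"
proof -
  define d where "d k x = s (Suc k) x - s k x" for k x
  have d: "L2s M (d k)" for k unfolding d_def by (intro L2s_diff s)
  note [measurable] = L2sD(1)[OF d]
  have "(\<integral>\<^sup>+x. (\<Sum>k. ennreal (2 ^ k * (cmod (d k x))\<^sup>2)) \<partial>M) = (\<Sum>k. ennreal (2 ^ k) * ennreal (nsq M (d k)))"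
    by (subst nn_integral_suminf) (auto simp: ennreal_mult nn_integral_cmult nn_integral_nsq[OF d])
  also have "\<dots> \<le> (\<Sum>k. ennreal ((1 / 2) ^ k))"
  proof (rule suminf_le)
    fix k
    have "2 ^ k * nsq M (d k) \<le> 2 ^ k * (1 / 4) ^ k"
      using fast[of k] unfolding d_def by (intro mult_left_mono) auto
    also have "(2::real) ^ k * (1 / 4) ^ k = (1 / 2) ^ k"
      by (simp flip: power_mult_distrib)
    finally show "ennreal (2 ^ k) * ennreal (nsq M (d k)) \<le> ennreal ((1 / 2) ^ k)"
      by (simp flip: ennreal_mult)
  qed auto
  also have "\<dots> < \<top>"
    by (subst suminf_ennreal2) (auto simp: summable_geometric)
  finally have "(\<integral>\<^sup>+x. (\<Sum>k. ennreal (2 ^ k * (cmod (d k x))\<^sup>2)) \<partial>M) \<noteq> \<infinity>" by simp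
  then have "AE x in M. (\<Sum>k. ennreal (2 ^ k * (cmod (d k x))\<^sup>2)) \<noteq> \<infinity>"
    by (rule nn_integral_noteq_infinite[rotated]) simp
  then show ?thesis
  proof eventually_elim
    case (elim x)
    then have "summable (\<lambda>k. 2 ^ k * (cmod (d k x))\<^sup>2)"
      by (intro summable_suminf_not_top) auto
    then have "summable (\<lambda>k. ((1 / 2) ^ k + 2 ^ k * (cmod (d k x))\<^sup>2) / 2)"
      by (intro summable_divide summable_add) (auto simp: summable_geometric)
    moreover have "norm (d k x) \<le> ((1 / 2) ^ k + 2 ^ k * (cmod (d k x))\<^sup>2) / 2" for k
    proof -
      have "0 \<le> (1 - 2 ^ k * cmod (d k x))\<^sup>2" by simp
      then have "2 * 2 ^ k * cmod (d k x) \<le> 1 + 2 ^ k * 2 ^ k * (cmod (d k x))\<^sup>2"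
        by (simp add: power2_eq_square algebra_simps)
      then have "(1 / 2) ^ k * (2 * 2 ^ k * cmod (d k x)) \<le> (1 / 2) ^ k * (1 + 2 ^ k * 2 ^ k * (cmod (d k x))\<^sup>2)"
        by (intro mult_left_mono) auto
      then show ?thesis by (simp add: power_divide field_simps)
    qed
    ultimately have "summable (\<lambda>k. d k x)"
      by (rule summable_comparison_test'[where N = 0])
    then have "convergent (\<lambda>n. \<Sum>k<n. d k x)" by (simp add: summable_iff_convergent)
    then have "convergent (\<lambda>n. s 0 x + (\<Sum>k<n. d k x))"
      by (intro convergent_add convergent_const)
    moreover have "s 0 x + (\<Sum>k<n. d k x) = s n x" for n
      by (induction n) (auto simp: d_def algebra_simps)
    ultimately show ?case by simp
  qed
qed

text \<open>The almost everywhere limit is also the limit in \<open>L2\<close>, by Fatou's lemma.\<close>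

lemma L2_limit_of_fast_Cauchy:
  assumes s: "\<And>k. L2s M (s k)" and fast: "\<And>k l. k \<le> l \<Longrightarrow> nsq M (\<lambda>x. s k x - s l x) \<le> (1 / 4) ^ k"
  obtains g where "L2s M g" "\<And>k. nsq M (\<lambda>x. s k x - g x) \<le> (1 / 4) ^ k"
proof -
  note [measurable] = L2sD(1)[OF s]
  define g where "g x = lim (\<lambda>k. s k x)" for x
  have [measurable]: "g \<in> borel_measurable M" unfolding g_def by (rule borel_measurable_lim_metric) simp
  have "nsq M (\<lambda>x. s (Suc k) x - s k x) \<le> (1 / 4) ^ k" for k
    using fast[of k "Suc k"] by (simp add: nsq_def norm_minus_commute)
  then have conv: "AE x in M. (\<lambda>l. s l x) \<longlonglongrightarrow> g x"
    using AE_convergent_of_fast_L2[OF s] by (auto simp: g_def convergent_LIMSEQ_iff)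
  have fatou: "(\<integral>\<^sup>+x. ennreal ((cmod (s k x - g x))\<^sup>2) \<partial>M) \<le> ennreal ((1 / 4) ^ k)" for k
  proof -
    have "(\<integral>\<^sup>+x. ennreal ((cmod (s k x - g x))\<^sup>2) \<partial>M) = (\<integral>\<^sup>+x. liminf (\<lambda>l. ennreal ((cmod (s k x - s l x))\<^sup>2)) \<partial>M)"
    proof (rule nn_integral_cong_AE)
      show "AE x in M. ennreal ((cmod (s k x - g x))\<^sup>2) = liminf (\<lambda>l. ennreal ((cmod (s k x - s l x))\<^sup>2))"
        using conv
      proof eventually_elim
        case (elim x)
        have "(\<lambda>l. ennreal ((cmod (s k x - s l x))\<^sup>2)) \<longlonglongrightarrow> ennreal ((cmod (s k x - g x))\<^sup>2)"
          using elim by (intro tendsto_intros)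
        then show ?case by (rule lim_imp_Liminf[symmetric, rotated]) simp
      qed
    qed
    also have "\<dots> \<le> liminf (\<lambda>l. \<integral>\<^sup>+x. ennreal ((cmod (s k x - s l x))\<^sup>2) \<partial>M)"
      by (rule nn_integral_liminf) simp
    also have "\<dots> \<le> ennreal ((1 / 4) ^ k)"
    proof (rule Liminf_le)
      show "\<forall>\<^sub>F l in sequentially. (\<integral>\<^sup>+x. ennreal ((cmod (s k x - s l x))\<^sup>2) \<partial>M) \<le> ennreal ((1 / 4) ^ k)"
        using eventually_ge_at_top[of k]
        by eventually_elim (use fast L2s_diff[OF s s] in \<open>auto simp: nn_integral_nsq intro!: ennreal_leI\<close>)
    qed simp
    finally show ?thesis .
  qed
  have diff: "L2s M (\<lambda>x. s k x - g x)" "nsq M (\<lambda>x. s k x - g x) \<le> (1 / 4) ^ k" for k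
    using L2s_of_nn_integral[OF _ fatou[of k]] by auto
  have "L2s M (\<lambda>x. s 0 x - (s 0 x - g x))" by (intro L2s_diff s diff)
  then show ?thesis using that diff by simp
qed

text \<open>Maximality of \<open>e\<close> only says that no nonzero function is orthogonal to all its members, so
  completeness of \<open>L2\<close> is needed: a subsequence of the partial sums of the expansion of \<open>f\<close> has a limit
  \<open>g\<close> with the coefficients of \<open>f\<close>, and \<open>f - g\<close> is orthogonal to every \<open>e i\<close>.\<close>

theorem Parseval_of_maximal_orthonormal:
  assumes basis: "L2_orthonormal_basis M UNIV J e" and f: "L2s M f"
  shows "(\<lambda>i. if i \<in> J then (cmod (ip M f (e i)))\<^sup>2 else 0) sums nsq M f"
proof -
  have e: "ortho M J e" using basis by (simp add: L2_orthonormal_basis_def)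
  let ?c = "\<lambda>i. ip M f (e i)"
  let ?a = "\<lambda>i. if i \<in> J then (cmod (?c i))\<^sup>2 else 0"
  let ?F = "\<lambda>n. {i\<in>J. i < n}"
  have sm: "summable ?a" using Bessel_summable(1)[OF e f] .
  obtain r where r: "strict_mono r" "\<And>k m. r k \<le> m \<Longrightarrow> (\<Sum>i\<in>{r k..<m}. ?a i) \<le> (1 / 4) ^ k"
    by (rule fast_subsequence[OF sm]) auto
  define s where "s k x = (\<Sum>i\<in>?F (r k). ?c i * e i x)" for k x
  have s: "L2s M (s k)" for k
    unfolding s_def by (intro L2s_sum L2s_cmult) (use orthoD(1)[OF e] in auto)
  have fast: "nsq M (\<lambda>x. s k x - s l x) \<le> (1 / 4) ^ k" if "k \<le> l" for k l
  proof -
    have rl: "r k \<le> r l" using r(1) that by (simp add: strict_mono_less_eq)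
    let ?G = "{i\<in>J. r k \<le> i \<and> i < r l}"
    have "?F (r l) = ?F (r k) \<union> ?G" using rl by auto
    then have "s l x = s k x + (\<Sum>i\<in>?G. ?c i * e i x)" for x
      unfolding s_def by (simp add: sum.union_disjoint[symmetric] disjoint_iff)
    then have "nsq M (\<lambda>x. s k x - s l x) = nsq M (\<lambda>x. \<Sum>i\<in>?G. ?c i * e i x)"
      by (simp add: nsq_def)
    also have "\<dots> = (\<Sum>i\<in>?G. (cmod (?c i))\<^sup>2)"
      by (rule nsq_orthonormal_sum[OF e]) auto
    also have "\<dots> = (\<Sum>i\<in>{r k..<r l}. ?a i)"
      by (rule sum.mono_neutral_cong_left) auto
    finally show ?thesis using r(2)[OF rl] by simp
  qed
  obtain g where g: "L2s M g" "\<And>k. nsq M (\<lambda>x. s k x - g x) \<le> (1 / 4) ^ k"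
    using L2_limit_of_fast_Cauchy[OF s fast] by blast
  have pow0: "(\<lambda>k. (1 / 4 :: real) ^ k) \<longlonglongrightarrow> 0" by (rule LIMSEQ_realpow_zero) auto
  have coeff: "ip M g (e i) = ?c i" if i: "i \<in> J" for i
  proof -
    have ei: "L2s M (e i)" "nsq M (e i) = 1" by (rule orthoD(1)[OF e i], rule nsq_orthonormal[OF e i])
    have "(cmod (?c i - ip M g (e i)))\<^sup>2 \<le> (1 / 4) ^ k" if "k > i" for k
    proof -
      have "i < r k" using seq_suble[OF r(1), of k] that by linarith
      then have "ip M (s k) (e i) = ?c i"
        unfolding s_def using ip_orthonormal_sum[OF e, of "?F (r k)" i ?c] i by auto
      then have "?c i - ip M g (e i) = ip M (\<lambda>x. s k x - g x) (e i)"
        using s g ei by (simp add: ip_diff_left)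
      then have "(cmod (?c i - ip M g (e i)))\<^sup>2 \<le> nsq M (\<lambda>x. s k x - g x) * nsq M (e i)"
        using Cauchy_Schwarz_ip[OF L2s_diff[OF s g(1)] ei(1)] by simp
      with g(2)[of k] ei show ?thesis by simp
    qed
    then have "(cmod (?c i - ip M g (e i)))\<^sup>2 \<le> 0"
      by (intro LIMSEQ_le_const[OF pow0]) (auto intro!: exI[of _ "Suc i"])
    then show ?thesis by simp
  qed
  have "AE x in M. f x - g x = 0"
  proof -
    have "\<forall>i\<in>J. ip M (\<lambda>x. f x - g x) (e i) = 0"
      using coeff orthoD(1)[OF e] f g by (simp add: ip_diff_left)
    with L2s_diff[OF f g(1)] basis show ?thesis
      by (auto simp: L2_orthonormal_basis_def)
  qed
  then have fg: "AE x in M. f x - s k x = g x - s k x" for k by eventually_elim auto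
  have gap: "nsq M f - (\<Sum>i<r k. ?a i) \<le> (1 / 4) ^ k" for k
  proof -
    have "nsq M f - (\<Sum>i<r k. ?a i) = nsq M f - (\<Sum>i\<in>?F (r k). (cmod (?c i))\<^sup>2)"
      by (intro arg_cong2[where f = "(-)"] refl sum.mono_neutral_cong_right) auto
    also have "\<dots> = nsq M (\<lambda>x. f x - s k x)"
      unfolding s_def by (rule nsq_residual[OF e _ _ f, symmetric]) auto
    also have "\<dots> = nsq M (\<lambda>x. g x - s k x)"
      by (rule nsq_cong_AE[OF L2s_diff[OF f s] L2s_diff[OF g(1) s] fg])
    also have "\<dots> = nsq M (\<lambda>x. s k x - g x)" by (simp add: nsq_def norm_minus_commute)
    finally show ?thesis using g(2)[of k] by simp
  qed
  have "nsq M f \<le> (\<Sum>i. ?a i)"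
  proof -
    have "nsq M f - (\<Sum>i. ?a i) \<le> (1 / 4) ^ k" for k
    proof -
      have "(\<Sum>i<r k. ?a i) \<le> (\<Sum>i. ?a i)"
        by (rule sum_le_suminf[OF sm]) auto
      with gap[of k] show ?thesis by linarith
    qed
    then have "nsq M f - (\<Sum>i. ?a i) \<le> 0"
      by (intro LIMSEQ_le_const[OF pow0]) auto
    then show ?thesis by simp
  qed
  with Bessel_summable(2)[OF e f] have "(\<Sum>i. ?a i) = nsq M f" by linarith
  with summable_sums[OF sm] show ?thesis by simp
qed

section \<open>Square-summable sequences and kernels given by features\<close>

abbreviation (input) nats :: "nat measure" where "nats \<equiv> count_space UNIV"

lemma l2_iff: "L2s nats v \<longleftrightarrow> summable (\<lambda>j. (cmod (v j))\<^sup>2)"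
  by (simp add: L2s_iff integrable_count_space_nat_iff)

lemma nsq_nats_sums: "L2s nats v \<Longrightarrow> (\<lambda>j. (cmod (v j))\<^sup>2) sums nsq nats v"
  unfolding nsq_def by (rule sums_integral_count_space_nat) (rule L2sD(2))

lemma ip_nats_sums: "L2s nats v \<Longrightarrow> L2s nats w \<Longrightarrow> (\<lambda>j. v j * cnj (w j)) sums ip nats v w"
  unfolding ip_eq by (intro sums_integral_count_space_nat L2s_integrable)

definition unit_vec :: "nat \<Rightarrow> nat \<Rightarrow> complex" where
  "unit_vec j = (\<lambda>i. if i = j then 1 else 0)"

lemma unit_vec_l2: "L2s nats (unit_vec j)"
  unfolding l2_iff unit_vec_def
  by (rule summable_finite[of "{j}"]) auto

lemma ip_unit_vec: "L2s nats w \<Longrightarrow> ip nats (unit_vec j) w = cnj (w j)"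
  using sums_unique2[OF ip_nats_sums[OF unit_vec_l2] sums_finite[of "{j}" "\<lambda>i. unit_vec j i * cnj (w i)"]]
  by (simp add: unit_vec_def)

lemma nsq_unit_vec: "nsq nats (unit_vec j) = 1"
proof -
  have "complex_of_real (nsq nats (unit_vec j)) = 1"
    using ip_unit_vec[OF unit_vec_l2, of j j] unfolding ip_self by (simp add: unit_vec_def)
  then show ?thesis by simp
qed

definition l2_ball :: "(nat \<Rightarrow> complex) set" where
  "l2_ball = {v. L2s nats v \<and> nsq nats v \<le> 1}"

text \<open>The description by finitely many coordinates at a time shows that the ball is closed for
  coordinatewise convergence.\<close>

lemma l2_ball_eq: "l2_ball = (\<Inter>n. {v. (\<Sum>j<n. (cmod (v j))\<^sup>2) \<le> 1})"
proof safe
  fix v n assume v: "v \<in> l2_ball"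
  then have "(\<Sum>j<n. (cmod (v j))\<^sup>2) \<le> nsq nats v"
    using sum_le_suminf[of "\<lambda>j. (cmod (v j))\<^sup>2" "{..<n}"] nsq_nats_sums[of v]
    by (auto simp: l2_ball_def sums_iff)
  with v show "(\<Sum>j<n. (cmod (v j))\<^sup>2) \<le> 1" by (simp add: l2_ball_def)
next
  fix v :: "nat \<Rightarrow> complex" assume v: "v \<in> (\<Inter>n. {v. (\<Sum>j<n. (cmod (v j))\<^sup>2) \<le> 1})"
  then have s: "summable (\<lambda>j. (cmod (v j))\<^sup>2)"
    by (intro bounded_imp_summable[where B = 1]) (auto simp: lessThan_Suc_atMost[symmetric] simp del: sum.lessThan_Suc)
  have "(\<Sum>j. (cmod (v j))\<^sup>2) \<le> 1"
    by (rule suminf_le_const[OF s]) (use v in auto)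
  with s show "v \<in> l2_ball"
    using nsq_nats_sums[of v] by (auto simp: l2_ball_def l2_iff sums_iff)
qed

text \<open>The ball is a closed subset of a product of compact discs. The topology on \<open>nat \<Rightarrow> complex\<close> is the
  product topology; on the ball this is the weak topology of \<open>l2\<close>.\<close>

lemma compact_l2_ball: "compact l2_ball"
proof -
  have cl: "closed l2_ball"
    unfolding l2_ball_eq
    by (intro closed_INT ballI closed_Collect_le continuous_intros continuous_on_product_coordinates)
  have "compactin (product_topology (\<lambda>i::nat. euclidean) UNIV) (PiE UNIV (\<lambda>_. cball (0::complex) 1))"
    by (subst compactin_PiE) auto
  then have cp: "compact (PiE UNIV (\<lambda>_::nat. cball (0::complex) 1))"
    by (simp add: euclidean_product_topology)
  have "l2_ball \<subseteq> PiE UNIV (\<lambda>_. cball 0 1)"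
  proof
    fix v assume "v \<in> l2_ball"
    then have "(\<Sum>j<Suc i. (cmod (v j))\<^sup>2) \<le> 1" for i
      unfolding l2_ball_eq by blast
    then have "(cmod (v i))\<^sup>2 \<le> 1" for i
      by (rule order_trans[rotated]) (rule member_le_sum, auto)
    then show "v \<in> PiE UNIV (\<lambda>_. cball 0 1)"
      by (auto simp: abs_square_le_1)
  qed
  then show ?thesis
    using compact_Int_closed[OF cp cl] by (simp add: Int_absorb1)
qed

text \<open>The tails of the series are uniformly small on the ball, by the Cauchy-Schwarz inequality.\<close>

lemma continuous_on_ip_l2_ball:
  assumes w: "L2s nats w"
  shows "continuous_on l2_ball (\<lambda>v. ip nats v w)"
proof (rule uniform_limit_theorem[where F = sequentially and f = "\<lambda>n v. \<Sum>j<n. v j * cnj (w j)"])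
  show "\<forall>\<^sub>F n in sequentially. continuous_on l2_ball (\<lambda>v. \<Sum>j<n. v j * cnj (w j))"
    by (intro always_eventually allI continuous_intros continuous_on_subset[OF continuous_on_product_coordinates]) auto
  show "uniform_limit l2_ball (\<lambda>n v. \<Sum>j<n. v j * cnj (w j)) (\<lambda>v. ip nats v w) sequentially"
  proof (rule uniform_limitI)
    fix e :: real assume e: "e > 0"
    have "(\<lambda>n. nsq nats w - (\<Sum>j<n. (cmod (w j))\<^sup>2)) \<longlonglongrightarrow> nsq nats w - nsq nats w"
      using nsq_nats_sums[OF w] unfolding sums_def by (intro tendsto_intros)
    then have "\<forall>\<^sub>F n in sequentially. nsq nats w - (\<Sum>j<n. (cmod (w j))\<^sup>2) < e\<^sup>2"
      by (rule order_tendstoD(2)) (use e in simp)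
    then show "\<forall>\<^sub>F n in sequentially. \<forall>v\<in>l2_ball. dist (\<Sum>j<n. v j * cnj (w j)) (ip nats v w) < e"
    proof eventually_elim
      case (elim n)
      show ?case
      proof
        fix v assume "v \<in> l2_ball"
        then have v: "L2s nats v" "nsq nats v \<le> 1" by (auto simp: l2_ball_def)
        define t where "t j = (if j < n then 0 else w j)" for j
        have "(\<lambda>j. if j < n then v j * cnj (w j) else 0) sums (\<Sum>j<n. v j * cnj (w j))"
          using sums_If_finite_set[of "{..<n}" "\<lambda>j. v j * cnj (w j)"] by simp
        from sums_diff[OF ip_nats_sums[OF v(1) w] this]
        have 1: "(\<lambda>j. v j * cnj (t j)) sums (ip nats v w - (\<Sum>j<n. v j * cnj (w j)))"
          by (rule sums_cong[THEN iffD1, rotated]) (auto simp: t_def)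
        have "(\<lambda>j. if j < n then (cmod (w j))\<^sup>2 else 0) sums (\<Sum>j<n. (cmod (w j))\<^sup>2)"
          using sums_If_finite_set[of "{..<n}" "\<lambda>j. (cmod (w j))\<^sup>2"] by simp
        from sums_diff[OF nsq_nats_sums[OF w] this]
        have 2: "(\<lambda>j. (cmod (t j))\<^sup>2) sums (nsq nats w - (\<Sum>j<n. (cmod (w j))\<^sup>2))"
          by (rule sums_cong[THEN iffD1, rotated]) (auto simp: t_def)
        then have t: "L2s nats t" by (simp add: l2_iff sums_iff)
        have "(cmod (ip nats v t))\<^sup>2 \<le> nsq nats v * nsq nats t"
          by (rule Cauchy_Schwarz_ip[OF v(1) t])
        also have "\<dots> \<le> nsq nats t" using v mult_right_mono[of "nsq nats v" 1 "nsq nats t"] by simp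
        also have "\<dots> < e\<^sup>2" using sums_unique2[OF 2 nsq_nats_sums[OF t]] elim by simp
        finally have "cmod (ip nats v t) < e" using e by (simp add: power2_less_imp_less)
        then show "dist (\<Sum>j<n. v j * cnj (w j)) (ip nats v w) < e"
          using sums_unique2[OF 1 ip_nats_sums[OF v(1) t]] by (simp add: dist_norm norm_minus_commute)
      qed
    qed
  qed
qed simp

text \<open>A kernel given by features: \<open>(\<Sum>j. b j x * cnj (b j y))\<close>. The vector \<open>\<kappa> x\<close> in \<open>l2\<close> represents evaluation at
  \<open>x\<close>, the operator \<open>T\<close> from \<open>l2\<close> to \<open>L2\<close> is \<open>v \<mapsto> (\<Sum>j. v j * b j)\<close>, its adjoint is \<open>S\<close>, and the kernel at \<open>x\<close>
  and \<open>y\<close> is \<open>T (\<kappa> y) x\<close>. Its diagonal is \<open>nsq nats (\<kappa> x)\<close>, with integral \<open>trace\<close>.\<close>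

locale feature_map =
  fixes M :: "'a measure" and b :: "nat \<Rightarrow> 'a \<Rightarrow> complex"
  assumes b_L2: "\<And>j. L2s M (b j)"
    and trace_summable: "summable (\<lambda>j. nsq M (b j))"
    and pointwise_summable: "\<And>x. summable (\<lambda>j. (cmod (b j x))\<^sup>2)"
begin

definition \<kappa> :: "'a \<Rightarrow> nat \<Rightarrow> complex" where "\<kappa> x = (\<lambda>j. cnj (b j x))"

definition T :: "(nat \<Rightarrow> complex) \<Rightarrow> 'a \<Rightarrow> complex" where "T v x = ip nats v (\<kappa> x)"

definition S :: "('a \<Rightarrow> complex) \<Rightarrow> nat \<Rightarrow> complex" where "S f = (\<lambda>j. ip M f (b j))"

definition trace :: real where "trace = (\<Sum>j. nsq M (b j))"

lemma \<kappa>_l2: "L2s nats (\<kappa> x)"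
  using pointwise_summable by (simp add: l2_iff \<kappa>_def)

lemma nsq_\<kappa>: "nsq nats (\<kappa> x) = (\<Sum>j. (cmod (b j x))\<^sup>2)"
  using nsq_nats_sums[OF \<kappa>_l2, of x] by (simp add: \<kappa>_def sums_iff)

lemma nsq_\<kappa>_integral: "integrable M (\<lambda>x. nsq nats (\<kappa> x))" "(LINT x|M. nsq nats (\<kappa> x)) = trace"
proof -
  have "integrable M (\<lambda>x. \<Sum>j. (cmod (b j x))\<^sup>2) \<and> (LINT x|M. (\<Sum>j. (cmod (b j x))\<^sup>2)) = (\<Sum>j. LINT x|M. (cmod (b j x))\<^sup>2)"
    using L2sD(2)[OF b_L2] pointwise_summable trace_summable
    by (intro conjI integrable_suminf integral_suminf) (auto simp: nsq_def)
  then show "integrable M (\<lambda>x. nsq nats (\<kappa> x))" "(LINT x|M. nsq nats (\<kappa> x)) = trace"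
    unfolding nsq_\<kappa> trace_def nsq_def[of M] by auto
qed

lemma T_sums: "L2s nats v \<Longrightarrow> (\<lambda>j. v j * b j x) sums T v x"
  using ip_nats_sums[OF _ \<kappa>_l2, of v x] by (simp add: T_def \<kappa>_def)

lemma T_bound: "L2s nats v \<Longrightarrow> (cmod (T v x))\<^sup>2 \<le> nsq nats v * nsq nats (\<kappa> x)"
  unfolding T_def by (rule Cauchy_Schwarz_ip[OF _ \<kappa>_l2])

lemma T_L2:
  assumes v: "L2s nats v"
  shows "L2s M (T v)"
  unfolding L2s_iff
proof
  have "T v = (\<lambda>x. \<Sum>j. v j * b j x)" using T_sums[OF v] by (auto simp: sums_iff)
  then show m [measurable]: "T v \<in> borel_measurable M" using L2sD(1)[OF b_L2] by simp
  show "integrable M (\<lambda>x. (cmod (T v x))\<^sup>2)"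
    by (rule Bochner_Integration.integrable_bound[where f = "\<lambda>x. nsq nats v * nsq nats (\<kappa> x)"])
       (use nsq_\<kappa>_integral(1) T_bound[OF v] in auto)
qed

lemma T_add_cmult: "L2s nats v \<Longrightarrow> L2s nats w \<Longrightarrow> T (\<lambda>j. v j + z * w j) x = T v x + z * T w x"
  unfolding T_def by (simp add: ip_add_left ip_cmult_left L2s_cmult \<kappa>_l2)

lemma T_unit_vec: "T (unit_vec j) x = b j x"
  unfolding T_def by (simp add: ip_unit_vec \<kappa>_l2) (simp add: \<kappa>_def)

lemma S_l2:
  assumes "L2s M f"
  shows "L2s nats (S f)"
  unfolding l2_iff
proof (rule summable_comparison_test')
  show "summable (\<lambda>j. nsq M f * nsq M (b j))" by (intro summable_mult trace_summable)
  show "norm ((cmod (S f j))\<^sup>2) \<le> nsq M f * nsq M (b j)" if "j \<ge> 0" for j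
    using Cauchy_Schwarz_ip[OF assms b_L2] by (simp add: S_def)
qed

text \<open>Integration and summation are interchanged; absolute convergence follows from the inequality of
  the geometric and the arithmetic mean, pointwise and for the integrals \<open>A j\<close>.\<close>

lemma T_S_adjoint:
  assumes v: "L2s nats v" and f: "L2s M f"
  shows "ip M (T v) f = ip nats v (S f)"
proof -
  define A where "A j = (LINT x|M. cmod (b j x * cnj (f x)))" for j
  have int: "integrable M (\<lambda>x. b j x * cnj (f x))" for j by (rule L2s_integrable[OF b_L2 f])
  have A2: "(A j)\<^sup>2 \<le> nsq M (b j) * nsq M f" for j
  proof -
    let ?g = "\<lambda>x. complex_of_real (cmod (b j x))" and ?h = "\<lambda>x. complex_of_real (cmod (f x))"
    have g: "L2s M ?g" "L2s M ?h" using b_L2[of j] f by (auto simp: L2s_iff)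
    have "ip M ?g ?h = (LINT x|M. complex_of_real (cmod (b j x * cnj (f x))))"
      by (simp add: ip_eq norm_mult)
    also have "\<dots> = complex_of_real (A j)"
      unfolding A_def by (rule integral_complex_of_real)
    finally show ?thesis using Cauchy_Schwarz_ip[OF g] by (simp add: nsq_def)
  qed
  have sumA: "summable (\<lambda>j. cmod (v j) * A j)"
  proof (rule summable_comparison_test')
    show "summable (\<lambda>j. ((cmod (v j))\<^sup>2 + nsq M (b j) * nsq M f) / 2)"
      using v by (intro summable_divide summable_add summable_mult2 trace_summable) (simp add: l2_iff)
    show "norm (cmod (v j) * A j) \<le> ((cmod (v j))\<^sup>2 + nsq M (b j) * nsq M f) / 2" if "j \<ge> 0" for j
      using sum_squares_bound[of "cmod (v j)" "A j"] A2[of j] by (simp add: A_def)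
  qed
  have "ip M (T v) f = (LINT x|M. (\<Sum>j. v j * (b j x * cnj (f x))))"
    unfolding ip_eq
  proof (rule Bochner_Integration.integral_cong[OF refl])
    fix x
    from sums_mult2[OF T_sums[OF v], of x "cnj (f x)"]
    show "T v x * cnj (f x) = (\<Sum>j. v j * (b j x * cnj (f x)))" by (simp add: sums_iff mult.assoc)
  qed
  also have "\<dots> = (\<Sum>j. LINT x|M. v j * (b j x * cnj (f x)))"
  proof (rule integral_suminf)
    show "integrable M (\<lambda>x. v j * (b j x * cnj (f x)))" for j using int by simp
    show "AE x in M. summable (\<lambda>j. norm (v j * (b j x * cnj (f x))))"
    proof (intro AE_I2)
      fix x
      have "summable (\<lambda>j. cmod (f x) * (((cmod (v j))\<^sup>2 + (cmod (b j x))\<^sup>2) / 2))"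
        using v pointwise_summable by (intro summable_mult summable_divide summable_add) (auto simp: l2_iff)
      then show "summable (\<lambda>j. norm (v j * (b j x * cnj (f x))))"
      proof (rule summable_comparison_test'[where N = 0])
        fix j
        have "cmod (f x) * cmod (v j * b j x) \<le> cmod (f x) * (((cmod (v j))\<^sup>2 + (cmod (b j x))\<^sup>2) / 2)"
          by (intro mult_left_mono cmod_mult_le) auto
        then show "norm (norm (v j * (b j x * cnj (f x)))) \<le> cmod (f x) * (((cmod (v j))\<^sup>2 + (cmod (b j x))\<^sup>2) / 2)"
          by (simp add: norm_mult mult_ac)
      qed
    qed
    show "summable (\<lambda>j. LINT x|M. norm (v j * (b j x * cnj (f x))))"
      using sumA by (simp add: norm_mult A_def)
  qed
  also have "\<dots> = (\<Sum>j. v j * cnj (S f j))"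
    by (rule suminf_cong) (simp add: S_def ip_commute[of M f], simp add: ip_eq)
  also have "\<dots> = ip nats v (S f)"
    using ip_nats_sums[OF v S_l2[OF f]] by (simp add: sums_iff)
  finally show ?thesis .
qed

lemma ip_T_S: "L2s M f \<Longrightarrow> L2s M g \<Longrightarrow> ip M (T (S f)) g = ip nats (S f) (S g)"
  by (rule T_S_adjoint[OF S_l2])

text \<open>The integral operator of the kernel is the composition of \<open>S\<close> and \<open>T\<close>.\<close>

lemma kernel_integral:
  assumes f: "L2s M f"
  shows "(LINT y|M. T (\<kappa> y) x * f y) = T (S f) x"
proof -
  have sym: "T (\<kappa> y) x = cnj (T (\<kappa> x) y)" for y
    unfolding T_def by (rule ip_commute)
  have "(LINT y|M. T (\<kappa> y) x * f y) = cnj (ip M (T (\<kappa> x)) f)"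
    unfolding ip_eq sym by (subst Bochner_Integration.integral_cnj[symmetric]) simp
  also have "\<dots> = ip nats (S f) (\<kappa> x)"
    by (simp add: T_S_adjoint[OF \<kappa>_l2 f] ip_commute[of nats "S f"])
  finally show ?thesis by (simp add: T_def)
qed

text \<open>On the ball, \<open>(cmod (T v x))\<^sup>2\<close> is dominated by the integrable diagonal, and \<open>T v x\<close> is continuous in
  \<open>v\<close> for every \<open>x\<close>.\<close>

lemma continuous_on_nsq_T: "continuous_on l2_ball (\<lambda>v. nsq M (T v))"
proof (rule continuous_on_sequentiallyI)
  fix u a assume u: "\<forall>n. u n \<in> l2_ball" and a: "a \<in> l2_ball" and lim: "u \<longlonglongrightarrow> a"
  have ul: "L2s nats (u n)" "nsq nats (u n) \<le> 1" for n using u by (auto simp: l2_ball_def)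
  have al: "L2s nats a" using a by (auto simp: l2_ball_def)
  show "(\<lambda>n. nsq M (T (u n))) \<longlonglongrightarrow> nsq M (T a)"
    unfolding nsq_def[of M]
  proof (rule integral_dominated_convergence[where w = "\<lambda>x. nsq nats (\<kappa> x)"])
    show "(\<lambda>x. (cmod (T a x))\<^sup>2) \<in> borel_measurable M" "(\<lambda>x. (cmod (T (u n) x))\<^sup>2) \<in> borel_measurable M" for n
      using L2sD(1)[OF T_L2[OF al]] L2sD(1)[OF T_L2[OF ul(1)]] by measurable
    show "integrable M (\<lambda>x. nsq nats (\<kappa> x))" by (rule nsq_\<kappa>_integral)
    show "AE x in M. (\<lambda>n. (cmod (T (u n) x))\<^sup>2) \<longlonglongrightarrow> (cmod (T a x))\<^sup>2"
    proof (intro AE_I2 tendsto_intros)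
      fix x show "(\<lambda>n. T (u n) x) \<longlonglongrightarrow> T a x"
        unfolding T_def by (rule continuous_on_tendsto_compose[OF continuous_on_ip_l2_ball[OF \<kappa>_l2] lim a]) (use u in auto)
    qed
    show "AE x in M. norm ((cmod (T (u n) x))\<^sup>2) \<le> nsq nats (\<kappa> x)" for n
    proof (intro AE_I2)
      fix x
      show "norm ((cmod (T (u n) x))\<^sup>2) \<le> nsq nats (\<kappa> x)"
        using T_bound[OF ul(1), of n x] mult_right_mono[OF ul(2)[of n], of "nsq nats (\<kappa> x)"] by simp
    qed
  qed
qed

end

section \<open>Eigenfunction expansion of a trace-class kernel\<close>

text \<open>If Bessel's inequality is an equality for \<open>f\<close>, then \<open>f\<close> is the limit of its projections, and inner
  products with \<open>f\<close> may be computed termwise.\<close>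

lemma Parseval_expansion:
  assumes e: "ortho M I e" and f: "L2s M f" and g: "L2s M g"
    and full: "(\<lambda>i. if i \<in> I then (cmod (ip M f (e i)))\<^sup>2 else 0) sums nsq M f"
  shows "(\<lambda>i. if i \<in> I then ip M g (e i) * ip M (e i) f else 0) sums ip M g f"
proof -
  let ?a = "\<lambda>i. if i \<in> I then (cmod (ip M f (e i)))\<^sup>2 else 0"
  let ?t = "\<lambda>i. if i \<in> I then ip M g (e i) * ip M (e i) f else 0"
  have bound: "(cmod (ip M g f - (\<Sum>i<n. ?t i)))\<^sup>2 \<le> nsq M g * (nsq M f - (\<Sum>i<n. ?a i))" for n
  proof -
    let ?F = "{i\<in>I. i < n}"
    let ?s = "\<lambda>x. \<Sum>i\<in>?F. ip M f (e i) * e i x"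
    have s: "L2s M ?s" by (intro L2s_sum L2s_cmult) (use orthoD(1)[OF e] in auto)
    have "ip M g ?s = (\<Sum>i\<in>?F. cnj (ip M f (e i)) * ip M g (e i))"
      by (subst ip_sum_right) (use orthoD(1)[OF e] g in \<open>auto simp: ip_cmult_right intro!: L2s_cmult\<close>)
    also have "\<dots> = (\<Sum>i<n. ?t i)"
      by (rule sum.mono_neutral_cong_left) (auto simp: ip_commute[of M f] mult.commute)
    finally have 1: "ip M g (\<lambda>x. f x - ?s x) = ip M g f - (\<Sum>i<n. ?t i)"
      using f g s by (simp add: ip_diff_right)
    have "nsq M (\<lambda>x. f x - ?s x) = nsq M f - (\<Sum>i\<in>?F. (cmod (ip M f (e i)))\<^sup>2)"
      by (rule nsq_residual[OF e _ _ f]) auto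
    also have "(\<Sum>i\<in>?F. (cmod (ip M f (e i)))\<^sup>2) = (\<Sum>i<n. ?a i)"
      by (rule sum.mono_neutral_cong_left) auto
    finally show ?thesis using Cauchy_Schwarz_ip[OF g L2s_diff[OF f s]] unfolding 1 by simp
  qed
  have "(\<lambda>n. nsq M g * (nsq M f - (\<Sum>i<n. ?a i))) \<longlonglongrightarrow> nsq M g * (nsq M f - nsq M f)"
    using full unfolding sums_def by (intro tendsto_intros)
  then have lim0: "(\<lambda>n. nsq M g * (nsq M f - (\<Sum>i<n. ?a i))) \<longlonglongrightarrow> 0" by simp
  have "(\<lambda>n. (cmod (ip M g f - (\<Sum>i<n. ?t i)))\<^sup>2) \<longlonglongrightarrow> 0"
    by (rule tendsto_sandwich[OF _ _ tendsto_const lim0]) (simp_all add: bound)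
  then have "(\<lambda>n. sqrt ((cmod (ip M g f - (\<Sum>i<n. ?t i)))\<^sup>2)) \<longlonglongrightarrow> sqrt 0"
    by (rule tendsto_real_sqrt)
  then have "(\<lambda>n. ip M g f - (\<Sum>i<n. ?t i)) \<longlonglongrightarrow> 0"
    unfolding real_sqrt_zero real_sqrt_abs abs_norm_cancel by (rule tendsto_norm_zero_cancel)
  then have "(\<lambda>n. ip M g f - (ip M g f - (\<Sum>i<n. ?t i))) \<longlonglongrightarrow> ip M g f - 0"
    by (intro tendsto_intros)
  then show ?thesis by (simp add: sums_def)
qed

text \<open>Orthonormal eigenfunctions \<open>\<phi> k\<close> of the kernel that account for all nonzero eigenvalues. The
  eigenvalue of \<open>\<phi> k\<close> is \<open>a k\<close>, and the \<open>u k\<close> below are the corresponding orthonormal eigenvectors in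
  \<open>l2\<close>: \<open>T\<close> sends \<open>u k\<close> to \<open>sqrt (a k) * \<phi> k\<close>. What has to be proved is that \<open>T\<close>
  vanishes on the orthogonal complement of the \<open>u k\<close>.\<close>

locale feature_eigensystem = feature_map +
  fixes I :: "nat set" and \<phi> :: "nat \<Rightarrow> 'a \<Rightarrow> complex" and \<alpha> :: "nat \<Rightarrow> complex"
  assumes \<phi>: "ortho M I \<phi>"
    and \<alpha>_nonzero: "\<And>k. k \<in> I \<Longrightarrow> \<alpha> k \<noteq> 0"
    and eigen: "\<And>k. k \<in> I \<Longrightarrow> AE x in M. T (S (\<phi> k)) x = \<alpha> k * \<phi> k x"
    and complete: "\<And>c f. c \<noteq> 0 \<Longrightarrow> L2s M f \<Longrightarrow> \<not> (AE x in M. f x = 0) \<Longrightarrow> (AE x in M. T (S f) x = c * f x) \<Longrightarrow>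
       \<exists>F \<beta>. finite F \<and> F \<subseteq> I \<and> (AE x in M. f x = (\<Sum>k\<in>F. \<beta> k * \<phi> k x))"
begin

definition a :: "nat \<Rightarrow> real" where "a k = nsq nats (S (\<phi> k))"

definition u :: "nat \<Rightarrow> nat \<Rightarrow> complex" where "u k = (\<lambda>j. (1 / sqrt (a k)) * S (\<phi> k) j)"

lemma \<phi>_L2: "k \<in> I \<Longrightarrow> L2s M (\<phi> k)"
  using orthoD(1)[OF \<phi>] .

lemma ip_S_\<phi>: "k \<in> I \<Longrightarrow> l \<in> I \<Longrightarrow> ip nats (S (\<phi> k)) (S (\<phi> l)) = (if k = l then \<alpha> k else 0)"
proof -
  assume k: "k \<in> I" and l: "l \<in> I"
  have "ip nats (S (\<phi> k)) (S (\<phi> l)) = ip M (T (S (\<phi> k))) (\<phi> l)"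
    using k l by (simp add: ip_T_S \<phi>_L2)
  also have "\<dots> = ip M (\<lambda>x. \<alpha> k * \<phi> k x) (\<phi> l)"
    by (intro ip_cong_AE) (use k l eigen in \<open>auto intro!: T_L2 S_l2 \<phi>_L2 L2s_cmult\<close>)
  also have "\<dots> = (if k = l then \<alpha> k else 0)"
    using orthoD(2)[OF \<phi> k l] by (simp add: ip_cmult_left)
  finally show ?thesis .
qed

lemma a_eq: "k \<in> I \<Longrightarrow> \<alpha> k = complex_of_real (a k)"
  using ip_S_\<phi>[of k k] by (simp add: a_def ip_self)

lemma a_pos: "k \<in> I \<Longrightarrow> a k > 0"
proof -
  assume k: "k \<in> I"
  have "a k \<noteq> 0" using a_eq[OF k] \<alpha>_nonzero[OF k] by auto
  moreover have "a k \<ge> 0" by (simp add: a_def)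
  ultimately show ?thesis by linarith
qed

lemma u_ortho: "ortho nats I u"
  unfolding L2_orthonormal_def
proof (intro conjI ballI)
  fix k assume k: "k \<in> I"
  show "L2s nats (u k)" unfolding u_def by (intro L2s_cmult S_l2 \<phi>_L2 k)
  fix l assume l: "l \<in> I"
  show "ip nats (u k) (u l) = (if k = l then 1 else 0)"
  proof (cases "k = l")
    case True
    have "nsq nats (u k) = (cmod (complex_of_real (1 / sqrt (a k))))\<^sup>2 * a k"
      unfolding u_def a_def[of k, symmetric] nsq_cmult[of nats _ "S (\<phi> k)"] by (simp add: a_def)
    also have "\<dots> = 1" using a_pos[OF k] by (simp add: norm_divide power_divide)
    finally show ?thesis using True by (simp add: ip_self)
  next
    case False
    have "ip nats (u k) (u l) = (1 / sqrt (a k)) * (cnj (1 / sqrt (a l)) * ip nats (S (\<phi> k)) (S (\<phi> l)))"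
      unfolding u_def ip_cmult_left ip_cmult_right by simp
    then show ?thesis using False ip_S_\<phi>[OF k l] by simp
  qed
qed

lemma u_l2: "k \<in> I \<Longrightarrow> L2s nats (u k)"
  using orthoD(1)[OF u_ortho] .

lemma ip_u: "L2s M f \<Longrightarrow> k \<in> I \<Longrightarrow> ip nats (S f) (u k) = complex_of_real (sqrt (a k)) * ip M f (\<phi> k)"
proof -
  assume f: "L2s M f" and k: "k \<in> I"
  have "ip nats (S f) (u k) = (1 / sqrt (a k)) * ip nats (S f) (S (\<phi> k))"
    unfolding u_def by (subst ip_cmult_right) simp
  also have "ip nats (S f) (S (\<phi> k)) = cnj (ip M (T (S (\<phi> k))) f)"
    using f k by (simp add: ip_T_S \<phi>_L2 ip_commute[of nats "S f"])
  also have "ip M (T (S (\<phi> k))) f = ip M (\<lambda>x. \<alpha> k * \<phi> k x) f"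
    by (intro ip_cong_AE) (use k f eigen in \<open>auto intro!: T_L2 S_l2 \<phi>_L2 L2s_cmult\<close>)
  also have "cnj \<dots> = a k * ip M f (\<phi> k)"
    by (simp add: ip_cmult_left a_eq[OF k] ip_commute[of M f])
  also have "(1 / sqrt (a k)) * (a k * ip M f (\<phi> k)) = complex_of_real (a k / sqrt (a k)) * ip M f (\<phi> k)"
    by simp
  also have "a k / sqrt (a k) = sqrt (a k)" using a_pos[OF k] by (simp add: real_div_sqrt)
  finally show ?thesis .
qed

lemma T_u:
  assumes k: "k \<in> I"
  shows "AE x in M. T (u k) x = complex_of_real (sqrt (a k)) * \<phi> k x"
  using eigen[OF k]
proof eventually_elim
  case (elim x)
  have "T (u k) x = (1 / sqrt (a k)) * T (S (\<phi> k)) x"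
    unfolding T_def u_def by (rule ip_cmult_left)
  also have "\<dots> = complex_of_real (a k / sqrt (a k)) * \<phi> k x"
    using elim a_eq[OF k] by (simp add: T_def)
  also have "a k / sqrt (a k) = sqrt (a k)" using a_pos[OF k] by (simp add: real_div_sqrt)
  finally show ?case .
qed

lemma ip_T_\<phi>: "L2s nats v \<Longrightarrow> k \<in> I \<Longrightarrow> ip M (T v) (\<phi> k) = complex_of_real (sqrt (a k)) * ip nats v (u k)"
proof -
  assume v: "L2s nats v" and k: "k \<in> I"
  have "ip nats v (u k) = (1 / sqrt (a k)) * ip M (T v) (\<phi> k)"
    unfolding u_def using v k by (subst ip_cmult_right) (simp add: T_S_adjoint \<phi>_L2)
  then show ?thesis using a_pos[OF k] by simp
qed

lemma nsq_T_u: "k \<in> I \<Longrightarrow> nsq M (T (u k)) = a k"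
proof -
  assume k: "k \<in> I"
  have "nsq M (T (u k)) = nsq M (\<lambda>x. complex_of_real (sqrt (a k)) * \<phi> k x)"
    by (rule nsq_cong_AE) (use k T_u in \<open>auto intro!: T_L2 u_l2 \<phi>_L2 L2s_cmult\<close>)
  also have "\<dots> = a k * nsq M (\<phi> k)" using a_pos[OF k] by (simp add: nsq_cmult)
  finally show ?thesis by (simp add: nsq_orthonormal[OF \<phi> k])
qed

text \<open>The term of index \<open>k\<close> of the expansion of the diagonal, which equals \<open>a k * (cmod (\<phi> k x))\<^sup>2\<close> almost
  everywhere. Written with \<open>T (u k)\<close> it satisfies Bessel's inequality at every \<open>x\<close>.\<close>

definition \<Phi> :: "'a \<Rightarrow> nat \<Rightarrow> real" where
  "\<Phi> x k = (if k \<in> I then (cmod (T (u k) x))\<^sup>2 else 0)"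

lemma \<Phi>_summable: "summable (\<Phi> x)" "(\<Sum>k. \<Phi> x k) \<le> nsq nats (\<kappa> x)"
proof -
  have "\<Phi> x = (\<lambda>k. if k \<in> I then (cmod (ip nats (\<kappa> x) (u k)))\<^sup>2 else 0)"
    by (auto simp: \<Phi>_def T_def ip_commute[of nats "\<kappa> x"])
  then show "summable (\<Phi> x)" "(\<Sum>k. \<Phi> x k) \<le> nsq nats (\<kappa> x)"
    using Bessel_summable[OF u_ortho \<kappa>_l2, of x] by auto
qed

lemma \<Phi>_integral: "integrable M (\<lambda>x. \<Phi> x k)" "(LINT x|M. \<Phi> x k) = (if k \<in> I then a k else 0)"
proof -
  show "integrable M (\<lambda>x. \<Phi> x k)"
    using L2sD(2)[OF T_L2[OF u_l2[of k]]] by (cases "k \<in> I") (simp_all add: \<Phi>_def)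
  show "(LINT x|M. \<Phi> x k) = (if k \<in> I then a k else 0)"
    using nsq_T_u[of k] by (cases "k \<in> I") (simp_all add: \<Phi>_def nsq_def)
qed

lemma a_partial_sums: "(\<Sum>k<n. if k \<in> I then a k else 0) \<le> trace"
proof -
  have "(\<Sum>k<n. if k \<in> I then a k else 0) = (LINT x|M. (\<Sum>k<n. \<Phi> x k))"
    by (simp add: \<Phi>_integral)
  also have "\<dots> \<le> (LINT x|M. nsq nats (\<kappa> x))"
  proof (rule integral_mono)
    show "integrable M (\<lambda>x. \<Sum>k<n. \<Phi> x k)" by (intro Bochner_Integration.integrable_sum \<Phi>_integral)
    show "(\<Sum>k<n. \<Phi> x k) \<le> nsq nats (\<kappa> x)" for x
      by (rule order_trans[OF sum_le_suminf[OF \<Phi>_summable(1)] \<Phi>_summable(2)]) (auto simp: \<Phi>_def)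
  qed (rule nsq_\<kappa>_integral)
  finally show ?thesis by (simp add: nsq_\<kappa>_integral)
qed

lemma a_summable: "summable (\<lambda>k. if k \<in> I then a k else 0)"
proof (rule bounded_imp_summable[where B = trace])
  show "0 \<le> (if k \<in> I then a k else 0)" for k using a_pos[of k] by auto
  show "(\<Sum>k\<le>n. if k \<in> I then a k else 0) \<le> trace" for n
    using a_partial_sums[of "Suc n"] by (simp only: lessThan_Suc_atMost)
qed

text \<open>The coefficients of \<open>T v\<close> with respect to the \<open>\<phi> k\<close>.\<close>

definition R :: "(nat \<Rightarrow> complex) \<Rightarrow> nat \<Rightarrow> complex" where
  "R v k = (if k \<in> I then complex_of_real (sqrt (a k)) * ip nats v (u k) else 0)"

lemma cmod_R: "L2s nats v \<Longrightarrow> (cmod (R v k))\<^sup>2 \<le> (if k \<in> I then a k else 0) * nsq nats v"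
proof -
  assume v: "L2s nats v"
  show ?thesis
  proof (cases "k \<in> I")
    case True
    have "(cmod (ip nats v (u k)))\<^sup>2 \<le> nsq nats v"
      using Cauchy_Schwarz_ip[OF v u_l2[OF True]] by (simp add: nsq_orthonormal[OF u_ortho True])
    then show ?thesis using True a_pos[OF True]
      by (simp add: R_def norm_mult power_mult_distrib mult_left_mono)
  qed (simp add: R_def)
qed

lemma R_l2: "L2s nats v \<Longrightarrow> L2s nats (R v)"
proof -
  assume v: "L2s nats v"
  have "summable (\<lambda>k. (if k \<in> I then a k else 0) * nsq nats v)"
    by (rule summable_mult2[OF a_summable])
  then have "summable (\<lambda>k. (cmod (R v k))\<^sup>2)"
    by (rule summable_comparison_test'[where N = 0]) (use cmod_R[OF v] in simp)
  then show ?thesis by (simp add: l2_iff)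
qed

lemma R_add_cmult: "L2s nats v \<Longrightarrow> L2s nats w \<Longrightarrow> R (\<lambda>j. v j + z * w j) k = R v k + z * R w k"
  by (cases "k \<in> I") (simp_all add: R_def ip_add_left ip_cmult_left L2s_cmult u_l2 distrib_left mult.left_commute)

text \<open>The squared norm of the part of \<open>T v\<close> orthogonal to all \<open>\<phi> k\<close>, that is, the quadratic form of the
  kernel with the known eigenvectors removed.\<close>

definition q :: "(nat \<Rightarrow> complex) \<Rightarrow> real" where
  "q v = nsq M (T v) - nsq nats (R v)"

lemma continuous_on_q: "continuous_on l2_ball q"
proof -
  have "continuous_on l2_ball (\<lambda>v. nsq nats (R v))"
  proof (rule uniform_limit_theorem[where F = sequentially])
    have "uniform_limit l2_ball (\<lambda>n v. \<Sum>k<n. (cmod (R v k))\<^sup>2) (\<lambda>v. \<Sum>k. (cmod (R v k))\<^sup>2) sequentially"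
    proof (rule Weierstrass_m_test[OF _ a_summable])
      fix k v assume "v \<in> l2_ball"
      then have v: "L2s nats v" "nsq nats v \<le> 1" by (auto simp: l2_ball_def)
      have "(cmod (R v k))\<^sup>2 \<le> (if k \<in> I then a k else 0) * nsq nats v" by (rule cmod_R[OF v(1)])
      also have "\<dots> \<le> (if k \<in> I then a k else 0)"
        using v(2) a_pos[of k] by (auto intro: mult_left_le)
      finally show "norm ((cmod (R v k))\<^sup>2) \<le> (if k \<in> I then a k else 0)" by simp
    qed
    moreover have "(\<Sum>k. (cmod (R v k))\<^sup>2) = nsq nats (R v)" if "v \<in> l2_ball" for v
      using nsq_nats_sums[OF R_l2, of v] that by (auto simp: sums_iff l2_ball_def)
    ultimately show "uniform_limit l2_ball (\<lambda>n v. \<Sum>k<n. (cmod (R v k))\<^sup>2) (\<lambda>v. nsq nats (R v)) sequentially"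
      by (auto cong: uniform_limit_cong')
    have "continuous_on l2_ball (\<lambda>v. R v k)" for k
      using continuous_on_ip_l2_ball[OF u_l2] by (cases "k \<in> I") (auto simp: R_def intro!: continuous_intros)
    then show "\<forall>\<^sub>F n in sequentially. continuous_on l2_ball (\<lambda>v. \<Sum>k<n. (cmod (R v k))\<^sup>2)"
      by (intro always_eventually allI continuous_intros)
  qed simp
  then show ?thesis unfolding q_def by (intro continuous_intros continuous_on_nsq_T)
qed

lemma q_add_cmult:
  assumes v: "L2s nats v" and w: "L2s nats w"
  shows "q (\<lambda>j. v j + z * w j) = q v + 2 * Re (cnj z * (ip M (T v) (T w) - ip nats (R v) (R w))) + (cmod z)\<^sup>2 * q w"
proof -
  have "nsq M (T (\<lambda>j. v j + z * w j)) = nsq M (\<lambda>x. T v x + z * T w x)"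
    using v w by (simp add: T_add_cmult nsq_def)
  also have "\<dots> = nsq M (T v) + 2 * Re (cnj z * ip M (T v) (T w)) + (cmod z)\<^sup>2 * nsq M (T w)"
    by (rule nsq_add_cmult[OF T_L2[OF v] T_L2[OF w]])
  finally have 1: "nsq M (T (\<lambda>j. v j + z * w j)) = \<dots>" .
  have "nsq nats (R (\<lambda>j. v j + z * w j)) = nsq nats (\<lambda>x. R v x + z * R w x)"
    using v w by (simp add: R_add_cmult nsq_def)
  also have "\<dots> = nsq nats (R v) + 2 * Re (cnj z * ip nats (R v) (R w)) + (cmod z)\<^sup>2 * nsq nats (R w)"
    by (rule nsq_add_cmult[OF R_l2[OF v] R_l2[OF w]])
  finally have 2: "nsq nats (R (\<lambda>j. v j + z * w j)) = \<dots>" .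
  show ?thesis unfolding q_def 1 2 by (simp add: right_diff_distrib algebra_simps)
qed

lemma q_cmult: "L2s nats v \<Longrightarrow> q (\<lambda>j. z * v j) = (cmod z)\<^sup>2 * q v"
proof -
  assume v: "L2s nats v"
  have "T (\<lambda>j. 0) = (\<lambda>x. 0)" "R (\<lambda>j. 0) = (\<lambda>k. 0)" by (auto simp: T_def R_def ip_eq)
  then have "q (\<lambda>j. 0) = 0" by (simp add: q_def nsq_def)
  moreover have "ip M (T (\<lambda>j. 0)) (T v) = 0" "ip nats (R (\<lambda>j. 0)) (R v) = 0"
    by (simp_all add: ip_eq \<open>T (\<lambda>j. 0) = (\<lambda>x. 0)\<close> \<open>R (\<lambda>j. 0) = (\<lambda>k. 0)\<close>)
  ultimately show ?thesis using q_add_cmult[OF L2s_zero v, of z] by simp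
qed

lemma q_bound:
  assumes max: "\<And>v. v \<in> l2_ball \<Longrightarrow> q v \<le> c" and v: "L2s nats v"
  shows "q v \<le> c * nsq nats v"
proof (cases "nsq nats v = 0")
  case True
  then have z: "v j = 0" for j
    using nsq_nats_sums[OF v] sum_le_suminf[of "\<lambda>j. (cmod (v j))\<^sup>2" "{j}"] by (auto simp: sums_iff)
  have "q (\<lambda>j. 0 * v j) = 0" by (subst q_cmult[OF v]) simp
  moreover have "(\<lambda>j. 0 * v j) = v" using z by auto
  ultimately show ?thesis using True by simp
next
  case False
  then have pos: "nsq nats v > 0" using nsq_nonneg[of nats v] by linarith
  let ?z = "complex_of_real (1 / sqrt (nsq nats v))"
  have z2: "(cmod ?z)\<^sup>2 = 1 / nsq nats v" using pos by (simp add: norm_divide power_divide)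
  have "(\<lambda>j. ?z * v j) \<in> l2_ball"
    unfolding l2_ball_def mem_Collect_eq nsq_cmult z2 by (intro conjI L2s_cmult v) (use pos in simp)
  from max[OF this] have "1 / nsq nats v * q v \<le> c" unfolding q_cmult[OF v] z2 .
  then show ?thesis using pos by (simp add: field_simps)
qed

text \<open>By compactness \<open>q\<close> attains its maximum over the unit ball, at \<open>w\<close> say. If the maximum is positive,
  its first-order condition \<open>crit\<close>, tested against \<open>u k\<close>, shows that \<open>w\<close> is orthogonal to all \<open>u k\<close>; tested
  against unit vectors, it then says that \<open>T w\<close> is an eigenfunction of the kernel with eigenvalue
  \<open>q w\<close>. It is orthogonal to all \<open>\<phi> k\<close>, but also a linear combination of them.\<close>

lemma q_le_0: "q v \<le> 0" if v: "v \<in> l2_ball"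
proof (rule ccontr)
  assume "\<not> q v \<le> 0"
  have "(\<lambda>_. 0) \<in> l2_ball" by (auto simp: l2_ball_def L2s_zero nsq_def)
  then obtain w where w: "w \<in> l2_ball" "\<And>v. v \<in> l2_ball \<Longrightarrow> q v \<le> q w"
    using continuous_attains_sup[OF compact_l2_ball _ continuous_on_q] by blast
  have pos: "q w > 0" using w(2)[OF v] \<open>\<not> q v \<le> 0\<close> by linarith
  have wl: "L2s nats w" "nsq nats w \<le> 1" using w(1) by (auto simp: l2_ball_def)
  have crit: "q w * ip nats w h = ip M (T w) (T h) - ip nats (R w) (R h)" if h: "L2s nats h" for h
  proof -
    \<comment> \<open>\<open>q w * nsq nats v - q v\<close> is nonnegative for every \<open>v\<close> and at most \<open>0\<close> at \<open>w\<close>; perturb \<open>w\<close> by multiples of \<open>h\<close>\<close>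
    have "q w * ip nats w h - (ip M (T w) (T h) - ip nats (R w) (R h)) = 0"
    proof (rule nonneg_quadratic_imp_zero[where c = "q w * nsq nats h - q h"])
      fix z
      have "q (\<lambda>j. w j + z * h j) \<le> q w * nsq nats (\<lambda>j. w j + z * h j)"
        by (rule q_bound[OF w(2)]) (use wl h in \<open>auto intro!: L2s_add L2s_cmult\<close>)
      then have "q w + 2 * Re (cnj z * (ip M (T w) (T h) - ip nats (R w) (R h))) + (cmod z)\<^sup>2 * q h
         \<le> q w * (nsq nats w + 2 * Re (cnj z * ip nats w h) + (cmod z)\<^sup>2 * nsq nats h)"
        unfolding q_add_cmult[OF wl(1) h] nsq_add_cmult[OF wl(1) h] .
      moreover have "q w * nsq nats w \<le> q w" using wl(2) pos by (simp add: mult_left_le)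
      moreover have "Re (cnj z * (q w * ip nats w h - (ip M (T w) (T h) - ip nats (R w) (R h)))) =
          q w * Re (cnj z * ip nats w h) - Re (cnj z * (ip M (T w) (T h) - ip nats (R w) (R h)))"
        by (simp add: right_diff_distrib algebra_simps)
      ultimately show "0 \<le> 2 * Re (cnj z * (q w * ip nats w h - (ip M (T w) (T h) - ip nats (R w) (R h)))) +
           (cmod z)\<^sup>2 * (q w * nsq nats h - q h)"
        by (simp add: algebra_simps)
    qed
    then show ?thesis by simp
  qed
  have orth: "ip nats w (u k) = 0" if k: "k \<in> I" for k
  proof -
    have "ip M (T w) (T (u k)) = ip M (T w) (\<lambda>x. complex_of_real (sqrt (a k)) * \<phi> k x)"
      by (intro ip_cong_AE) (use k T_u wl in \<open>auto intro!: T_L2 u_l2 \<phi>_L2 L2s_cmult\<close>)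
    also have "\<dots> = complex_of_real (sqrt (a k)) * (complex_of_real (sqrt (a k)) * ip nats w (u k))"
      using wl k by (simp add: ip_cmult_right ip_T_\<phi>)
    finally have 1: "ip M (T w) (T (u k)) = \<dots>" .
    have Ru: "R (u k) = (\<lambda>l. complex_of_real (sqrt (a k)) * unit_vec k l)"
      using orthoD(2)[OF u_ortho k] k by (auto simp: R_def unit_vec_def)
    have "ip nats (R w) (R (u k)) = complex_of_real (sqrt (a k)) * ip nats (R w) (unit_vec k)"
      unfolding Ru by (simp add: ip_cmult_right)
    also have "ip nats (R w) (unit_vec k) = R w k"
      using ip_unit_vec[OF R_l2[OF wl(1)], of k] by (simp add: ip_commute[of nats "R w"])
    also have "\<dots> = complex_of_real (sqrt (a k)) * ip nats w (u k)" using k by (simp add: R_def)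
    finally have "q w * ip nats w (u k) = 0" using crit[OF u_l2[OF k]] 1 by simp
    then show ?thesis using pos by simp
  qed
  then have R0: "R w = (\<lambda>k. 0)" by (auto simp: R_def)
  \<comment> \<open>the condition \<open>crit\<close> at unit vectors, where the terms with \<open>R w\<close> have disappeared\<close>
  have SL: "S (T w) j = q w * w j" for j
  proof -
    have "q w * w j = q w * ip nats w (unit_vec j)"
      using ip_unit_vec[OF wl(1), of j] by (simp add: ip_commute[of nats w])
    also have "\<dots> = ip M (T w) (T (unit_vec j))" using crit[OF unit_vec_l2, of j] by (simp add: R0 ip_eq[of nats "\<lambda>k. 0"])
    also have "\<dots> = S (T w) j" by (simp add: S_def T_unit_vec[abs_def])
    finally show ?thesis by simp
  qed
  have f: "L2s M (T w)" by (rule T_L2[OF wl(1)])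
  have nf: "nsq M (T w) = q w" by (simp add: q_def R0 nsq_def[of nats])
  have "T (S (T w)) x = q w * T w x" for x
    unfolding T_def[of "S (T w)"] SL by (simp add: ip_cmult_left T_def)
  moreover have "\<not> (AE x in M. T w x = 0)" using nsq_eq_0_iff[OF f] nf pos by simp
  moreover have "complex_of_real (q w) \<noteq> 0" using pos by simp
  ultimately obtain F \<beta> where F: "finite F" "F \<subseteq> I" "AE x in M. T w x = (\<Sum>k\<in>F. \<beta> k * \<phi> k x)"
    using complete[of "q w" "T w"] f by auto
  have "ip M (T w) (T w) = ip M (T w) (\<lambda>x. \<Sum>k\<in>F. \<beta> k * \<phi> k x)"
    by (intro ip_cong_AE) (use F f in \<open>auto intro!: L2s_sum L2s_cmult \<phi>_L2\<close>)
  also have "\<dots> = (\<Sum>k\<in>F. cnj (\<beta> k) * ip M (T w) (\<phi> k))"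
    by (subst ip_sum_right) (use F f in \<open>auto intro!: L2s_cmult \<phi>_L2 simp: ip_cmult_right\<close>)
  also have "\<dots> = 0"
    by (rule sum.neutral) (use F wl orth in \<open>auto simp: ip_T_\<phi> subset_iff\<close>)
  finally show False using nf pos by (simp add: ip_self)
qed

text \<open>The values of \<open>q\<close> at the unit vectors are nonpositive, and their sum is the difference of the two
  sides.\<close>

theorem trace_eq: "(\<Sum>k. if k \<in> I then a k else 0) = trace"
proof (rule antisym)
  have "(\<Sum>n<m. nsq M (b n)) \<le> (\<Sum>k. if k \<in> I then a k else 0)" for m
  proof -
    have "nsq M (b n) \<le> nsq nats (R (unit_vec n))" for n
      using q_le_0[of "unit_vec n"] by (simp add: q_def T_unit_vec[abs_def] l2_ball_def unit_vec_l2 nsq_unit_vec)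
    also have "nsq nats (R (unit_vec n)) = (\<Sum>k. (cmod (R (unit_vec n) k))\<^sup>2)" for n
      using nsq_nats_sums[OF R_l2[OF unit_vec_l2]] by (simp add: sums_iff)
    finally have "(\<Sum>n<m. nsq M (b n)) \<le> (\<Sum>n<m. \<Sum>k. (cmod (R (unit_vec n) k))\<^sup>2)"
      by (intro sum_mono) auto
    also have "\<dots> = (\<Sum>k. \<Sum>n<m. (cmod (R (unit_vec n) k))\<^sup>2)"
      by (rule suminf_sum[symmetric]) (use R_l2[OF unit_vec_l2] in \<open>auto simp: l2_iff\<close>)
    also have "\<dots> \<le> (\<Sum>k. if k \<in> I then a k else 0)"
    proof (rule suminf_le[OF _ _ a_summable])
      show "summable (\<lambda>k. \<Sum>n<m. (cmod (R (unit_vec n) k))\<^sup>2)"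
        by (rule summable_sum) (use R_l2[OF unit_vec_l2] in \<open>auto simp: l2_iff\<close>)
      fix k
      show "(\<Sum>n<m. (cmod (R (unit_vec n) k))\<^sup>2) \<le> (if k \<in> I then a k else 0)"
      proof (cases "k \<in> I")
        case True
        note n1 = nsq_orthonormal[OF u_ortho True]
        have "(cmod (R (unit_vec n) k))\<^sup>2 = a k * (cmod (u k n))\<^sup>2" for n
          using True a_pos[OF True] by (simp add: R_def ip_unit_vec[OF u_l2] norm_mult power_mult_distrib)
        then have "(\<Sum>n<m. (cmod (R (unit_vec n) k))\<^sup>2) = a k * (\<Sum>n<m. (cmod (u k n))\<^sup>2)"
          by (simp add: sum_distrib_left)
        also have "(\<Sum>n<m. (cmod (u k n))\<^sup>2) \<le> nsq nats (u k)"
          using sum_le_suminf[of "\<lambda>n. (cmod (u k n))\<^sup>2" "{..<m}"] nsq_nats_sums[OF u_l2[OF True]] by (auto simp: sums_iff)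
        finally show ?thesis using True a_pos[OF True] n1 by (simp add: mult_left_mono)
      qed (simp add: R_def)
    qed
    finally show ?thesis .
  qed
  then show "trace \<le> (\<Sum>k. if k \<in> I then a k else 0)"
    unfolding trace_def by (intro suminf_le_const trace_summable)
  show "(\<Sum>k. if k \<in> I then a k else 0) \<le> trace"
    by (intro suminf_le_const a_summable a_partial_sums)
qed

text \<open>Bessel's inequality holds pointwise, and both sides have the same finite integral.\<close>

lemma diagonal_expansion: "AE x in M. (\<Sum>k. \<Phi> x k) = nsq nats (\<kappa> x)"
proof -
  have n: "norm (\<Phi> x k) = \<Phi> x k" for x k by (simp add: \<Phi>_def)
  have "AE x in M. summable (\<lambda>k. norm (\<Phi> x k))" unfolding n using \<Phi>_summable(1) by simp
  moreover have "summable (\<lambda>k. LINT x|M. norm (\<Phi> x k))" unfolding n \<Phi>_integral by (rule a_summable)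
  ultimately have int: "integrable M (\<lambda>x. \<Sum>k. \<Phi> x k) \<and> (LINT x|M. (\<Sum>k. \<Phi> x k)) = (\<Sum>k. LINT x|M. \<Phi> x k)"
    using integrable_suminf[of M "\<lambda>k x. \<Phi> x k"] integral_suminf[of M "\<lambda>k x. \<Phi> x k"] \<Phi>_integral(1) by blast
  have i2: "integrable M (\<lambda>x. nsq nats (\<kappa> x) - (\<Sum>k. \<Phi> x k))"
    using int nsq_\<kappa>_integral by auto
  have "(LINT x|M. nsq nats (\<kappa> x) - (\<Sum>k. \<Phi> x k)) = 0"
    using int nsq_\<kappa>_integral trace_eq by (simp add: \<Phi>_integral)
  then have "AE x in M. nsq nats (\<kappa> x) - (\<Sum>k. \<Phi> x k) = 0"
    using integral_nonneg_eq_0_iff_AE[OF i2] \<Phi>_summable(2) by auto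
  then show ?thesis by eventually_elim simp
qed

text \<open>Equality in Bessel's inequality for \<open>\<kappa> x\<close> gives the expansion of \<open>T v x\<close> for all \<open>v\<close> at once, so the
  exceptional null set does not depend on \<open>v\<close>.\<close>

lemma expansion:
  "AE x in M. (\<forall>k\<in>I. T (u k) x = complex_of_real (sqrt (a k)) * \<phi> k x) \<and>
     (\<forall>v. L2s nats v \<longrightarrow> (\<lambda>k. if k \<in> I then ip nats v (u k) * (complex_of_real (sqrt (a k)) * \<phi> k x) else 0) sums T v x)"
proof -
  have "AE x in M. \<forall>k\<in>I. T (u k) x = complex_of_real (sqrt (a k)) * \<phi> k x"
    by (subst AE_ball_countable) (use T_u in auto)
  then show ?thesis using diagonal_expansion
  proof eventually_elim
    case (elim x)
    have "\<Phi> x = (\<lambda>k. if k \<in> I then (cmod (ip nats (\<kappa> x) (u k)))\<^sup>2 else 0)"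
      by (auto simp: \<Phi>_def T_def ip_commute[of nats "\<kappa> x"])
    then have full: "(\<lambda>k. if k \<in> I then (cmod (ip nats (\<kappa> x) (u k)))\<^sup>2 else 0) sums nsq nats (\<kappa> x)"
      using \<Phi>_summable(1)[of x] elim(2) by (simp add: sums_iff)
    show ?case
    proof (intro conjI allI impI)
      fix v assume v: "L2s nats v"
      from Parseval_expansion[OF u_ortho \<kappa>_l2 v full]
      show "(\<lambda>k. if k \<in> I then ip nats v (u k) * (complex_of_real (sqrt (a k)) * \<phi> k x) else 0) sums T v x"
        unfolding T_def[symmetric] by (rule sums_cong[THEN iffD1, rotated]) (use elim(1) in auto)
    qed (rule elim(1))
  qed
qed

end

section \<open>Summability of the eigenvalues of a trace-class operator\<close>

lemma kernel_op_UNIV: "kernel_op \<mu> UNIV K f x = (LINT y|\<mu>. K x y * f y)"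
  by (simp add: kernel_op_def set_lebesgue_integral_def)

lemma kernel_op_diff_eigenfunctions:
  assumes K: "bounded_kernel \<mu> K" and f: "L2s \<mu> f" and F: "finite F"
    and \<psi>: "\<And>j. j \<in> F \<Longrightarrow> L2s \<mu> (\<psi> j)"
    and eig: "\<And>j. j \<in> F \<Longrightarrow> AE x in \<mu>. kernel_op \<mu> UNIV K (\<psi> j) x = \<alpha> j * \<psi> j x"
  shows "AE x in \<mu>. kernel_op \<mu> UNIV K (\<lambda>x. f x - (\<Sum>j\<in>F. c j * \<psi> j x)) x =
      kernel_op \<mu> UNIV K f x - (\<Sum>j\<in>F. c j * \<alpha> j * \<psi> j x)"
proof -
  have int: "AE x in \<mu>. integrable \<mu> (\<lambda>y. K x y * g y)" if "L2s \<mu> g" for g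
    using K that by (auto simp: bounded_kernel_def)
  have 1: "AE x in \<mu>. \<forall>j\<in>F. integrable \<mu> (\<lambda>y. K x y * \<psi> j y)"
    using int \<psi> F by (subst AE_ball_countable) (auto simp: countable_finite)
  have 2: "AE x in \<mu>. \<forall>j\<in>F. kernel_op \<mu> UNIV K (\<psi> j) x = \<alpha> j * \<psi> j x"
    using eig F by (subst AE_ball_countable) (auto simp: countable_finite)
  show ?thesis using int[OF f] 1 2
  proof eventually_elim
    case (elim x)
    have i2: "integrable \<mu> (\<lambda>y. \<Sum>j\<in>F. c j * (K x y * \<psi> j y))"
      using elim by (intro Bochner_Integration.integrable_sum integrable_mult_right) auto
    have "kernel_op \<mu> UNIV K (\<lambda>x. f x - (\<Sum>j\<in>F. c j * \<psi> j x)) x = (LINT y|\<mu>. K x y * f y - (\<Sum>j\<in>F. c j * (K x y * \<psi> j y)))"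
      unfolding kernel_op_UNIV by (intro Bochner_Integration.integral_cong refl)
        (simp add: right_diff_distrib sum_distrib_left mult.left_commute)
    also have "\<dots> = (LINT y|\<mu>. K x y * f y) - (LINT y|\<mu>. (\<Sum>j\<in>F. c j * (K x y * \<psi> j y)))"
      by (rule Bochner_Integration.integral_diff[OF elim(1) i2])
    also have "(LINT y|\<mu>. (\<Sum>j\<in>F. c j * (K x y * \<psi> j y))) = (\<Sum>j\<in>F. c j * (LINT y|\<mu>. K x y * \<psi> j y))"
      using elim by (subst Bochner_Integration.integral_sum) auto
    also have "\<dots> = (\<Sum>j\<in>F. c j * \<alpha> j * \<psi> j x)"
      using elim by (intro sum.cong refl) (simp add: kernel_op_UNIV mult.assoc)
    finally show ?case by (simp add: kernel_op_UNIV)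
  qed
qed

text \<open>Removing from \<open>f\<close> its components along the eigenfunctions \<open>\<psi> j\<close>, \<open>j \<in> F\<close>, lowers the quadratic form of
  the operator by exactly the left-hand side, and the form stays nonnegative.\<close>

lemma finite_rank_part_le:
  assumes K: "bounded_kernel \<mu> K" "selfadjoint_kernel \<mu> K" "nonneg_kernel \<mu> K"
    and \<psi>: "ortho \<mu> J \<psi>" and F: "finite F" "F \<subseteq> J"
    and eig: "\<And>j. j \<in> J \<Longrightarrow> AE x in \<mu>. kernel_op \<mu> UNIV K (\<psi> j) x = complex_of_real (\<alpha> j) * \<psi> j x"
    and f: "L2s \<mu> f"
  shows "(\<Sum>j\<in>F. \<alpha> j * (cmod (ip \<mu> f (\<psi> j)))\<^sup>2) \<le> Re (ip \<mu> (kernel_op \<mu> UNIV K f) f)"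
proof -
  let ?K = "kernel_op \<mu> UNIV K"
  let ?c = "\<lambda>j. ip \<mu> f (\<psi> j)"
  let ?s = "\<lambda>x. \<Sum>j\<in>F. ?c j * \<psi> j x"
  let ?g = "\<lambda>x. f x - ?s x"
  have \<psi>L: "L2s \<mu> (\<psi> j)" if "j \<in> F" for j using orthoD(1)[OF \<psi>] that F by auto
  have KL: "L2s \<mu> (?K h)" if "L2s \<mu> h" for h using K(1) that by (auto simp: bounded_kernel_def)
  have s: "L2s \<mu> ?s" by (intro L2s_sum L2s_cmult \<psi>L)
  have g: "L2s \<mu> ?g" by (intro L2s_diff f s)
  let ?r = "\<lambda>x. \<Sum>j\<in>F. ?c j * complex_of_real (\<alpha> j) * \<psi> j x"
  have r: "L2s \<mu> ?r" by (intro L2s_sum L2s_cmult \<psi>L)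
  have Kg: "AE x in \<mu>. ?K ?g x = ?K f x - ?r x"
    by (rule kernel_op_diff_eigenfunctions[OF K(1) f F(1) \<psi>L]) (use eig F in auto)
  have g\<psi>: "ip \<mu> ?g (\<psi> j) = 0" if "j \<in> F" for j
    using ip_orthonormal_sum[OF \<psi> F, of j ?c] that F f s \<psi>L[OF that] by (auto simp: ip_diff_left)
  have K\<psi>: "ip \<mu> (?K f) (\<psi> j) = complex_of_real (\<alpha> j) * ?c j" if "j \<in> F" for j
  proof -
    have "ip \<mu> (?K f) (\<psi> j) = ip \<mu> f (?K (\<psi> j))"
      using K(2) f \<psi>L[OF that] by (auto simp: selfadjoint_kernel_def)
    also have "\<dots> = ip \<mu> f (\<lambda>x. complex_of_real (\<alpha> j) * \<psi> j x)"
      by (intro ip_cong_AE) (use that eig F f in \<open>auto intro!: KL \<psi>L L2s_cmult\<close>)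
    finally show ?thesis by (simp add: ip_cmult_right)
  qed
  have "ip \<mu> (?K ?g) ?g = ip \<mu> (\<lambda>x. ?K f x - ?r x) ?g"
    by (intro ip_cong_AE) (use Kg KL[OF g] g L2s_diff[OF KL[OF f] r] in auto)
  also have "\<dots> = ip \<mu> (?K f) ?g - ip \<mu> ?r ?g"
    by (intro ip_diff_left KL f g r)
  also have "ip \<mu> ?r ?g = (\<Sum>j\<in>F. ?c j * complex_of_real (\<alpha> j) * ip \<mu> (\<psi> j) ?g)"
    by (subst ip_sum_left) (use \<psi>L g in \<open>auto intro!: L2s_cmult simp: ip_cmult_left\<close>)
  also have "\<dots> = 0"
    by (rule sum.neutral) (use g\<psi> in \<open>auto simp: ip_commute[of \<mu> "\<psi> _" ?g]\<close>)
  also have "ip \<mu> (?K f) ?g = ip \<mu> (?K f) f - ip \<mu> (?K f) ?s"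
    by (intro ip_diff_right KL f s)
  also have "ip \<mu> (?K f) ?s = (\<Sum>j\<in>F. cnj (?c j) * ip \<mu> (?K f) (\<psi> j))"
    by (subst ip_sum_right) (use \<psi>L KL[OF f] in \<open>auto intro!: L2s_cmult simp: ip_cmult_right\<close>)
  also have "\<dots> = (\<Sum>j\<in>F. complex_of_real (\<alpha> j * (cmod (?c j))\<^sup>2))"
    by (intro sum.cong refl) (simp only: K\<psi> of_real_mult complex_norm_square, simp add: mult_ac)
  finally have "Re (ip \<mu> (?K ?g) ?g) = Re (ip \<mu> (?K f) f) - (\<Sum>j\<in>F. \<alpha> j * (cmod (?c j))\<^sup>2)"
    by simp
  moreover have "ip \<mu> (?K ?g) ?g \<in> \<real>\<^sub>\<ge>\<^sub>0" using K(3) g by (simp add: nonneg_kernel_def)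
  then have "Re (ip \<mu> (?K ?g) ?g) \<ge> 0" by (simp add: complex_nonneg_Reals_iff)
  ultimately show ?thesis by linarith
qed

lemma eigensystem_ortho: "nonzero_eigensystem \<mu> UNIV K J \<psi> \<alpha> \<Longrightarrow> ortho \<mu> J \<psi>"
  by (simp add: nonzero_eigensystem_def)

lemma eigenvalue_nonneg:
  assumes K: "bounded_kernel \<mu> K" "nonneg_kernel \<mu> K"
    and sys: "nonzero_eigensystem \<mu> UNIV K J \<psi> \<alpha>" and j: "j \<in> J"
  shows "\<alpha> j = complex_of_real (Re (\<alpha> j))" "Re (\<alpha> j) > 0"
proof -
  have \<psi>: "ortho \<mu> J \<psi>" by (rule eigensystem_ortho[OF sys])
  have L: "L2s \<mu> (\<psi> j)" using orthoD(1)[OF \<psi> j] .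
  have eig: "AE x in \<mu>. kernel_op \<mu> UNIV K (\<psi> j) x = \<alpha> j * \<psi> j x" and nz: "\<alpha> j \<noteq> 0"
    using sys j by (auto simp: nonzero_eigensystem_def eigenfunction_def)
  have "ip \<mu> (kernel_op \<mu> UNIV K (\<psi> j)) (\<psi> j) = ip \<mu> (\<lambda>x. \<alpha> j * \<psi> j x) (\<psi> j)"
    by (intro ip_cong_AE) (use K L eig in \<open>auto simp: bounded_kernel_def intro!: L2s_cmult\<close>)
  also have "\<dots> = \<alpha> j" using orthoD(2)[OF \<psi> j j] by (simp add: ip_cmult_left)
  finally have "\<alpha> j \<in> \<real>\<^sub>\<ge>\<^sub>0" using K(2) L by (metis nonneg_kernel_def)
  then show "\<alpha> j = complex_of_real (Re (\<alpha> j))" "Re (\<alpha> j) > 0"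
    using nz by (auto simp: complex_nonneg_Reals_iff complex_eq_iff)
qed

text \<open>By Parseval's identity for the basis \<open>e\<close>, each eigenvalue \<open>\<alpha> j\<close> is the sum over \<open>i\<close> of
  \<open>\<alpha> j * (cmod (ip \<mu> (e i) (\<psi> j)))\<^sup>2\<close>. For finitely many \<open>j\<close> together these terms are at most the
  diagonal entry of the operator at \<open>e i\<close>, and the diagonal entries are summable.\<close>

theorem trace_class_eigenvalues_summable:
  assumes K: "bounded_kernel \<mu> K" "selfadjoint_kernel \<mu> K" "nonneg_kernel \<mu> K" "trace_class_nonneg_kernel \<mu> K"
    and sys: "nonzero_eigensystem \<mu> UNIV K J \<psi> \<alpha>"
  shows "summable (\<lambda>j. if j \<in> J then Re (\<alpha> j) else 0)"
proof -
  have \<psi>: "ortho \<mu> J \<psi>" by (rule eigensystem_ortho[OF sys])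
  note pos = eigenvalue_nonneg[OF K(1,3) sys]
  have eig: "AE x in \<mu>. kernel_op \<mu> UNIV K (\<psi> j) x = complex_of_real (Re (\<alpha> j)) * \<psi> j x" if "j \<in> J" for j
    using sys that pos(1)[OF that] by (auto simp: nonzero_eigensystem_def eigenfunction_def)
  obtain B e where B: "L2_orthonormal_basis \<mu> UNIV B e"
    and sm: "(\<lambda>j. ip \<mu> (kernel_op \<mu> UNIV K (e j)) (e j)) summable_on B"
    using K(4) by (auto simp: trace_class_nonneg_kernel_def)
  have e: "ortho \<mu> B e" using B by (simp add: L2_orthonormal_basis_def)
  define t where "t i = Re (ip \<mu> (kernel_op \<mu> UNIV K (e i)) (e i))" for i
  have t_nonneg: "t i \<ge> 0" if "i \<in> B" for i
    using K(3) orthoD(1)[OF e that] by (auto simp: t_def nonneg_kernel_def complex_nonneg_Reals_iff)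
  have t_sum: "t summable_on B" unfolding t_def using sm by (rule summable_on_Re)
  have t_bound: "sum t E \<le> infsum t B" if "finite E" "E \<subseteq> B" for E
    by (rule finite_sum_le_infsum[OF t_sum that]) (use t_nonneg in auto)
  have bound: "(\<Sum>j\<in>F. Re (\<alpha> j)) \<le> infsum t B" if F: "finite F" "F \<subseteq> J" for F
  proof -
    let ?c = "\<lambda>j i. if i \<in> B then (cmod (ip \<mu> (\<psi> j) (e i)))\<^sup>2 else 0"
    have "?c j sums 1" if "j \<in> F" for j
    proof -
      have j: "j \<in> J" using that F by auto
      show ?thesis
        using Parseval_of_maximal_orthonormal[OF B orthoD(1)[OF \<psi> j]] by (simp add: nsq_orthonormal[OF \<psi> j])
    qed
    then have s: "(\<lambda>i. \<Sum>j\<in>F. Re (\<alpha> j) * ?c j i) sums (\<Sum>j\<in>F. Re (\<alpha> j) * 1)"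
      by (intro sums_sum sums_mult)
    show ?thesis
    proof (rule LIMSEQ_le_const2)
      show "(\<lambda>n. \<Sum>i<n. \<Sum>j\<in>F. Re (\<alpha> j) * ?c j i) \<longlonglongrightarrow> (\<Sum>j\<in>F. Re (\<alpha> j))"
        using s by (simp add: sums_def)
      have "(\<Sum>i<n. \<Sum>j\<in>F. Re (\<alpha> j) * ?c j i) \<le> infsum t B" for n
      proof -
        have "(\<Sum>i<n. \<Sum>j\<in>F. Re (\<alpha> j) * ?c j i) = (\<Sum>i\<in>{i\<in>B. i < n}. \<Sum>j\<in>F. Re (\<alpha> j) * (cmod (ip \<mu> (e i) (\<psi> j)))\<^sup>2)"
        proof (rule sum.mono_neutral_cong_right)
          fix i assume "i \<in> {i\<in>B. i < n}"
          then show "(\<Sum>j\<in>F. Re (\<alpha> j) * ?c j i) = (\<Sum>j\<in>F. Re (\<alpha> j) * (cmod (ip \<mu> (e i) (\<psi> j)))\<^sup>2)"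
            by (intro sum.cong refl) (simp add: ip_commute[of \<mu> "\<psi> _"])
        next
          show "\<forall>i\<in>{..<n} - {i\<in>B. i < n}. (\<Sum>j\<in>F. Re (\<alpha> j) * ?c j i) = 0"
            by (intro ballI sum.neutral) auto
        qed auto
        also have "\<dots> \<le> (\<Sum>i\<in>{i\<in>B. i < n}. t i)"
          unfolding t_def
          by (intro sum_mono finite_rank_part_le[OF K(1-3) \<psi> F eig]) (use orthoD(1)[OF e] in auto)
        also have "\<dots> \<le> infsum t B" by (rule t_bound) auto
        finally show ?thesis .
      qed
      then show "\<exists>N. \<forall>n\<ge>N. (\<Sum>i<n. \<Sum>j\<in>F. Re (\<alpha> j) * ?c j i) \<le> infsum t B" by blast
    qed
  qed
  show ?thesis
  proof (rule bounded_imp_summable[where B = "infsum t B"])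
    show "0 \<le> (if j \<in> J then Re (\<alpha> j) else 0)" for j using pos(2)[of j] by auto
    fix n
    have "(\<Sum>j\<le>n. if j \<in> J then Re (\<alpha> j) else 0) = (\<Sum>j\<in>{j\<in>J. j \<le> n}. Re (\<alpha> j))"
      by (rule sum.mono_neutral_cong_right) auto
    also have "\<dots> \<le> infsum t B" by (rule bound) auto
    finally show "(\<Sum>j\<le>n. if j \<in> J then Re (\<alpha> j) else 0) \<le> infsum t B" .
  qed
qed

section \<open>The kernel restricted to the observed region\<close>

lemma L2_indicator: "L2 \<mu> A f \<longleftrightarrow> L2s \<mu> (\<lambda>x. indicator A x * f x)"
proof -
  have 1: "(\<lambda>x. indicator A x *\<^sub>R f x) = (\<lambda>x. indicator A x * f x)"
    by (auto simp: indicator_def)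
  have 2: "(\<lambda>x. indicator A x *\<^sub>R (cmod (f x))\<^sup>2) = (\<lambda>x. (cmod (indicator A x * f x))\<^sup>2)"
    by (auto simp: indicator_def)
  show ?thesis unfolding L2s_iff unfolding L2_def set_borel_measurable_def set_integrable_def 1 2 by simp
qed

lemma L2_inner_indicator: "L2_inner \<mu> A f g = ip \<mu> (\<lambda>x. indicator A x * f x) (\<lambda>x. indicator A x * g x)"
  unfolding L2_inner_def set_lebesgue_integral_def
  by (intro Bochner_Integration.integral_cong) (auto simp: indicator_def)

text \<open>The features are \<open>sqrt (\<alpha> j) * \<psi> j\<close>, set to \<open>0\<close> outside the set \<open>G\<close> on which the expansion of the kernel is
  known to converge; this makes all series converge everywhere.\<close>

lemma feature_map_of_expansion:
  assumes \<psi>: "ortho \<mu> J \<psi>" and pos: "\<And>j. j \<in> J \<Longrightarrow> \<alpha> j = complex_of_real (Re (\<alpha> j)) \<and> Re (\<alpha> j) > 0"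
    and sm: "summable (\<lambda>j. if j \<in> J then Re (\<alpha> j) else 0)"
    and G: "G \<in> sets \<mu>"
    and exp: "\<And>x y. x \<in> G \<Longrightarrow> y \<in> G \<Longrightarrow> ((\<lambda>j. \<alpha> j * \<psi> j x * cnj (\<psi> j y)) has_sum K x y) J"
    and b_def: "b = (\<lambda>j x. if j \<in> J then indicator G x * (complex_of_real (sqrt (Re (\<alpha> j))) * \<psi> j x) else 0)"
  shows "feature_map \<mu> b"
    and "x \<in> G \<Longrightarrow> y \<in> G \<Longrightarrow> feature_map.T b (feature_map.\<kappa> b y) x = K x y"
    and "x \<notin> G \<Longrightarrow> feature_map.T b v x = 0"
proof -
  have \<psi>L: "L2s \<mu> (\<psi> j)" if "j \<in> J" for j using orthoD(1)[OF \<psi> that] .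
  have bL: "L2s \<mu> (b j)" for j
    unfolding b_def using \<psi>L G by (cases "j \<in> J") (auto intro!: L2s_indicator L2s_cmult simp: L2s_zero)
  have prod: "b j x * cnj (b j y) = (if j \<in> J then \<alpha> j * \<psi> j x * cnj (\<psi> j y) else 0)" if "x \<in> G" "y \<in> G" for j x y
  proof (cases "j \<in> J")
    case True
    let ?s = "complex_of_real (sqrt (Re (\<alpha> j)))"
    have "sqrt (Re (\<alpha> j)) * sqrt (Re (\<alpha> j)) = Re (\<alpha> j)"
      using conjunct2[OF pos[OF True]] by simp
    then have "?s * ?s = complex_of_real (Re (\<alpha> j))" by (simp only: of_real_mult[symmetric])
    also have "\<dots> = \<alpha> j" using conjunct1[OF pos[OF True]] by (rule sym)
    finally have sq: "?s * ?s = \<alpha> j" .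
    have "b j x = ?s * \<psi> j x" "b j y = ?s * \<psi> j y" using True that by (simp_all add: b_def)
    then have "b j x * cnj (b j y) = (?s * ?s) * \<psi> j x * cnj (\<psi> j y)" by (simp only: complex_cnj_mult complex_cnj_complex_of_real mult_ac)
    then show ?thesis unfolding sq using True by simp
  qed (simp add: b_def)
  have sums: "(\<lambda>j. b j x * cnj (b j y)) sums K x y" if "x \<in> G" "y \<in> G" for x y
  proof -
    have "((\<lambda>j. b j x * cnj (b j y)) has_sum K x y) UNIV"
      using exp[OF that] by (subst has_sum_cong_neutral[of J UNIV]) (auto simp: prod[OF that])
    then show ?thesis by (rule has_sum_imp_sums)
  qed
  have sq: "summable (\<lambda>j. (cmod (b j x))\<^sup>2)" for x
  proof (cases "x \<in> G")
    case True
    have "(\<lambda>j. complex_of_real ((cmod (b j x))\<^sup>2)) sums K x x"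
      using sums[OF True True] by (simp only: complex_norm_square)
    then have "summable (\<lambda>j. complex_of_real ((cmod (b j x))\<^sup>2))" by (simp add: sums_iff)
    then show ?thesis by (simp only: summable_complex_of_real)
  next
    case False
    then have "b j x = 0" for j by (simp add: b_def)
    then show ?thesis by simp
  qed
  have tr: "summable (\<lambda>j. nsq \<mu> (b j))"
  proof (rule summable_comparison_test'[OF sm])
    fix j
    show "norm (nsq \<mu> (b j)) \<le> (if j \<in> J then Re (\<alpha> j) else 0)"
    proof (cases "j \<in> J")
      case True
      note n1 = nsq_orthonormal[OF \<psi> True]
      have "nsq \<mu> (b j) \<le> nsq \<mu> (\<lambda>x. complex_of_real (sqrt (Re (\<alpha> j))) * \<psi> j x)"
        unfolding nsq_def
      proof (rule integral_mono)
        show "integrable \<mu> (\<lambda>x. (cmod (b j x))\<^sup>2)" using L2sD(2)[OF bL] .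
        show "integrable \<mu> (\<lambda>x. (cmod (complex_of_real (sqrt (Re (\<alpha> j))) * \<psi> j x))\<^sup>2)"
          using L2sD(2)[OF L2s_cmult[OF \<psi>L[OF True]]] .
        show "(cmod (b j x))\<^sup>2 \<le> (cmod (complex_of_real (sqrt (Re (\<alpha> j))) * \<psi> j x))\<^sup>2" for x
          using True by (simp add: b_def indicator_def)
      qed
      also have "\<dots> = Re (\<alpha> j)" using conjunct2[OF pos[OF True]] by (simp add: nsq_cmult n1)
      finally show ?thesis using True by simp
    qed (simp add: b_def nsq_def)
  qed
  show fm: "feature_map \<mu> b" by unfold_locales (use bL tr sq in auto)
  show "feature_map.T b (feature_map.\<kappa> b y) x = K x y" if "x \<in> G" "y \<in> G"
  proof -
    have "(\<lambda>j. feature_map.\<kappa> b y j * b j x) sums feature_map.T b (feature_map.\<kappa> b y) x"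
      by (rule feature_map.T_sums[OF fm feature_map.\<kappa>_l2[OF fm]])
    then have "(\<lambda>j. b j x * cnj (b j y)) sums feature_map.T b (feature_map.\<kappa> b y) x"
      by (simp add: feature_map.\<kappa>_def[OF fm] mult.commute)
    with sums[OF that] show ?thesis by (metis sums_unique2)
  qed
  show "feature_map.T b v x = 0" if "x \<notin> G"
  proof -
    have "b j x = 0" for j using that by (simp add: b_def)
    then show ?thesis unfolding feature_map.T_def[OF fm] feature_map.\<kappa>_def[OF fm] ip_eq by simp
  qed
qed

text \<open>The three series that the expansion of \<open>K\<close> on \<open>D\<close> provides: for the kernel off a null set of the base
  space, for its diagonal with integrable sum \<open>g\<close>, and for the operators of its restrictions to subsets
  \<open>A\<close> of \<open>D\<close>.\<close>

locale kernel_eigen_expansion =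
  fixes \<mu> :: "'a measure" and D :: "'a set" and K :: "'a \<Rightarrow> 'a \<Rightarrow> complex" and I :: "nat set"
    and \<phi> :: "nat \<Rightarrow> 'a \<Rightarrow> complex" and N :: "'a set" and a :: "nat \<Rightarrow> real" and g :: "'a \<Rightarrow> real"
  assumes null: "N \<in> null_sets \<mu>"
    and a_pos: "\<And>k. k \<in> I \<Longrightarrow> a k > 0"
    and a_summable: "summable (\<lambda>k. if k \<in> I then a k else 0)"
    and g_integrable: "integrable \<mu> g"
    and kernel_sums: "\<And>x y. x \<in> D - N \<Longrightarrow> y \<in> D - N \<Longrightarrow>
      (\<lambda>k. if k \<in> I then complex_of_real (a k) * \<phi> k x * cnj (\<phi> k y) else 0) sums K x y"
    and diagonal_sums: "\<And>x. x \<in> D - N \<Longrightarrow> (\<lambda>k. if k \<in> I then a k * (cmod (\<phi> k x))\<^sup>2 else 0) sums g x"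
    and operator_sums: "\<And>A f x. A \<in> sets \<mu> \<Longrightarrow> A \<subseteq> D \<Longrightarrow> L2 \<mu> A f \<Longrightarrow> x \<in> D - N \<Longrightarrow>
      (\<lambda>k. if k \<in> I then complex_of_real (a k) * L2_inner \<mu> A f (\<phi> k) * \<phi> k x else 0) sums kernel_op \<mu> A K f x"

text \<open>The expansion on the whole space is cut down to \<open>D\<close> and read as a feature map. Its integral operator
  agrees with that of the restricted kernel, so the eigenfunctions on \<open>D\<close>, extended by \<open>0\<close>, form a
  complete eigensystem of the feature map, and its expansion is the desired one.\<close>

theorem restricted_kernel_expansion:
  fixes \<mu> :: "'a measure" and D :: "'a set"
  assumes K: "bounded_kernel \<mu> K" "selfadjoint_kernel \<mu> K" "nonneg_kernel \<mu> K" "trace_class_nonneg_kernel \<mu> K"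
    and exp: "kernel_expansion \<mu> K"
    and D: "D \<in> sets \<mu>" and sp: "space \<mu> = UNIV"
    and sys: "nonzero_eigensystem \<mu> D K I \<phi> \<alpha>"
  shows "\<exists>N a g. kernel_eigen_expansion \<mu> D K I \<phi> N a g"
proof -
  obtain J \<psi> \<beta> N0 where \<psi>: "nonzero_eigensystem \<mu> UNIV K J \<psi> \<beta>" and N0: "N0 \<in> null_sets \<mu>"
    and kexp: "\<And>x y. x \<in> -N0 \<Longrightarrow> y \<in> -N0 \<Longrightarrow> ((\<lambda>j. \<beta> j * \<psi> j x * cnj (\<psi> j y)) has_sum K x y) J"
    using exp by (auto simp: kernel_expansion_def)
  define G where "G = D - N0"
  have G: "G \<in> sets \<mu>" unfolding G_def using D N0 by auto
  note ev = eigenvalue_nonneg[OF K(1,3) \<psi>]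
  define b where "b = (\<lambda>j x. if j \<in> J then indicator G x * (complex_of_real (sqrt (Re (\<beta> j))) * \<psi> j x) else 0)"
  have kexpG: "((\<lambda>j. \<beta> j * \<psi> j x * cnj (\<psi> j y)) has_sum K x y) J" if "x \<in> G" "y \<in> G" for x y
    using kexp that by (simp add: G_def)
  have pos: "\<beta> j = complex_of_real (Re (\<beta> j)) \<and> Re (\<beta> j) > 0" if "j \<in> J" for j
    using ev[OF that] by (rule conjI)
  note ort\<psi> = eigensystem_ortho[OF \<psi>]
  note sum\<beta> = trace_class_eigenvalues_summable[OF K \<psi>]
  have fm: "feature_map \<mu> b"
    by (rule feature_map_of_expansion(1)[OF ort\<psi> _ sum\<beta> G _ b_def]) (fact pos, fact kexpG)
  have fmT: "feature_map.T b (feature_map.\<kappa> b y) x = K x y" if "x \<in> G" "y \<in> G" for x y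
    by (rule feature_map_of_expansion(2)[OF ort\<psi> _ sum\<beta> G _ b_def that]) (fact pos, fact kexpG)
  have fm0: "feature_map.T b v x = 0" if "x \<notin> G" for x v
    by (rule feature_map_of_expansion(3)[OF ort\<psi> _ sum\<beta> G kexpG b_def that]) (fact pos)
  interpret F: feature_map \<mu> b by (rule fm)
  have G_AE: "AE x in \<mu>. x \<in> D \<longleftrightarrow> x \<in> G"
    using AE_not_in[OF N0] by eventually_elim (auto simp: G_def)
  have kop: "kernel_op \<mu> A K f x = F.T (F.S (\<lambda>x. indicator A x * f x)) x"
    if A: "A \<in> sets \<mu>" "A \<subseteq> D" "L2 \<mu> A f" "x \<in> G" for A f x
  proof -
    let ?f = "\<lambda>x. indicator A x * f x"
    have f: "L2s \<mu> ?f" by (rule L2_indicator[THEN iffD1, OF A(3)])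
    note [measurable] = L2sD(1)[OF f]
    have [measurable]: "(\<lambda>y. K x y) \<in> borel_measurable \<mu>"
    proof -
      have "(\<lambda>(x, y). K x y) \<in> borel_measurable (\<mu> \<Otimes>\<^sub>M \<mu>)" using K(1) by (simp add: bounded_kernel_def)
      from measurable_Pair2[OF this, of x] show ?thesis by (simp add: sp)
    qed
    have e: "F.T (F.\<kappa> y) x = (\<Sum>j. cnj (b j y) * b j x)" for y
      using F.T_sums[OF F.\<kappa>_l2, of y x] by (simp add: sums_iff F.\<kappa>_def)
    have [measurable]: "(\<lambda>y. F.T (F.\<kappa> y) x) \<in> borel_measurable \<mu>"
      unfolding e using L2sD(1)[OF F.b_L2] L2sD(1)[OF L2s_cnj[OF F.b_L2]] by simp
    have "kernel_op \<mu> A K f x = (LINT y|\<mu>. K x y * ?f y)"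
      unfolding kernel_op_def set_lebesgue_integral_def
      by (intro Bochner_Integration.integral_cong) (auto simp: indicator_def)
    also have "\<dots> = (LINT y|\<mu>. F.T (F.\<kappa> y) x * ?f y)"
    proof (rule integral_cong_AE)
      show "AE y in \<mu>. K x y * ?f y = F.T (F.\<kappa> y) x * ?f y"
        using G_AE
      proof eventually_elim
        case (elim y)
        then show ?case using A fmT[OF \<open>x \<in> G\<close>, of y] by (cases "y \<in> A") auto
      qed
    qed measurable
    also have "\<dots> = F.T (F.S ?f) x" by (rule F.kernel_integral[OF f])
    finally show ?thesis .
  qed
  define \<phi>' where "\<phi>' k = (\<lambda>x. indicator D x * \<phi> k x)" for k
  have ort: "ortho \<mu> I \<phi>'"
    using sys unfolding nonzero_eigensystem_def L2_orthonormal_def \<phi>'_def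
    by (auto simp: L2_indicator[of \<mu> D] L2_inner_indicator[of \<mu> D])
  have \<phi>L: "L2 \<mu> D (\<phi> k)" if "k \<in> I" for k
    by (rule L2_indicator[THEN iffD2]) (use orthoD(1)[OF ort that] in \<open>simp add: \<phi>'_def\<close>)
  interpret E: feature_eigensystem \<mu> b I \<phi>' \<alpha>
  proof unfold_locales
    show "ortho \<mu> I \<phi>'" by (rule ort)
    fix k assume k: "k \<in> I"
    show "\<alpha> k \<noteq> 0" using sys k by (simp add: nonzero_eigensystem_def)
    have "AE x in \<mu>. x \<in> D \<longrightarrow> kernel_op \<mu> D K (\<phi> k) x = \<alpha> k * \<phi> k x"
      using sys k by (auto simp: nonzero_eigensystem_def eigenfunction_def)
    then show "AE x in \<mu>. F.T (F.S (\<phi>' k)) x = \<alpha> k * \<phi>' k x"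
      using G_AE
    proof eventually_elim
      case (elim x)
      show ?case
      proof (cases "x \<in> G")
        case True
        then show ?thesis using elim kop[OF D order_refl \<phi>L[OF k] True] by (simp add: \<phi>'_def)
      next
        case False
        then show ?thesis using elim fm0 by (simp add: \<phi>'_def)
      qed
    qed
  next
    fix c f assume c: "c \<noteq> 0" and f: "L2s \<mu> f" "\<not> (AE x in \<mu>. f x = 0)" "AE x in \<mu>. F.T (F.S f) x = c * f x"
    \<comment> \<open>the image of the operator vanishes outside \<open>D\<close>, hence so does an eigenfunction\<close>
    have off: "AE x in \<mu>. x \<notin> D \<longrightarrow> f x = 0"
      using f(3) by eventually_elim (use fm0 c in \<open>auto simp: G_def\<close>)
    have fD: "AE x in \<mu>. indicator D x * f x = f x"
      using off by eventually_elim (auto simp: indicator_def)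
    have L: "L2 \<mu> D f" by (rule L2_indicator[THEN iffD2, OF L2s_indicator[OF D f(1)]])
    have Seq: "F.S (\<lambda>x. indicator D x * f x) = F.S f"
      unfolding F.S_def by (intro ext ip_cong_AE) (use fD f L F.b_L2 in \<open>auto simp: L2_indicator[of \<mu> D]\<close>)
    have "AE x in \<mu>. x \<in> D \<longrightarrow> kernel_op \<mu> D K f x = c * f x"
      using f(3) G_AE by eventually_elim (use kop[OF D order_refl L, unfolded Seq] in auto)
    moreover have "\<not> (AE x in \<mu>. x \<in> D \<longrightarrow> f x = 0)"
    proof
      assume "AE x in \<mu>. x \<in> D \<longrightarrow> f x = 0"
      with off have "AE x in \<mu>. f x = 0" by eventually_elim auto
      with f(2) show False by simp
    qed
    ultimately have "eigenfunction \<mu> D K c f" using L by (simp add: eigenfunction_def)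
    then obtain F0 \<gamma> where F0: "finite F0" "F0 \<subseteq> {k\<in>I. \<alpha> k = c}" "AE x in \<mu>. x \<in> D \<longrightarrow> f x = (\<Sum>k\<in>F0. \<gamma> k * \<phi> k x)"
      using sys c unfolding nonzero_eigensystem_def by blast
    have "AE x in \<mu>. f x = (\<Sum>k\<in>F0. \<gamma> k * \<phi>' k x)"
      using off F0(3) by eventually_elim (auto simp: \<phi>'_def indicator_def)
    with F0 show "\<exists>F \<beta>. finite F \<and> F \<subseteq> I \<and> (AE x in \<mu>. f x = (\<Sum>k\<in>F. \<beta> k * \<phi>' k x))" by blast
  qed
  obtain N1 where N1: "N1 \<in> null_sets \<mu>" and good:
    "\<And>x. x \<notin> N1 \<Longrightarrow> (\<forall>k\<in>I. F.T (E.u k) x = complex_of_real (sqrt (E.a k)) * \<phi>' k x) \<and>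
     (\<forall>v. L2s nats v \<longrightarrow> (\<lambda>k. if k \<in> I then ip nats v (E.u k) * (complex_of_real (sqrt (E.a k)) * \<phi>' k x) else 0) sums F.T v x)"
    using E.expansion unfolding eventually_ae_filter by (auto simp: sp)
  define N where "N = N0 \<union> N1"
  have inG: "x \<in> G" "x \<in> D" "x \<notin> N1" if "x \<in> D - N" for x using that by (auto simp: N_def G_def)
  have sqa: "complex_of_real (sqrt (E.a k)) * complex_of_real (sqrt (E.a k)) = complex_of_real (E.a k)" if "k \<in> I" for k
    using E.a_pos[OF that] by (simp flip: of_real_mult)
  have expK: "(\<lambda>k. if k \<in> I then complex_of_real (E.a k) * \<phi> k x * cnj (\<phi> k y) else 0) sums K x y"
    if x: "x \<in> D - N" and y: "y \<in> D - N" for x y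
  proof -
    have "(\<lambda>k. if k \<in> I then ip nats (F.\<kappa> y) (E.u k) * (complex_of_real (sqrt (E.a k)) * \<phi>' k x) else 0) sums F.T (F.\<kappa> y) x"
      using good[OF inG(3)[OF x]] F.\<kappa>_l2 by blast
    moreover have "ip nats (F.\<kappa> y) (E.u k) * (complex_of_real (sqrt (E.a k)) * \<phi>' k x) = complex_of_real (E.a k) * \<phi> k x * cnj (\<phi> k y)"
      if k: "k \<in> I" for k
    proof -
      have "ip nats (F.\<kappa> y) (E.u k) = cnj (F.T (E.u k) y)"
        unfolding F.T_def by (rule ip_commute)
      also have "\<dots> = complex_of_real (sqrt (E.a k)) * cnj (\<phi> k y)"
        using good[OF inG(3)[OF y]] k inG(2)[OF y] by (simp add: \<phi>'_def)
      finally have "ip nats (F.\<kappa> y) (E.u k) * (complex_of_real (sqrt (E.a k)) * \<phi>' k x) =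
         (complex_of_real (sqrt (E.a k)) * complex_of_real (sqrt (E.a k))) * \<phi> k x * cnj (\<phi> k y)"
        using inG(2)[OF x] by (simp add: \<phi>'_def mult_ac)
      then show ?thesis unfolding sqa[OF k] .
    qed
    ultimately show ?thesis
      using fmT[OF inG(1)[OF x] inG(1)[OF y]] by (simp cong: if_cong)
  qed
  show ?thesis
  proof (intro exI[of _ N] exI[of _ E.a] exI[of _ "\<lambda>x. nsq nats (F.\<kappa> x)"] kernel_eigen_expansion.intro)
    show "N \<in> null_sets \<mu>" unfolding N_def by (rule null_sets.Un[OF N0 N1])
    show "E.a k > 0" if "k \<in> I" for k by (rule E.a_pos[OF that])
    show "summable (\<lambda>k. if k \<in> I then E.a k else 0)" by (rule E.a_summable)
    show "integrable \<mu> (\<lambda>x. nsq nats (F.\<kappa> x))" by (rule F.nsq_\<kappa>_integral)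
    show "(\<lambda>k. if k \<in> I then complex_of_real (E.a k) * \<phi> k x * cnj (\<phi> k y) else 0) sums K x y"
      if "x \<in> D - N" "y \<in> D - N" for x y by (rule expK[OF that])
    show "(\<lambda>k. if k \<in> I then E.a k * (cmod (\<phi> k x))\<^sup>2 else 0) sums nsq nats (F.\<kappa> x)" if x: "x \<in> D - N" for x
    proof -
      have "K x x = ip nats (F.\<kappa> x) (F.\<kappa> x)"
        using fmT[OF inG(1)[OF x] inG(1)[OF x]] by (simp add: F.T_def)
      then have "K x x = complex_of_real (nsq nats (F.\<kappa> x))" by (simp add: ip_self)
      moreover have "(\<lambda>k. if k \<in> I then complex_of_real (E.a k) * \<phi> k x * cnj (\<phi> k x) else 0) =
        (\<lambda>k. complex_of_real (if k \<in> I then E.a k * (cmod (\<phi> k x))\<^sup>2 else 0))"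
        by (auto simp: mult.assoc complex_norm_square simp del: of_real_power)
      ultimately show ?thesis using expK[OF x x] by (simp only: sums_of_real_iff)
    qed
    show "(\<lambda>k. if k \<in> I then complex_of_real (E.a k) * L2_inner \<mu> A f (\<phi> k) * \<phi> k x else 0) sums kernel_op \<mu> A K f x"
      if A: "A \<in> sets \<mu>" "A \<subseteq> D" "L2 \<mu> A f" and x: "x \<in> D - N" for A f x
    proof -
      let ?f = "\<lambda>x. indicator A x * f x"
      have f: "L2s \<mu> ?f" by (rule L2_indicator[THEN iffD1, OF A(3)])
      have "(\<lambda>k. if k \<in> I then ip nats (F.S ?f) (E.u k) * (complex_of_real (sqrt (E.a k)) * \<phi>' k x) else 0) sums F.T (F.S ?f) x"
        using good[OF inG(3)[OF x]] F.S_l2[OF f] by blast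
      moreover have "ip nats (F.S ?f) (E.u k) * (complex_of_real (sqrt (E.a k)) * \<phi>' k x) =
          complex_of_real (E.a k) * L2_inner \<mu> A f (\<phi> k) * \<phi> k x" if k: "k \<in> I" for k
      proof -
        have "ip \<mu> ?f (\<phi>' k) = L2_inner \<mu> A f (\<phi> k)"
          unfolding L2_inner_indicator[of \<mu> A] unfolding ip_eq \<phi>'_def
          by (intro Bochner_Integration.integral_cong) (use A in \<open>auto simp: indicator_def\<close>)
        then have ipk: "ip nats (F.S ?f) (E.u k) = complex_of_real (sqrt (E.a k)) * L2_inner \<mu> A f (\<phi> k)"
          using E.ip_u[OF f k] by (simp only:)
        have "ip nats (F.S ?f) (E.u k) * (complex_of_real (sqrt (E.a k)) * \<phi>' k x) =
           (complex_of_real (sqrt (E.a k)) * complex_of_real (sqrt (E.a k))) * L2_inner \<mu> A f (\<phi> k) * \<phi> k x"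
          unfolding ipk using inG(2)[OF x] by (simp add: \<phi>'_def mult_ac)
        then show ?thesis unfolding sqa[OF k] .
      qed
      ultimately show ?thesis
        using kop[OF A inG(1)[OF x]] by (simp cong: if_cong)
    qed
  qed
qed

section \<open>Integrals of permanents over blocks\<close>

text \<open>Open sets with compact closure have finite measure, and by Lindelof countably many of them cover
  the space.\<close>

lemma sigma_finite_radon:
  fixes \<mu> :: "'a::polish_space measure"
  assumes lc: "locally compact (UNIV :: 'a set)" and \<mu>: "radon_measure \<mu>"
  shows "sigma_finite_measure \<mu>"
proof -
  have sets: "sets \<mu> = sets borel" and fin: "\<And>C. compact C \<Longrightarrow> emeasure \<mu> C < \<top>"
    using \<mu> by (auto simp: radon_measure_def)
  let ?F = "{U :: 'a set. open U \<and> (\<exists>C. compact C \<and> U \<subseteq> C)}"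
  obtain F' where F': "F' \<subseteq> ?F" "countable F'" "\<Union>F' = \<Union>?F"
    using Lindelof[of ?F] by auto
  have "\<Union>?F = UNIV"
  proof safe
    fix x :: 'a
    obtain U C where "x \<in> U" "U \<subseteq> C" "open U" "compact C"
      using lc unfolding locally_compact by simp metis
    then show "x \<in> \<Union>?F" by blast
  qed auto
  show ?thesis
  proof
    show "\<exists>A. countable A \<and> A \<subseteq> sets \<mu> \<and> \<Union>A = space \<mu> \<and> (\<forall>a\<in>A. emeasure \<mu> a \<noteq> \<infinity>)"
    proof (intro exI conjI ballI)
      show "countable F'" by fact
      show "F' \<subseteq> sets \<mu>" using F' by (auto simp: sets)
      show "\<Union>F' = space \<mu>" using F' \<open>\<Union>?F = UNIV\<close> sets_eq_imp_space_eq[OF sets] by simp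
      fix U assume "U \<in> F'"
      with F'(1) obtain C where "compact C" "U \<subseteq> C" by auto
      then have "emeasure \<mu> U \<le> emeasure \<mu> C" by (intro emeasure_mono) (auto simp: sets compact_imp_closed)
      with fin[OF \<open>compact C\<close>] show "emeasure \<mu> U \<noteq> \<infinity>" by auto
    qed
  qed
qed

lemma AE_PiM_all_coordinates:
  assumes \<mu>: "sigma_finite_measure \<mu>" and N: "N \<in> null_sets \<mu>" and U: "finite U"
  shows "AE x in PiM U (\<lambda>_. \<mu>). \<forall>u\<in>U. x u \<notin> N"
proof -
  interpret sigma_finite_measure \<mu> by fact
  interpret product_sigma_finite "\<lambda>_. \<mu>" by unfold_locales
  have "AE x in PiM U (\<lambda>_. \<mu>). x u \<notin> N" if u: "u \<in> U" for u
  proof (rule AE_I')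
    let ?A = "PiE U (\<lambda>i. if i = u then N else space \<mu>)"
    have "emeasure (PiM U (\<lambda>_. \<mu>)) ?A = (\<Prod>i\<in>U. emeasure \<mu> (if i = u then N else space \<mu>))"
      by (rule emeasure_PiM[OF U]) (use N in auto)
    also have "\<dots> = 0" using u N U by (intro prod_zero) (auto intro!: bexI[of _ u])
    finally show "?A \<in> null_sets (PiM U (\<lambda>_. \<mu>))"
      using N U by (auto intro!: null_setsI sets_PiM_I_finite)
    show "{x \<in> space (PiM U (\<lambda>_. \<mu>)). \<not> x u \<notin> N} \<subseteq> ?A"
      by (auto simp: space_PiM PiE_iff extensional_def)
  qed
  then show ?thesis using U by (subst AE_ball_countable) (auto simp: countable_finite)
qed

text \<open>The moment of the colouring \<open>c\<close> of \<open>n\<close> slots contributed by the eigenfunctions with index in \<open>A\<close>.\<close>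

definition colour_permanent :: "nat set \<Rightarrow> nat \<Rightarrow> (nat \<Rightarrow> 'i) \<Rightarrow> (nat \<Rightarrow> 'i \<Rightarrow> real) \<Rightarrow> real" where
  "colour_permanent A n c lam = (\<Sum>f\<in>{..<n} \<rightarrow>\<^sub>E A.
     real (card (fibre_permutations f {..<n})) * (\<Prod>u<n. lam (f u) (c u)))"

lemma L2_subset:
  assumes f: "L2 \<mu> A f" and B: "B \<in> sets \<mu>" "B \<subseteq> A"
  shows "L2 \<mu> B f"
proof -
  have "L2s \<mu> (\<lambda>x. indicator B x * (indicator A x * f x))"
    by (rule L2s_indicator[OF B(1) L2_indicator[THEN iffD1, OF f]])
  also have "(\<lambda>x. indicator B x * (indicator A x * f x)) = (\<lambda>x. indicator B x * f x)"
  proof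
    fix x show "indicator B x * (indicator A x * f x) = indicator B x * f x"
      using B(2) by (cases "x \<in> B") auto
  qed
  finally show ?thesis by (rule L2_indicator[THEN iffD2])
qed

lemma L2_inner_self:
  "L2_inner \<mu> A f f = complex_of_real (nsq \<mu> (\<lambda>x. indicator A x * f x))"
  unfolding L2_inner_indicator[of \<mu> A] ip_self ..

lemma nsq_disjoint_union:
  fixes D :: "'i \<Rightarrow> 'a set"
  assumes R: "finite R" and dis: "disjoint_family_on D R"
    and f: "\<And>i. i \<in> R \<Longrightarrow> L2 \<mu> (D i) f"
  shows "nsq \<mu> (\<lambda>x. indicator (\<Union>i\<in>R. D i) x * f x) = (\<Sum>i\<in>R. nsq \<mu> (\<lambda>x. indicator (D i) x * f x))"
proof -
  have "(cmod (indicator (\<Union>i\<in>R. D i) x * f x))\<^sup>2 = (\<Sum>i\<in>R. (cmod (indicator (D i) x * f x))\<^sup>2)" for x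
  proof (cases "\<exists>j\<in>R. x \<in> D j")
    case True
    then obtain j where j: "j \<in> R" "x \<in> D j" by auto
    have "(\<Sum>i\<in>R. (cmod (indicator (D i) x * f x))\<^sup>2) = (\<Sum>i\<in>{j}. (cmod (indicator (D i) x * f x))\<^sup>2)"
    proof (rule sum.mono_neutral_right)
      show "\<forall>i\<in>R - {j}. (cmod (indicator (D i) x * f x))\<^sup>2 = 0"
        using j dis by (auto simp: disjoint_family_on_def indicator_def)
    qed (use R j in auto)
    moreover have "x \<in> (\<Union>i\<in>R. D i)" using j by auto
    ultimately show ?thesis using j by simp
  next
    case False
    then have "indicator (D i) x = (0::complex)" if "i \<in> R" for i using that by auto
    then show ?thesis using False by simp
  qed
  then show ?thesis unfolding nsq_def
    using L2sD(2)[OF L2_indicator[THEN iffD1, OF f]] by (simp add: Bochner_Integration.integral_sum)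
qed

text \<open>Simultaneously observable sets together with an expansion of the kernel on their union.\<close>

locale common_eigenfunctions = kernel_eigen_expansion \<mu> "\<Union>i\<in>R. D i" K I \<phi> N a g
  for \<mu> :: "'a measure" and D :: "'i \<Rightarrow> 'a set" and R K I \<phi> N a g +
  fixes lam :: "nat \<Rightarrow> 'i \<Rightarrow> real"
  assumes base_sigma_finite: "sigma_finite_measure \<mu>"
    and R: "finite R" and D: "\<And>i. i \<in> R \<Longrightarrow> D i \<in> sets \<mu>" and disjoint: "disjoint_family_on D R"
    and orthonormal: "L2_orthonormal \<mu> (\<Union>i\<in>R. D i) I \<phi>"
    and orthogonal: "\<And>i k l. i \<in> R \<Longrightarrow> k \<in> I \<Longrightarrow> l \<in> I \<Longrightarrow> k \<noteq> l \<Longrightarrow> L2_inner \<mu> (D i) (\<phi> k) (\<phi> l) = 0"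
    and eigen: "\<And>i k. i \<in> R \<Longrightarrow> k \<in> I \<Longrightarrow> (AE x in \<mu>. x \<in> D i \<longrightarrow> \<phi> k x = 0) \<and> lam k i = 0 \<or>
        eigenfunction \<mu> (D i) K (complex_of_real (lam k i)) (\<phi> k)"
begin

lemma \<phi>_L2:
  assumes "i \<in> R" "k \<in> I"
  shows "L2 \<mu> (D i) (\<phi> k)"
  by (rule L2_subset[where A = "\<Union>i\<in>R. D i"]) (use orthonormal D assms in \<open>auto simp: L2_orthonormal_def\<close>)

text \<open>The series for the operator restricted to \<open>D i\<close>, applied to \<open>\<phi> k\<close>, reduces to the term of index \<open>k\<close>
  by orthogonality on \<open>D i\<close>. Comparing with the eigenvalue equation identifies \<open>lam k i\<close>.\<close>

lemma lam_eq:
  assumes i: "i \<in> R" and k: "k \<in> I"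
  shows "lam k i = a k * nsq \<mu> (\<lambda>x. indicator (D i) x * \<phi> k x)"
proof -
  let ?\<nu> = "nsq \<mu> (\<lambda>x. indicator (D i) x * \<phi> k x)"
  have op': "kernel_op \<mu> (D i) K (\<phi> k) x = complex_of_real (a k * ?\<nu>) * \<phi> k x" if x: "x \<in> D i - N" for x
  proof -
    have "(\<lambda>l. if l \<in> I then complex_of_real (a l) * L2_inner \<mu> (D i) (\<phi> k) (\<phi> l) * \<phi> l x else 0) sums kernel_op \<mu> (D i) K (\<phi> k) x"
      by (rule operator_sums) (use i x D \<phi>_L2[OF i k] in auto)
    moreover have "(\<lambda>l. if l \<in> I then complex_of_real (a l) * L2_inner \<mu> (D i) (\<phi> k) (\<phi> l) * \<phi> l x else 0) sums
        (\<Sum>l\<in>{k}. if l \<in> I then complex_of_real (a l) * L2_inner \<mu> (D i) (\<phi> k) (\<phi> l) * \<phi> l x else 0)"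
      by (rule sums_finite) (use orthogonal[OF i k] in auto)
    ultimately have "kernel_op \<mu> (D i) K (\<phi> k) x = (\<Sum>l\<in>{k}. if l \<in> I then complex_of_real (a l) * L2_inner \<mu> (D i) (\<phi> k) (\<phi> l) * \<phi> l x else 0)"
      by (rule sums_unique2)
    then show ?thesis using k by (simp add: L2_inner_self)
  qed
  show ?thesis using eigen[OF i k]
  proof
    assume z: "(AE x in \<mu>. x \<in> D i \<longrightarrow> \<phi> k x = 0) \<and> lam k i = 0"
    then have "AE x in \<mu>. indicator (D i) x * \<phi> k x = 0"
      by (auto elim!: eventually_mono simp: indicator_def)
    then have "?\<nu> = 0" using nsq_eq_0_iff[OF L2_indicator[THEN iffD1, OF \<phi>_L2[OF i k]]] by simp
    then show ?thesis using z by simp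
  next
    assume e: "eigenfunction \<mu> (D i) K (complex_of_real (lam k i)) (\<phi> k)"
    show ?thesis
    proof (rule ccontr)
      assume ne: "lam k i \<noteq> a k * ?\<nu>"
      have "AE x in \<mu>. x \<in> D i \<longrightarrow> kernel_op \<mu> (D i) K (\<phi> k) x = complex_of_real (lam k i) * \<phi> k x"
        using e by (simp add: eigenfunction_def)
      then have "AE x in \<mu>. x \<in> D i \<longrightarrow> \<phi> k x = 0"
        using AE_not_in[OF null]
      proof eventually_elim
        case (elim x)
        show ?case
        proof
          assume x: "x \<in> D i"
          then have "complex_of_real (a k * ?\<nu>) * \<phi> k x = complex_of_real (lam k i) * \<phi> k x"
            using elim op'[of x] by simp
          then show "\<phi> k x = 0" using ne by (metis mult_right_cancel of_real_eq_iff)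
        qed
      qed
      then show False using e by (simp add: eigenfunction_def)
    qed
  qed
qed

lemma lam_inner:
  assumes "i \<in> R" "k \<in> I" "l \<in> I"
  shows "complex_of_real (a k) * L2_inner \<mu> (D i) (\<phi> k) (\<phi> l) = (if k = l then complex_of_real (lam k i) else 0)"
  using assms orthogonal lam_eq by (auto simp: L2_inner_self)

lemma sum_lam:
  assumes k: "k \<in> I"
  shows "(\<Sum>i\<in>R. lam k i) = a k"
proof -
  have "complex_of_real (nsq \<mu> (\<lambda>x. indicator (\<Union>i\<in>R. D i) x * \<phi> k x)) = 1"
    using orthonormal k unfolding L2_inner_self[symmetric] by (simp add: L2_orthonormal_def)
  then have "nsq \<mu> (\<lambda>x. indicator (\<Union>i\<in>R. D i) x * \<phi> k x) = 1"
    by (simp only: of_real_eq_1_iff)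
  then have "(\<Sum>i\<in>R. nsq \<mu> (\<lambda>x. indicator (D i) x * \<phi> k x)) = 1"
    using nsq_disjoint_union[OF R disjoint \<phi>_L2[OF _ k]] by simp
  moreover have "(\<Sum>i\<in>R. lam k i) = a k * (\<Sum>i\<in>R. nsq \<mu> (\<lambda>x. indicator (D i) x * \<phi> k x))"
    using lam_eq[OF _ k] by (simp add: sum_distrib_left)
  ultimately show ?thesis by simp
qed


text \<open>Only finitely many eigenfunctions are used at a time, so that the permanent of the truncated kernel
  \<open>Km\<close> is a finite sum.\<close>

definition trunc :: "nat \<Rightarrow> nat set" where "trunc m = {k\<in>I. k < m}"

definition Km :: "nat \<Rightarrow> 'a \<Rightarrow> 'a \<Rightarrow> complex" where
  "Km m x y = (\<Sum>k\<in>trunc m. complex_of_real (a k) * \<phi> k x * cnj (\<phi> k y))"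

definition DD :: "'a set" where "DD = (\<Union>i\<in>R. D i) - N"

lemma finite_trunc: "finite (trunc m)" by (simp add: trunc_def)

lemma Km_tendsto: "x \<in> DD \<Longrightarrow> y \<in> DD \<Longrightarrow> (\<lambda>m. Km m x y) \<longlonglongrightarrow> K x y"
proof -
  assume "x \<in> DD" "y \<in> DD"
  then have "(\<lambda>m. \<Sum>k<m. if k \<in> I then complex_of_real (a k) * \<phi> k x * cnj (\<phi> k y) else 0) \<longlonglongrightarrow> K x y"
    using kernel_sums by (auto simp: sums_def DD_def)
  moreover have "(\<Sum>k<m. if k \<in> I then complex_of_real (a k) * \<phi> k x * cnj (\<phi> k y) else 0) = Km m x y" for m
    unfolding Km_def trunc_def by (rule sum.mono_neutral_cong_right) auto
  ultimately show ?thesis by simp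
qed

lemma g_nonneg: "x \<in> DD \<Longrightarrow> 0 \<le> g x"
proof -
  assume "x \<in> DD"
  then have s: "(\<lambda>k. if k \<in> I then a k * (cmod (\<phi> k x))\<^sup>2 else 0) sums g x" using diagonal_sums by (auto simp: DD_def)
  show ?thesis
    by (rule sums_le[OF _ sums_zero s]) (use a_pos in \<open>auto intro!: mult_nonneg_nonneg intro: less_imp_le\<close>)
qed

lemma sum_sq_le: "x \<in> DD \<Longrightarrow> (\<Sum>k\<in>trunc m. a k * (cmod (\<phi> k x))\<^sup>2) \<le> g x"
proof -
  assume "x \<in> DD"
  then have s: "(\<lambda>k. if k \<in> I then a k * (cmod (\<phi> k x))\<^sup>2 else 0) sums g x" using diagonal_sums by (auto simp: DD_def)
  have "(\<Sum>k\<in>trunc m. a k * (cmod (\<phi> k x))\<^sup>2) = (\<Sum>k<m. if k \<in> I then a k * (cmod (\<phi> k x))\<^sup>2 else 0)"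
    unfolding trunc_def by (rule sum.mono_neutral_cong_left) auto
  also have "\<dots> \<le> g x"
    unfolding sums_unique[OF s]
    by (rule sum_le_suminf[OF sums_summable[OF s]]) (use a_pos in \<open>auto intro!: mult_nonneg_nonneg intro: less_imp_le\<close>)
  finally show ?thesis .
qed

text \<open>The Cauchy-Schwarz inequality for finite sums, with a bound that does not depend on the
  truncation.\<close>

lemma Km_bound:
  assumes x: "x \<in> DD" and y: "y \<in> DD"
  shows "cmod (Km m x y) \<le> sqrt (g x) * sqrt (g y)"
proof -
  have "cmod (Km m x y) \<le> (\<Sum>k\<in>trunc m. (sqrt (a k) * cmod (\<phi> k x)) * (sqrt (a k) * cmod (\<phi> k y)))"
    unfolding Km_def
  proof (rule sum_norm_le)
    fix k assume "k \<in> trunc m"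
    then have pos: "a k > 0" using a_pos by (auto simp: trunc_def)
    have "cmod (complex_of_real (a k) * \<phi> k x * cnj (\<phi> k y)) = (sqrt (a k) * sqrt (a k)) * cmod (\<phi> k x) * cmod (\<phi> k y)"
      using pos by (simp add: norm_mult)
    then show "cmod (complex_of_real (a k) * \<phi> k x * cnj (\<phi> k y)) \<le> (sqrt (a k) * cmod (\<phi> k x)) * (sqrt (a k) * cmod (\<phi> k y))"
      by (simp only: mult_ac order_refl)
  qed
  also have "\<dots> \<le> sqrt ((\<Sum>k\<in>trunc m. (sqrt (a k) * cmod (\<phi> k x))\<^sup>2)) * sqrt (\<Sum>k\<in>trunc m. (sqrt (a k) * cmod (\<phi> k y))\<^sup>2)"
  proof -
    have "(\<Sum>k\<in>trunc m. (sqrt (a k) * cmod (\<phi> k x)) * (sqrt (a k) * cmod (\<phi> k y)))\<^sup>2 \<le>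
       (\<Sum>k\<in>trunc m. (sqrt (a k) * cmod (\<phi> k x))\<^sup>2) * (\<Sum>k\<in>trunc m. (sqrt (a k) * cmod (\<phi> k y))\<^sup>2)"
      by (rule Cauchy_Schwarz_ineq_sum)
    then show ?thesis unfolding real_sqrt_mult[symmetric] by (rule real_le_rsqrt)
  qed
  also have "\<dots> \<le> sqrt (g x) * sqrt (g y)"
  proof -
    have "(\<Sum>k\<in>trunc m. (sqrt (a k) * cmod (\<phi> k z))\<^sup>2) = (\<Sum>k\<in>trunc m. a k * (cmod (\<phi> k z))\<^sup>2)" for z
      by (rule sum.cong) (use a_pos in \<open>auto simp: trunc_def power_mult_distrib less_imp_le\<close>)
    moreover have "0 \<le> sqrt (\<Sum>k\<in>trunc m. (sqrt (a k) * cmod (\<phi> k y))\<^sup>2)"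
      by (intro real_sqrt_ge_zero sum_nonneg zero_le_power2)
    ultimately show ?thesis using sum_sq_le[OF x, of m] sum_sq_le[OF y, of m] g_nonneg[OF x] g_nonneg[OF y]
      by (intro mult_mono real_sqrt_le_mono) simp_all
  qed
  finally show ?thesis .
qed

text \<open>In every term of the permanent, each point occurs once as a first and once as a second argument
  of the kernel, so the square roots combine to \<open>g (x u)\<close>. This gives an integrable bound.\<close>

lemma prod_bound:
  fixes Q :: "'a \<Rightarrow> 'a \<Rightarrow> complex"
  assumes Q: "\<And>x y. x \<in> DD \<Longrightarrow> y \<in> DD \<Longrightarrow> cmod (Q x y) \<le> sqrt (g x) * sqrt (g y)"
    and x: "\<And>u. u < n \<Longrightarrow> x u \<in> DD"
  shows "cmod (per n (\<lambda>i j. Q (x i) (x j))) \<le> fact n * (\<Prod>u<n. g (x u))"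
proof -
  have "cmod (per n (\<lambda>i j. Q (x i) (x j))) \<le> (\<Sum>\<pi> | \<pi> permutes {..<n}. (\<Prod>u<n. g (x u)))"
    unfolding per_def
  proof (rule sum_norm_le)
    fix \<pi> assume "\<pi> \<in> {\<pi>. \<pi> permutes {..<n}}"
    then have p: "\<pi> permutes {..<n}" by simp
    have "cmod (\<Prod>i<n. Q (x i) (x (\<pi> i))) \<le> (\<Prod>i<n. sqrt (g (x i)) * sqrt (g (x (\<pi> i))))"
      unfolding prod_norm[symmetric]
    proof (rule prod_mono)
      fix i assume "i \<in> {..<n}"
      moreover from this have "\<pi> i < n" using permutes_in_image[OF p, of i] by simp
      ultimately show "0 \<le> cmod (Q (x i) (x (\<pi> i))) \<and> cmod (Q (x i) (x (\<pi> i))) \<le> sqrt (g (x i)) * sqrt (g (x (\<pi> i)))"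
        using Q x by simp
    qed
    also have "\<dots> = (\<Prod>i<n. sqrt (g (x i))) * (\<Prod>i<n. sqrt (g (x (\<pi> i))))" by (simp add: prod.distrib)
    also have "(\<Prod>i<n. sqrt (g (x (\<pi> i)))) = (\<Prod>i<n. sqrt (g (x i)))"
      using prod.permute[OF p, of "\<lambda>i. sqrt (g (x i))"] by (simp add: comp_def)
    also have "(\<Prod>i<n. sqrt (g (x i))) * (\<Prod>i<n. sqrt (g (x i))) = (\<Prod>i<n. g (x i))"
      unfolding prod.distrib[symmetric] by (rule prod.cong) (use x g_nonneg in auto)
    finally show "cmod (\<Prod>i<n. Q (x i) (x (\<pi> i))) \<le> (\<Prod>u<n. g (x u))" .
  qed
  also have "\<dots> = fact n * (\<Prod>u<n. g (x u))"
    using card_permutations[of "{..<n}" n] by simp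
  finally show ?thesis .
qed

definition block :: "nat \<Rightarrow> (nat \<Rightarrow> 'i) \<Rightarrow> (nat \<Rightarrow> 'a) \<Rightarrow> complex" where
  "block n c x = (\<Prod>u<n. indicator (D (c u)) (x u))"

text \<open>The factor that the point \<open>y\<close> in a slot of colour \<open>i\<close> contributes when \<open>k\<close> is the index of that slot
  and \<open>l\<close> the index of the slot whose kernel factor has \<open>y\<close> as second argument.\<close>

definition kterm :: "nat \<Rightarrow> nat \<Rightarrow> 'i \<Rightarrow> 'a \<Rightarrow> complex" where
  "kterm k l i y = complex_of_real (a k) * (indicator (D i) y *\<^sub>R (\<phi> k y * cnj (\<phi> l y)))"

lemma kterm_integrable:
  assumes "i \<in> R" "k \<in> I" "l \<in> I"
  shows "integrable \<mu> (kterm k l i)" "(LINT y|\<mu>. kterm k l i y) = (if k = l then complex_of_real (lam k i) else 0)"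
proof -
  have "integrable \<mu> (\<lambda>y. (indicator (D i) y * \<phi> k y) * cnj (indicator (D i) y * \<phi> l y))"
  proof (rule L2s_integrable)
    show "L2s \<mu> (\<lambda>y. indicator (D i) y * \<phi> k y)" "L2s \<mu> (\<lambda>y. indicator (D i) y * \<phi> l y)"
      using \<phi>_L2 assms L2_indicator[of \<mu> "D i" "\<phi> k"] L2_indicator[of \<mu> "D i" "\<phi> l"] by blast+
  qed
  also have "(\<lambda>y. (indicator (D i) y * \<phi> k y) * cnj (indicator (D i) y * \<phi> l y)) = (\<lambda>y. indicator (D i) y *\<^sub>R (\<phi> k y * cnj (\<phi> l y)))"
    by (auto simp: indicator_def)
  finally show "integrable \<mu> (kterm k l i)" unfolding kterm_def[abs_def] by (rule integrable_mult_right)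
  have "(LINT y|\<mu>. kterm k l i y) = complex_of_real (a k) * L2_inner \<mu> (D i) (\<phi> k) (\<phi> l)"
    unfolding kterm_def L2_inner_def set_lebesgue_integral_def by (rule integral_mult_right_zero)
  then show "(LINT y|\<mu>. kterm k l i y) = (if k = l then complex_of_real (lam k i) else 0)"
    using lam_inner[OF assms] by simp
qed

text \<open>Expanding the product of sums attaches an index \<open>f u\<close> to every slot. The point \<open>x u\<close> is the second
  argument of the factor belonging to the preimage of \<open>u\<close> under \<open>\<pi>\<close>.\<close>

lemma truncated_expansion:
  "per n (\<lambda>i j. Km m (x i) (x j)) * block n c x =
     (\<Sum>\<pi> | \<pi> permutes {..<n}. \<Sum>f\<in>{..<n} \<rightarrow>\<^sub>E trunc m. \<Prod>u<n. kterm (f u) (f (inv \<pi> u)) (c u) (x u))"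
  unfolding per_def sum_distrib_right
proof (rule sum.cong[OF refl])
  fix \<pi> assume "\<pi> \<in> {\<pi>. \<pi> permutes {..<n}}"
  then have p: "\<pi> permutes {..<n}" by simp
  have "(\<Prod>i<n. Km m (x i) (x (\<pi> i))) = (\<Sum>f\<in>{..<n} \<rightarrow>\<^sub>E trunc m. \<Prod>i<n. complex_of_real (a (f i)) * \<phi> (f i) (x i) * cnj (\<phi> (f i) (x (\<pi> i))))"
    unfolding Km_def by (rule prod_sum_PiE) (auto simp: finite_trunc)
  also have "\<dots> * block n c x = (\<Sum>f\<in>{..<n} \<rightarrow>\<^sub>E trunc m. \<Prod>u<n. kterm (f u) (f (inv \<pi> u)) (c u) (x u))"
    unfolding sum_distrib_right
  proof (rule sum.cong[OF refl])
    fix f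
    have "(\<Prod>i<n. cnj (\<phi> (f i) (x (\<pi> i)))) = (\<Prod>i<n. cnj (\<phi> (f (inv \<pi> i)) (x i)))"
      using prod.permute[OF p, of "\<lambda>i. cnj (\<phi> (f (inv \<pi> i)) (x i))"] permutes_inverses(2)[OF p]
      by (simp add: comp_def)
    then have "(\<Prod>i<n. complex_of_real (a (f i)) * \<phi> (f i) (x i) * cnj (\<phi> (f i) (x (\<pi> i)))) * block n c x =
       (\<Prod>i<n. complex_of_real (a (f i)) * \<phi> (f i) (x i)) * (\<Prod>i<n. cnj (\<phi> (f (inv \<pi> i)) (x i))) * (\<Prod>i<n. indicator (D (c i)) (x i))"
      by (simp add: prod.distrib block_def)
    also have "\<dots> = (\<Prod>u<n. kterm (f u) (f (inv \<pi> u)) (c u) (x u))"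
      unfolding prod.distrib[symmetric] kterm_def by (rule prod.cong) (auto simp: indicator_def)
    finally show "(\<Prod>i<n. complex_of_real (a (f i)) * \<phi> (f i) (x i) * cnj (\<phi> (f i) (x (\<pi> i)))) * block n c x = (\<Prod>u<n. kterm (f u) (f (inv \<pi> u)) (c u) (x u))" .
  qed
  finally show "(\<Prod>i<n. Km m (x i) (x (\<pi> i))) * block n c x = (\<Sum>f\<in>{..<n} \<rightarrow>\<^sub>E trunc m. \<Prod>u<n. kterm (f u) (f (inv \<pi> u)) (c u) (x u))" .
qed

text \<open>The integral factors over the slots, and orthogonality leaves only the pairs with \<open>f \<circ> \<pi> = f\<close>.\<close>

lemma truncated_integral:
  assumes c: "\<And>u. u < n \<Longrightarrow> c u \<in> R"
  shows "integrable (PiM {..<n} (\<lambda>_. \<mu>)) (\<lambda>x. per n (\<lambda>i j. Km m (x i) (x j)) * block n c x)"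
    and "(LINT x|PiM {..<n} (\<lambda>_. \<mu>). per n (\<lambda>i j. Km m (x i) (x j)) * block n c x) = complex_of_real (colour_permanent (trunc m) n c lam)"
proof -
  interpret sigma_finite_measure \<mu> by (rule base_sigma_finite)
  interpret P: product_sigma_finite "\<lambda>_. \<mu>" by unfold_locales
  have idx: "c u \<in> R" "f u \<in> I" "f (inv \<pi> u) \<in> I" if "u \<in> {..<n}" "f \<in> {..<n} \<rightarrow>\<^sub>E trunc m" "\<pi> permutes {..<n}" for u f \<pi>
  proof -
    have "inv \<pi> u \<in> {..<n}" using permutes_in_image[OF permutes_inv[OF that(3)], of u] that(1) by simp
    then show "c u \<in> R" "f u \<in> I" "f (inv \<pi> u) \<in> I"
      using c that(1) PiE_mem[OF that(2) that(1)] PiE_mem[OF that(2), of "inv \<pi> u"] by (auto simp: trunc_def)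
  qed
  have int: "integrable (PiM {..<n} (\<lambda>_. \<mu>)) (\<lambda>x. \<Prod>u<n. kterm (f u) (f (inv \<pi> u)) (c u) (x u))"
    if "f \<in> {..<n} \<rightarrow>\<^sub>E trunc m" "\<pi> permutes {..<n}" for f \<pi>
    by (rule P.product_integrable_prod) (use idx that in \<open>auto intro!: kterm_integrable\<close>)
  show "integrable (PiM {..<n} (\<lambda>_. \<mu>)) (\<lambda>x. per n (\<lambda>i j. Km m (x i) (x j)) * block n c x)"
    unfolding truncated_expansion by (intro Bochner_Integration.integrable_sum int) auto
  let ?S = "\<lambda>f. fibre_permutations f {..<n}"
  have val: "(LINT x|PiM {..<n} (\<lambda>_. \<mu>). (\<Prod>u<n. kterm (f u) (f (inv \<pi> u)) (c u) (x u))) =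
      (if \<pi> \<in> ?S f then complex_of_real (\<Prod>u<n. lam (f u) (c u)) else 0)"
    if f: "f \<in> {..<n} \<rightarrow>\<^sub>E trunc m" and p: "\<pi> permutes {..<n}" for f \<pi>
  proof -
    have "(LINT x|PiM {..<n} (\<lambda>_. \<mu>). (\<Prod>u<n. kterm (f u) (f (inv \<pi> u)) (c u) (x u))) = (\<Prod>u<n. LINT y|\<mu>. kterm (f u) (f (inv \<pi> u)) (c u) y)"
      by (rule P.product_integral_prod) (use idx f p in \<open>auto intro!: kterm_integrable\<close>)
    also have "\<dots> = (\<Prod>u<n. if f u = f (inv \<pi> u) then complex_of_real (lam (f u) (c u)) else 0)"
      by (rule prod.cong) (use idx[OF _ f p] in \<open>simp_all add: kterm_integrable\<close>)
    also have "\<dots> = (if \<pi> \<in> ?S f then complex_of_real (\<Prod>u<n. lam (f u) (c u)) else 0)"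
    proof (cases "\<forall>u\<in>{..<n}. f (\<pi> u) = f u")
      case True
      have "f u = f (inv \<pi> u)" if "u < n" for u
      proof -
        have "inv \<pi> u \<in> {..<n}" using permutes_in_image[OF permutes_inv[OF p], of u] that by simp
        with True have "f (\<pi> (inv \<pi> u)) = f (inv \<pi> u)" by blast
        then show ?thesis using permutes_inverses(1)[OF p] by simp
      qed
      then show ?thesis using True p by (simp add: fibre_permutations_def)
    next
      case False
      then obtain u where u: "u < n" "f (\<pi> u) \<noteq> f u" by auto
      have "\<pi> u \<in> {..<n}" using permutes_in_image[OF p, of u] u by simp
      moreover have "f (\<pi> u) \<noteq> f (inv \<pi> (\<pi> u))" using u permutes_inverses(2)[OF p] by simp
      ultimately have z: "(\<Prod>u<n. if f u = f (inv \<pi> u) then complex_of_real (lam (f u) (c u)) else 0) = 0"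
        by (intro prod_zero) (auto intro!: bexI[of _ "\<pi> u"])
      have "\<pi> \<notin> ?S f" using False by (simp add: fibre_permutations_def)
      then show ?thesis unfolding z by (simp only: if_False)
    qed
    finally show ?thesis .
  qed
  have "(LINT x|PiM {..<n} (\<lambda>_. \<mu>). per n (\<lambda>i j. Km m (x i) (x j)) * block n c x) =
     (\<Sum>\<pi> | \<pi> permutes {..<n}. \<Sum>f\<in>{..<n} \<rightarrow>\<^sub>E trunc m. LINT x|PiM {..<n} (\<lambda>_. \<mu>). (\<Prod>u<n. kterm (f u) (f (inv \<pi> u)) (c u) (x u)))"
    unfolding truncated_expansion
    by (subst Bochner_Integration.integral_sum) (auto intro!: sum.cong Bochner_Integration.integral_sum Bochner_Integration.integrable_sum int)
  also have "\<dots> = (\<Sum>\<pi> | \<pi> permutes {..<n}. \<Sum>f\<in>{..<n} \<rightarrow>\<^sub>E trunc m. if \<pi> \<in> ?S f then complex_of_real (\<Prod>u<n. lam (f u) (c u)) else 0)"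
    by (intro sum.cong refl val) auto
  also have "\<dots> = (\<Sum>f\<in>{..<n} \<rightarrow>\<^sub>E trunc m. \<Sum>\<pi> | \<pi> permutes {..<n}. if \<pi> \<in> ?S f then complex_of_real (\<Prod>u<n. lam (f u) (c u)) else 0)"
    by (rule sum.swap)
  also have "\<dots> = (\<Sum>f\<in>{..<n} \<rightarrow>\<^sub>E trunc m. of_nat (card (?S f)) * complex_of_real (\<Prod>u<n. lam (f u) (c u)))"
  proof (rule sum.cong[OF refl])
    fix f
    have "(\<Sum>\<pi> | \<pi> permutes {..<n}. if \<pi> \<in> ?S f then complex_of_real (\<Prod>u<n. lam (f u) (c u)) else 0) = (\<Sum>\<pi>\<in>?S f. complex_of_real (\<Prod>u<n. lam (f u) (c u)))"
      by (rule sum.mono_neutral_cong_right) (auto simp: fibre_permutations_def finite_permutations)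
    then show "(\<Sum>\<pi> | \<pi> permutes {..<n}. if \<pi> \<in> ?S f then complex_of_real (\<Prod>u<n. lam (f u) (c u)) else 0) = of_nat (card (?S f)) * complex_of_real (\<Prod>u<n. lam (f u) (c u))"
      by simp
  qed
  also have "\<dots> = complex_of_real (colour_permanent (trunc m) n c lam)"
    unfolding colour_permanent_def by simp
  finally show "(LINT x|PiM {..<n} (\<lambda>_. \<mu>). per n (\<lambda>i j. Km m (x i) (x j)) * block n c x) = complex_of_real (colour_permanent (trunc m) n c lam)" .
qed

text \<open>The truncated kernels converge at all points outside a null set, dominated as in \<open>prod_bound\<close>. The
  function \<open>\<rho>\<close> replaces the permanent in the limit because it is measurable.\<close>

theorem block_integral_tendsto:
  assumes c: "\<And>u. u < n \<Longrightarrow> c u \<in> R"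
    and \<rho>: "\<rho> \<in> borel_measurable (PiM {..<n} (\<lambda>_. \<mu>))" "\<And>x. x \<in> space (PiM {..<n} (\<lambda>_. \<mu>)) \<Longrightarrow> 0 \<le> \<rho> x"
    and per: "AE x in PiM {..<n} (\<lambda>_. \<mu>). complex_of_real (\<rho> x) = per n (\<lambda>i j. K (x i) (x j))"
  shows "(\<lambda>m. ennreal (colour_permanent (trunc m) n c lam)) \<longlonglongrightarrow>
     (\<integral>\<^sup>+x\<in>{x. \<forall>u<n. x u \<in> D (c u)}. ennreal (\<rho> x) \<partial>PiM {..<n} (\<lambda>_. \<mu>))"
proof -
  interpret sigma_finite_measure \<mu> by (rule base_sigma_finite)
  interpret P: product_sigma_finite "\<lambda>_. \<mu>" by unfold_locales
  let ?P = "PiM {..<n} (\<lambda>_. \<mu>)"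
  let ?B = "{x. \<forall>u<n. x u \<in> D (c u)}"
  let ?H = "\<lambda>m x. per n (\<lambda>i j. Km m (x i) (x j)) * block n c x"
  let ?G = "\<lambda>x. complex_of_real (\<rho> x * indicator ?B x)"
  have blk: "block n c x = indicator ?B x" for x
    by (auto simp: block_def indicator_def intro!: prod_zero)
  have blkr: "(indicator ?B x :: real) = (\<Prod>u<n. indicator (D (c u)) (x u))" for x
    by (auto simp: indicator_def intro!: prod_zero)
  have Bm: "(\<lambda>x. indicator ?B x :: real) \<in> borel_measurable ?P"
    unfolding blkr using D c by measurable
  have Gm: "(\<lambda>x. \<rho> x * indicator ?B x) \<in> borel_measurable ?P"
    using \<rho>(1) Bm by measurable
  have inDD: "AE x in ?P. x \<in> ?B \<longrightarrow> (\<forall>u<n. x u \<in> DD)"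
    using AE_PiM_all_coordinates[OF base_sigma_finite null, of "{..<n}"]
    by (rule eventually_mono) (use c in \<open>auto simp: DD_def\<close>)
  have lim: "integrable ?P ?G \<and> (\<lambda>m. LINT x|?P. ?H m x) \<longlonglongrightarrow> (LINT x|?P. ?G x)"
  proof -
    let ?w = "\<lambda>x. fact n * (\<Prod>u<n. \<bar>g (x u)\<bar>)"
    have 1: "?G \<in> borel_measurable ?P" using Gm by measurable
    have 2: "?H m \<in> borel_measurable ?P" for m
      using truncated_integral(1)[OF c] by (rule borel_measurable_integrable)
    have 3: "integrable ?P ?w"
      using P.product_integrable_prod[of "{..<n}" "\<lambda>_ x. \<bar>g x\<bar>"] g_integrable by auto
    have 4: "AE x in ?P. (\<lambda>m. ?H m x) \<longlonglongrightarrow> ?G x"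
      using inDD per
    proof eventually_elim
      case (elim x)
      show ?case
      proof (cases "x \<in> ?B")
        case True
        with elim have d: "x u \<in> DD" if "u < n" for u using that by auto
        have "(\<lambda>m. per n (\<lambda>i j. Km m (x i) (x j))) \<longlonglongrightarrow> per n (\<lambda>i j. K (x i) (x j))"
          unfolding per_def
        proof (intro tendsto_sum tendsto_prod Km_tendsto d)
          fix \<pi> u assume "\<pi> \<in> {\<pi>. \<pi> permutes {..<n}}" "u \<in> {..<n}"
          then show "u < n" "\<pi> u < n" using permutes_in_image[of \<pi> "{..<n}" u] by auto
        qed
        then show ?thesis using True elim by (simp add: blk)
      qed (simp add: blk)
    qed
    have 5: "AE x in ?P. norm (?H m x) \<le> ?w x" for m
      using inDD
    proof eventually_elim
      case (elim x)
      show ?case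
      proof (cases "x \<in> ?B")
        case True
        with elim have d: "x u \<in> DD" if "u < n" for u using that by auto
        have "cmod (per n (\<lambda>i j. Km m (x i) (x j))) \<le> fact n * (\<Prod>u<n. g (x u))"
          by (rule prod_bound[OF Km_bound d])
        also have "(\<Prod>u<n. g (x u)) = (\<Prod>u<n. \<bar>g (x u)\<bar>)"
          by (rule prod.cong) (use g_nonneg d in auto)
        finally show ?thesis using True by (simp add: blk)
      qed (simp add: blk prod_nonneg)
    qed
    show ?thesis
      using integrable_dominated_convergence[OF 1 2 3 4 5] integral_dominated_convergence[OF 1 2 3 4 5] by blast
  qed
  have Gi: "integrable ?P (\<lambda>x. \<rho> x * indicator ?B x)"
    using lim by (simp add: complex_of_real_integrable_eq del: of_real_mult)
  have "(\<lambda>m. complex_of_real (colour_permanent (trunc m) n c lam)) \<longlonglongrightarrow> complex_of_real (LINT x|?P. \<rho> x * indicator ?B x)"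
  proof -
    have "(\<lambda>m. LINT x|?P. ?H m x) = (\<lambda>m. complex_of_real (colour_permanent (trunc m) n c lam))"
      by (rule ext) (rule truncated_integral(2)[OF c])
    with lim show ?thesis by (simp only: integral_complex_of_real)
  qed
  then have "(\<lambda>m. colour_permanent (trunc m) n c lam) \<longlonglongrightarrow> (LINT x|?P. \<rho> x * indicator ?B x)"
    by (simp only: tendsto_of_real_iff)
  then have "(\<lambda>m. ennreal (colour_permanent (trunc m) n c lam)) \<longlonglongrightarrow> ennreal (LINT x|?P. \<rho> x * indicator ?B x)"
    by (rule tendsto_ennrealI)
  also have "ennreal (LINT x|?P. \<rho> x * indicator ?B x) = (\<integral>\<^sup>+x. ennreal (\<rho> x * indicator ?B x) \<partial>?P)"
    by (rule nn_integral_eq_integral[symmetric, OF Gi]) (use \<rho>(2) in auto)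
  also have "\<dots> = (\<integral>\<^sup>+x\<in>?B. ennreal (\<rho> x) \<partial>?P)"
    by (rule nn_integral_cong) (auto simp: indicator_def)
  finally show ?thesis .
qed

end

text \<open>There are at most \<open>n!\<close> permutations, and without them the sum over \<open>f\<close> is a product of sums.\<close>

lemma colour_permanent_le:
  assumes A: "finite A" and nn: "\<And>k i. k \<in> A \<Longrightarrow> i \<in> R \<Longrightarrow> 0 \<le> lam k i"
    and c: "\<And>u. u < n \<Longrightarrow> c u \<in> R" and L: "\<And>i. i \<in> R \<Longrightarrow> (\<Sum>k\<in>A. lam k i) \<le> L"
  shows "colour_permanent A n c lam \<le> L ^ n * fact n"
proof -
  have "colour_permanent A n c lam \<le> (\<Sum>f\<in>{..<n} \<rightarrow>\<^sub>E A. fact n * (\<Prod>u<n. lam (f u) (c u)))"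
    unfolding colour_permanent_def
  proof (rule sum_mono)
    fix f assume f: "f \<in> {..<n} \<rightarrow>\<^sub>E A"
    have "card (fibre_permutations f {..<n}) \<le> card {\<pi>. \<pi> permutes {..<n}}"
      by (rule card_mono) (auto simp: fibre_permutations_def finite_permutations)
    also have "\<dots> = fact n" by (rule card_permutations) auto
    finally have "real (card (fibre_permutations f {..<n})) \<le> real (fact n)"
      by (simp only: of_nat_le_iff)
    then have "real (card (fibre_permutations f {..<n})) \<le> fact n"
      by (simp only: of_nat_fact)
    moreover have "0 \<le> (\<Prod>u<n. lam (f u) (c u))"
    proof (rule prod_nonneg)
      fix u assume "u \<in> {..<n}"
      then show "0 \<le> lam (f u) (c u)" using nn[OF PiE_mem[OF f], of u "c u"] c by simp
    qed
    ultimately show "real (card (fibre_permutations f {..<n})) * (\<Prod>u<n. lam (f u) (c u)) \<le> fact n * (\<Prod>u<n. lam (f u) (c u))"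
      by (rule mult_right_mono)
  qed
  also have "\<dots> = fact n * (\<Prod>u<n. \<Sum>k\<in>A. lam k (c u))"
    using A by (simp add: sum_distrib_left prod_sum_PiE)
  also have "\<dots> \<le> fact n * (\<Prod>u<n. L)"
    using c nn L by (intro mult_left_mono prod_mono conjI sum_nonneg) auto
  finally show ?thesis by (simp add: mult.commute)
qed

section \<open>Factorial moments of a permanental process\<close>

text \<open>\<open>bl u\<close> is the number of the block that contains the coordinate \<open>u\<close>, when consecutive blocks have the
  lengths \<open>k 0\<close>, \<open>k 1\<close>, and so on.\<close>

lemma block_decomposition:
  fixes k :: "nat \<Rightarrow> nat"
  obtains bl where
    "\<And>j l. j < s \<Longrightarrow> l < k j \<Longrightarrow> bl ((\<Sum>l<j. k l) + l) = j"
    "\<And>u. u < (\<Sum>l<s. k l) \<Longrightarrow> bl u < s \<and> (\<Sum>l<bl u. k l) \<le> u \<and> u < (\<Sum>l<bl u. k l) + k (bl u)"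
proof
  define bl where "bl u = (LEAST j. u < (\<Sum>l<Suc j. k l))" for u
  have mono: "(\<Sum>l<i. k l) \<le> (\<Sum>l<j. k l)" if "i \<le> j" for i j
    using that by (intro sum_mono2) auto
  show "bl ((\<Sum>l<j. k l) + l) = j" if "j < s" "l < k j" for j l
    unfolding bl_def
  proof (rule Least_equality)
    show "(\<Sum>l<j. k l) + l < (\<Sum>l<Suc j. k l)" using that by simp
    fix i assume "(\<Sum>l<j. k l) + l < (\<Sum>l<Suc i. k l)"
    then show "j \<le> i" using mono[of "Suc i" j] by (cases "j \<le> i") auto
  qed
  show "bl u < s \<and> (\<Sum>l<bl u. k l) \<le> u \<and> u < (\<Sum>l<bl u. k l) + k (bl u)" if u: "u < (\<Sum>l<s. k l)" for u
  proof -
    obtain s' where s': "s = Suc s'" using u by (cases s) auto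
    have ex: "u < (\<Sum>l<Suc s'. k l)" using u s' by simp
    have 1: "u < (\<Sum>l<Suc (bl u). k l)" unfolding bl_def by (rule LeastI[where P = "\<lambda>j. u < (\<Sum>l<Suc j. k l)", OF ex])
    have 2: "bl u \<le> s'" unfolding bl_def by (rule Least_le[where P = "\<lambda>j. u < (\<Sum>l<Suc j. k l)", OF ex])
    have 3: "(\<Sum>l<bl u. k l) \<le> u"
    proof (cases "bl u")
      case (Suc j)
      then have "\<not> u < (\<Sum>l<Suc j. k l)" using not_less_Least[of j "\<lambda>j. u < (\<Sum>l<Suc j. k l)"] by (simp add: bl_def)
      then show ?thesis using Suc by simp
    qed simp
    show ?thesis using 1 2 3 s' by simp
  qed
qed

lemma block_product_colouring:
  fixes B :: "nat \<Rightarrow> 'a set" and k :: "nat \<Rightarrow> nat"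
  shows "\<exists>bl. (\<forall>u<(\<Sum>j<s. k j). bl u < s) \<and> (\<forall>j<s. card {u. u < (\<Sum>j<s. k j) \<and> bl u = j} = k j) \<and>
    block_product s B k = {x. \<forall>u<(\<Sum>j<s. k j). x u \<in> B (bl u)}"
proof -
  obtain bl where bl1: "\<And>j l. j < s \<Longrightarrow> l < k j \<Longrightarrow> bl ((\<Sum>l<j. k l) + l) = j"
    and bl2: "\<And>u. u < (\<Sum>l<s. k l) \<Longrightarrow> bl u < s \<and> (\<Sum>l<bl u. k l) \<le> u \<and> u < (\<Sum>l<bl u. k l) + k (bl u)"
    using block_decomposition[where s = s and k = k] by metis
  have lt: "(\<Sum>l<j. k l) + l < (\<Sum>l<s. k l)" if "j < s" "l < k j" for j l
  proof -
    have "(\<Sum>l<Suc j. k l) \<le> (\<Sum>l<s. k l)" using that by (intro sum_mono2) auto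
    then show ?thesis using that by simp
  qed
  show ?thesis
  proof (intro exI[of _ bl] conjI allI impI)
    show "bl u < s" if "u < (\<Sum>j<s. k j)" for u using bl2[OF that] by simp
    show "card {u. u < (\<Sum>j<s. k j) \<and> bl u = j} = k j" if j: "j < s" for j
    proof -
      have "{u. u < (\<Sum>j<s. k j) \<and> bl u = j} = {(\<Sum>l<j. k l)..<(\<Sum>l<j. k l) + k j}"
      proof safe
        fix u assume u: "u \<in> {(\<Sum>l<j. k l)..<(\<Sum>l<j. k l) + k j}"
        define l where "l = u - (\<Sum>l<j. k l)"
        have "u = (\<Sum>l<j. k l) + l" "l < k j" using u by (auto simp: l_def)
        then show "bl u = j" "u < (\<Sum>j<s. k j)" using bl1[OF j] lt[OF j] by auto
      qed (use bl2 in auto)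
      then show ?thesis by simp
    qed
    show "block_product s B k = {x. \<forall>u<(\<Sum>j<s. k j). x u \<in> B (bl u)}"
      unfolding block_product_def
    proof safe
      fix x u assume x: "\<forall>i<s. \<forall>j<k i. x ((\<Sum>l<i. k l) + j) \<in> B i" and u: "u < (\<Sum>j<s. k j)"
      define l where "l = u - (\<Sum>l<bl u. k l)"
      have "u = (\<Sum>l<bl u. k l) + l" "l < k (bl u)" "bl u < s" using bl2[OF u] by (auto simp: l_def)
      then show "x u \<in> B (bl u)" using x by metis
    next
      fix x i j assume x: "\<forall>u<(\<Sum>j<s. k j). x u \<in> B (bl u)" and "i < s" "j < k i"
      then have "x ((\<Sum>l<i. k l) + j) \<in> B (bl ((\<Sum>l<i. k l) + j))" using lt by blast
      then show "x ((\<Sum>l<i. k l) + j) \<in> B i" using bl1[OF \<open>i < s\<close> \<open>j < k i\<close>] by simp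
    qed
  qed
qed

lemma ext_binomial_fact: "ext_binomial (of_nat y) m * of_nat (fact m) = of_nat (ffact y m)"
  unfolding ext_binomial_of_nat ffact_eq_choose of_nat_mult ..

text \<open>Joint intensities describe products of factorial moments of positive order only. The sets with
  \<open>m i = 0\<close> contribute the factor \<open>1\<close> and are left out; the others are enumerated by \<open>e\<close>, and the
  coordinates of a block inherit the colour of its set.\<close>

lemma joint_intensities_moment:
  fixes X :: "'w \<Rightarrow> 'a::polish_space measure" and D :: "'i \<Rightarrow> 'a set"
  assumes ji: "joint_intensities P \<mu> X \<rho>" and R: "finite R"
    and D: "\<And>i. i \<in> R \<Longrightarrow> D i \<in> sets borel" and dis: "disjoint_family_on D R"
    and fin: "\<And>i. i \<in> R \<Longrightarrow> AE \<omega> in P. emeasure (X \<omega>) (D i) = of_nat (Y \<omega> i)"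
    and m: "(\<Sum>i\<in>R. m i) \<ge> 1"
  shows "\<exists>c. (\<forall>u<(\<Sum>i\<in>R. m i). c u \<in> R) \<and> (\<forall>i\<in>R. card {u. u < (\<Sum>i\<in>R. m i) \<and> c u = i} = m i) \<and>
    (\<integral>\<^sup>+\<omega>. (\<Prod>i\<in>R. of_nat (ffact (Y \<omega> i) (m i))) \<partial>P) =
      (\<integral>\<^sup>+x\<in>{x. \<forall>u<(\<Sum>i\<in>R. m i). x u \<in> D (c u)}. ennreal (\<rho> (\<Sum>i\<in>R. m i) x) \<partial>PiM {..<(\<Sum>i\<in>R. m i)} (\<lambda>_. \<mu>))"
proof -
  let ?n = "\<Sum>i\<in>R. m i"
  define Act where "Act = {i\<in>R. m i \<noteq> 0}"
  have finA: "finite Act" using R by (simp add: Act_def)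
  obtain e where e: "bij_betw e {..<card Act} Act"
    using ex_bij_betw_nat_finite[OF finA] by (auto simp: atLeast0LessThan)
  define s where "s = card Act"
  have e': "bij_betw e {..<s} Act" using e by (simp add: s_def)
  have eR: "e j \<in> R" "m (e j) \<ge> 1" if "j < s" for j
    using bij_betwE[OF e'] that by (auto simp: Act_def Suc_le_eq)
  have inj: "inj_on e {..<s}" using e' by (rule bij_betw_imp_inj_on)
  have sum_eq: "(\<Sum>j<s. m (e j)) = ?n"
  proof -
    have "(\<Sum>j<s. m (e j)) = (\<Sum>i\<in>Act. m i)" by (rule sum.reindex_bij_betw[OF e'])
    also have "\<dots> = ?n" by (rule sum.mono_neutral_left) (use R in \<open>auto simp: Act_def\<close>)
    finally show ?thesis .
  qed
  have s1: "s \<ge> 1"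
  proof (rule ccontr)
    assume "\<not> s \<ge> 1"
    then have "s = 0" by simp
    then have "(\<Sum>j<s. m (e j)) = 0" by simp
    with sum_eq m show False by simp
  qed
  have "\<exists>bl. (\<forall>u<(\<Sum>j<s. m (e j)). bl u < s) \<and> (\<forall>j<s. card {u. u < (\<Sum>j<s. m (e j)) \<and> bl u = j} = m (e j)) \<and>
    block_product s (\<lambda>j. D (e j)) (\<lambda>j. m (e j)) = {x. \<forall>u<(\<Sum>j<s. m (e j)). x u \<in> D (e (bl u))}"
    by (rule block_product_colouring)
  then obtain bl where bl: "\<forall>u<?n. bl u < s" "\<forall>j<s. card {u. u < ?n \<and> bl u = j} = m (e j)"
    "block_product s (\<lambda>j. D (e j)) (\<lambda>j. m (e j)) = {x. \<forall>u<?n. x u \<in> D (e (bl u))}"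
    unfolding sum_eq by blast
  have disj: "disjoint_family_on (\<lambda>j. D (e j)) {..<s}"
    unfolding disjoint_family_on_def
  proof (intro ballI impI)
    fix i j assume "i \<in> {..<s}" "j \<in> {..<s}" "i \<noteq> j"
    then have "e i \<noteq> e j" "e i \<in> R" "e j \<in> R" using inj eR by (auto dest: inj_onD)
    then show "D (e i) \<inter> D (e j) = {}" using dis by (auto simp: disjoint_family_on_def)
  qed
  have "(\<integral>\<^sup>+\<omega>. (\<Prod>j<s. ext_binomial (emeasure (X \<omega>) (D (e j))) (m (e j)) * of_nat (fact (m (e j)))) \<partial>P) =
     (\<integral>\<^sup>+x\<in>block_product s (\<lambda>j. D (e j)) (\<lambda>j. m (e j)). ennreal (\<rho> (\<Sum>j<s. m (e j)) x) \<partial>PiM {..<(\<Sum>j<s. m (e j))} (\<lambda>_. \<mu>))"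
    by (rule ji[unfolded joint_intensities_def, THEN conjunct2, rule_format])
       (use s1 disj eR D in auto)
  also have "\<dots> = (\<integral>\<^sup>+x\<in>{x. \<forall>u<?n. x u \<in> D (e (bl u))}. ennreal (\<rho> ?n x) \<partial>PiM {..<?n} (\<lambda>_. \<mu>))"
    unfolding sum_eq bl(3) ..
  also have "(\<integral>\<^sup>+\<omega>. (\<Prod>j<s. ext_binomial (emeasure (X \<omega>) (D (e j))) (m (e j)) * of_nat (fact (m (e j)))) \<partial>P) =
     (\<integral>\<^sup>+\<omega>. (\<Prod>i\<in>R. of_nat (ffact (Y \<omega> i) (m i))) \<partial>P)"
  proof (rule nn_integral_cong_AE)
    have "AE \<omega> in P. \<forall>i\<in>R. emeasure (X \<omega>) (D i) = of_nat (Y \<omega> i)"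
      using R fin by (subst AE_ball_countable) (auto simp: countable_finite)
    then show "AE \<omega> in P. (\<Prod>j<s. ext_binomial (emeasure (X \<omega>) (D (e j))) (m (e j)) * of_nat (fact (m (e j)))) = (\<Prod>i\<in>R. of_nat (ffact (Y \<omega> i) (m i)))"
    proof eventually_elim
      case (elim \<omega>)
      have "(\<Prod>j<s. ext_binomial (emeasure (X \<omega>) (D (e j))) (m (e j)) * of_nat (fact (m (e j)))) = (\<Prod>j<s. of_nat (ffact (Y \<omega> (e j)) (m (e j))))"
      proof (rule prod.cong[OF refl])
        fix j assume "j \<in> {..<s}"
        then have "emeasure (X \<omega>) (D (e j)) = of_nat (Y \<omega> (e j))" using elim eR by simp
        then show "ext_binomial (emeasure (X \<omega>) (D (e j))) (m (e j)) * of_nat (fact (m (e j))) = of_nat (ffact (Y \<omega> (e j)) (m (e j)))"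
          by (simp only: ext_binomial_fact)
      qed
      also have "\<dots> = (\<Prod>i\<in>Act. of_nat (ffact (Y \<omega> i) (m i)))" by (rule prod.reindex_bij_betw[OF e'])
      also have "\<dots> = (\<Prod>i\<in>R. of_nat (ffact (Y \<omega> i) (m i)))"
        by (rule prod.mono_neutral_left) (use R in \<open>auto simp: Act_def\<close>)
      finally show ?case .
    qed
  qed
  finally have int: "(\<integral>\<^sup>+\<omega>. (\<Prod>i\<in>R. of_nat (ffact (Y \<omega> i) (m i))) \<partial>P) = (\<integral>\<^sup>+x\<in>{x. \<forall>u<?n. x u \<in> D (e (bl u))}. ennreal (\<rho> ?n x) \<partial>PiM {..<?n} (\<lambda>_. \<mu>))" .
  show ?thesis
  proof (intro exI[of _ "\<lambda>u. e (bl u)"] conjI allI impI ballI)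
    show "e (bl u) \<in> R" if "u < ?n" for u using bl(1) that eR by simp
    show "card {u. u < ?n \<and> e (bl u) = i} = m i" if i: "i \<in> R" for i
    proof (cases "m i = 0")
      case True
      then have "{u. u < ?n \<and> e (bl u) = i} = {}" using bl(1) eR(2) by fastforce
      then show ?thesis using True by simp
    next
      case False
      then have "i \<in> Act" using i by (simp add: Act_def)
      then obtain j where j: "j < s" "e j = i" using e' by (auto simp: bij_betw_def)
      have "{u. u < ?n \<and> e (bl u) = i} = {u. u < ?n \<and> bl u = j}"
        using j bl(1) inj by (auto dest: inj_onD)
      then show ?thesis using bl(2) j by simp
    qed
  qed (rule int)
qed

text \<open>For order \<open>1\<close> the formula holds also where the count is infinite. It yields the finiteness of the
  counts, on which the formulas of higher order are based.\<close>

lemma first_intensity: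
  assumes "joint_intensities P \<mu> X \<rho>" "B \<in> sets borel"
    and nat: "\<And>\<omega>. \<omega> \<in> space P \<Longrightarrow> \<exists>n. emeasure (X \<omega>) B = ennreal_of_enat n"
  shows "(\<integral>\<^sup>+\<omega>. emeasure (X \<omega>) B \<partial>P) = (\<integral>\<^sup>+x\<in>{x. \<forall>u<1. x u \<in> B}. ennreal (\<rho> 1 x) \<partial>PiM {..<1} (\<lambda>_. \<mu>))"
proof -
  have e1: "ext_binomial (emeasure (X \<omega>) B) 1 * of_nat (fact 1) = emeasure (X \<omega>) B" if "\<omega> \<in> space P" for \<omega>
  proof -
    obtain n where n: "emeasure (X \<omega>) B = ennreal_of_enat n" using nat[OF \<open>\<omega> \<in> space P\<close>] by auto
    show ?thesis
    proof (cases n)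
      case (enat k)
      then have "emeasure (X \<omega>) B = of_nat k" using n by simp
      then show ?thesis by (simp add: ext_binomial_of_nat)
    next
      case infinity
      then show ?thesis using n by (simp add: ext_binomial_def)
    qed
  qed
  have bp: "block_product 1 (\<lambda>_. B) (\<lambda>_. 1) = {x. \<forall>u<1. x u \<in> B}"
    by (auto simp: block_product_def)
  have "(\<integral>\<^sup>+\<omega>. (\<Prod>i<1::nat. ext_binomial (emeasure (X \<omega>) B) 1 * of_nat (fact 1)) \<partial>P) =
     (\<integral>\<^sup>+x\<in>block_product 1 (\<lambda>_. B) (\<lambda>_. 1). ennreal (\<rho> (\<Sum>i<1::nat. 1) x) \<partial>PiM {..<(\<Sum>i<1::nat. 1)} (\<lambda>_. \<mu>))"
    using assms(1)[unfolded joint_intensities_def, THEN conjunct2, rule_format, of 1 "\<lambda>_. B" "\<lambda>_. 1"] assms(2)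
    by (simp add: disjoint_family_on_def)
  moreover have "(\<integral>\<^sup>+\<omega>. (\<Prod>i<1::nat. ext_binomial (emeasure (X \<omega>) B) 1 * of_nat (fact 1)) \<partial>P) = (\<integral>\<^sup>+\<omega>. emeasure (X \<omega>) B \<partial>P)"
    by (rule nn_integral_cong) (use e1 in simp)
  ultimately show ?thesis unfolding bp by simp
qed

section \<open>Sums of independent geometric-multinomial vectors\<close>

text \<open>For the identity map, the characterisation of independence by the joint law is the definition of the
  product measure.\<close>

lemma indep_vars_coordinates:
  assumes M: "\<And>i. i \<in> I \<Longrightarrow> prob_space (M i)"
  shows "prob_space.indep_vars (PiM I M) M (\<lambda>i \<omega>. \<omega> i) I"
proof -
  interpret prob_space "PiM I M" using M by (rule prob_space_PiM)
  show ?thesis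
  proof (cases "I = {}")
    case True
    then show ?thesis unfolding indep_vars_def2 indep_sets_def by auto
  next
    case False
    have "distr (PiM I M) (PiM I M) (\<lambda>x. \<lambda>i\<in>I. x i) = distr (PiM I M) (PiM I M) (\<lambda>x. x)"
      by (rule distr_cong) (auto simp: space_PiM)
    also have "\<dots> = PiM I (\<lambda>i. distr (PiM I M) (M i) (\<lambda>\<omega>. \<omega> i))"
      unfolding distr_id by (rule PiM_cong) (use M in \<open>auto simp: distr_PiM_component\<close>)
    finally show ?thesis
      by (subst indep_vars_iff_distr_eq_PiM'[OF False]) (auto intro: measurable_component_singleton)
  qed
qed

lemma nn_integral_PiM_prod:
  fixes h :: "'i \<Rightarrow> 'b \<Rightarrow> ennreal"
  assumes M: "\<And>i. i \<in> I \<Longrightarrow> prob_space (M i)" and A: "finite A" "A \<subseteq> I"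
    and h [measurable]: "\<And>i. i \<in> A \<Longrightarrow> h i \<in> borel_measurable (M i)"
  shows "(\<integral>\<^sup>+\<omega>. (\<Prod>i\<in>A. h i (\<omega> i)) \<partial>PiM I M) = (\<Prod>i\<in>A. \<integral>\<^sup>+x. h i x \<partial>M i)"
proof -
  interpret prob_space "PiM I M" using M by (rule prob_space_PiM)
  have "indep_vars M (\<lambda>i \<omega>. \<omega> i) A"
    by (rule indep_vars_subset[OF indep_vars_coordinates A(2)]) (rule M)
  then have "indep_vars (\<lambda>_. borel) (\<lambda>i \<omega>. h i (\<omega> i)) A"
    by (rule indep_vars_compose2) (rule h)
  then have "(\<integral>\<^sup>+\<omega>. (\<Prod>i\<in>A. h i (\<omega> i)) \<partial>PiM I M) = (\<Prod>i\<in>A. \<integral>\<^sup>+\<omega>. h i (\<omega> i) \<partial>PiM I M)"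
    by (intro indep_vars_nn_integral A) auto
  also have "\<dots> = (\<Prod>i\<in>A. \<integral>\<^sup>+x. h i x \<partial>M i)"
  proof (rule prod.cong[OF refl])
    fix i assume i: "i \<in> A"
    have "(\<integral>\<^sup>+x. h i x \<partial>M i) = (\<integral>\<^sup>+x. h i x \<partial>distr (PiM I M) (M i) (\<lambda>\<omega>. \<omega> i))"
      using i A M by (subst distr_PiM_component) auto
    also have "\<dots> = (\<integral>\<^sup>+\<omega>. h i (\<omega> i) \<partial>PiM I M)"
      using i A by (intro nn_integral_distr) (auto intro!: measurable_component_singleton h)
    finally show "(\<integral>\<^sup>+\<omega>. h i (\<omega> i) \<partial>PiM I M) = (\<integral>\<^sup>+x. h i x \<partial>M i)" by simp
  qed
  finally show ?thesis .
qed

definition colour_pmf :: "'i set \<Rightarrow> ('i \<Rightarrow> real) \<Rightarrow> 'i pmf" where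
  "colour_pmf R w = embed_pmf (\<lambda>i. if i \<in> R then w i / sum w R else 0)"

lemma colour_pmf:
  assumes R: "finite R" and w: "\<And>i. i \<in> R \<Longrightarrow> 0 \<le> w i" and pos: "sum w R > 0"
  shows "pmf (colour_pmf R w) i = (if i \<in> R then w i / sum w R else 0)" "set_pmf (colour_pmf R w) \<subseteq> R"
proof -
  let ?f = "\<lambda>i. if i \<in> R then w i / sum w R else 0"
  have "(\<integral>\<^sup>+i. ennreal (?f i) \<partial>count_space UNIV) = (\<Sum>i\<in>R. ennreal (?f i))"
    by (rule nn_integral_count_space'[OF R]) auto
  also have "\<dots> = ennreal (\<Sum>i\<in>R. ?f i)" by (rule sum_ennreal) (use w pos in auto)
  also have "(\<Sum>i\<in>R. ?f i) = (\<Sum>i\<in>R. w i / sum w R)" by (rule sum.cong) auto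
  also have "\<dots> = 1" using pos by (simp add: sum_divide_distrib[symmetric])
  finally have 1: "(\<integral>\<^sup>+i. ennreal (?f i) \<partial>count_space UNIV) = 1" by simp
  have nn: "0 \<le> ?f i" for i using w pos by auto
  show *: "pmf (colour_pmf R w) i = ?f i" for i
    unfolding colour_pmf_def by (rule pmf_embed_pmf[OF nn 1])
  show "set_pmf (colour_pmf R w) \<subseteq> R"
    using * by (auto simp: set_pmf_iff split: if_splits)
qed

text \<open>The natural number that an extended count represents; an infinite count gives \<open>0\<close>.\<close>

definition ennreal_count :: "ennreal \<Rightarrow> nat" where
  "ennreal_count x = nat \<lfloor>enn2real x\<rfloor>"

lemma ennreal_count_of_nat [simp]: "ennreal_count (of_nat n) = n"
  by (simp add: ennreal_count_def flip: ennreal_of_nat_eq_real_of_nat)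

lemma measurable_ennreal_count [measurable]: "ennreal_count \<in> measurable borel (count_space UNIV)"
  unfolding ennreal_count_def by measurable

lemma colour_ffact_mono:
  assumes "\<And>u. u \<in> U \<Longrightarrow> y (c u) \<le> z (c u)"
  shows "colour_ffact y c U \<le> colour_ffact z c U"
  unfolding colour_ffact_def ffact_def
  by (intro prod_mono conjI diff_le_mono) (use assms in auto)

lemma colour_ffact_cong:
  assumes "\<And>u. u \<in> U \<Longrightarrow> y (c u) = z (c u)"
  shows "colour_ffact y c U = colour_ffact z c U"
  by (intro antisym colour_ffact_mono) (use assms in auto)

lemma prod_ffact_eq_colour_ffact:
  assumes R: "finite R" and c: "\<And>u. u < n \<Longrightarrow> c u \<in> R" and m: "\<And>i. i \<in> R \<Longrightarrow> card {u. u < n \<and> c u = i} = m i"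
  shows "(\<Prod>i\<in>R. of_nat (ffact (y i) (m i))) = (of_nat (colour_ffact y c {..<n}) :: ennreal)"
proof -
  have "colour_ffact y c {..<n} = (\<Prod>i\<in>R. ffact (y i) (card {u\<in>{..<n}. c u = i}))"
    by (rule colour_ffact_superset) (use R c in auto)
  also have "\<dots> = (\<Prod>i\<in>R. ffact (y i) (m i))" by (rule prod.cong) (use m in auto)
  finally show ?thesis by simp
qed

text \<open>Independent vectors, one for each \<open>k \<in> I\<close>, realised as the coordinates of a product space. Their totals are
  geometric with mean \<open>\<Sum>i\<in>R. lam k i\<close> and are split multinomially in proportion to \<open>lam k i\<close>.\<close>

locale geometric_multinomial_family =
  fixes I :: "nat set" and R :: "'i set" and lam :: "nat \<Rightarrow> 'i \<Rightarrow> real"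
  assumes R: "finite R" and lam_nonneg: "\<And>k i. k \<in> I \<Longrightarrow> i \<in> R \<Longrightarrow> 0 \<le> lam k i"
    and lam_pos: "\<And>k. k \<in> I \<Longrightarrow> (\<Sum>i\<in>R. lam k i) > 0"
begin

definition law :: "nat \<Rightarrow> ('i \<Rightarrow> nat) pmf" where
  "law k = geometric_multinomial_pmf (\<Sum>i\<in>R. lam k i) (colour_pmf R (lam k))"

definition Q :: "(nat \<Rightarrow> 'i \<Rightarrow> nat) measure" where
  "Q = PiM I (\<lambda>k. measure_pmf (law k))"

sublocale Q: prob_space Q
  unfolding Q_def by (rule prob_space_PiM) (rule prob_space_measure_pmf)

lemma measurable_coordinate: "k \<in> I \<Longrightarrow> (\<lambda>\<omega>. h (\<omega> k)) \<in> measurable Q N" if "h \<in> UNIV \<rightarrow> space N"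
  unfolding Q_def using that
  by (intro measurable_compose[OF measurable_component_singleton]) auto

lemma distr_coordinate: "k \<in> I \<Longrightarrow> distr Q (measure_pmf (law k)) (\<lambda>\<omega>. \<omega> k) = measure_pmf (law k)"
  unfolding Q_def by (rule distr_PiM_component) (auto intro: prob_space_measure_pmf)

lemma measure_coordinate:
  assumes k: "k \<in> I"
  shows "measure Q {\<omega>\<in>space Q. \<omega> k \<in> E} = measure_pmf.prob (law k) E"
proof -
  have m: "(\<lambda>\<omega>. \<omega> k) \<in> measurable Q (measure_pmf (law k))"
    unfolding Q_def by (rule measurable_component_singleton[OF k])
  have "measure (distr Q (measure_pmf (law k)) (\<lambda>\<omega>. \<omega> k)) E = measure Q ((\<lambda>\<omega>. \<omega> k) -` E \<inter> space Q)"
    by (rule measure_distr[OF m]) simp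
  also have "(\<lambda>\<omega>. \<omega> k) -` E \<inter> space Q = {\<omega>\<in>space Q. \<omega> k \<in> E}" by auto
  finally show ?thesis by (simp add: distr_coordinate[OF k])
qed

lemma indep_coordinates:
  "Q.indep_vars (\<lambda>k. PiM R (\<lambda>i. count_space UNIV)) (\<lambda>k \<omega>. \<lambda>i\<in>R. \<omega> k i) I"
proof -
  have "prob_space.indep_vars Q (\<lambda>k. measure_pmf (law k)) (\<lambda>k \<omega>. \<omega> k) I"
    unfolding Q_def by (rule indep_vars_coordinates) (rule prob_space_measure_pmf)
  then show ?thesis
    by (rule Q.indep_vars_compose2) (auto simp: space_PiM)
qed

lemma nn_integral_law:
  assumes k: "k \<in> I" and U: "finite U" and c: "\<And>u. u \<in> U \<Longrightarrow> c u \<in> R"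
  shows "(\<integral>\<^sup>+n. of_nat (colour_ffact n c U) \<partial>measure_pmf (law k)) = ennreal (fact (card U) * (\<Prod>u\<in>U. lam k (c u)))"
proof -
  have "(\<Sum>i\<in>R. lam k i) * pmf (colour_pmf R (lam k)) (c u) = lam k (c u)" if "u \<in> U" for u
    using colour_pmf(1)[OF R lam_nonneg[OF k] lam_pos[OF k], of "c u"] c[OF that] lam_pos[OF k] by simp
  then show ?thesis
    unfolding law_def nn_integral_geometric_multinomial_colour_ffact[OF U lam_pos[OF k]]
    by (simp cong: prod.cong)
qed

text \<open>Vandermonde's identity, independence, the moments of a single vector, and the count of permutations
  that preserve the fibres of \<open>f\<close>.\<close>

lemma truncated_moment:
  assumes A: "finite A" "A \<subseteq> I" and c: "\<And>u. u < n \<Longrightarrow> c u \<in> R"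
  shows "(\<lambda>\<omega>. of_nat (colour_ffact (\<lambda>i. \<Sum>k\<in>A. \<omega> k i) c {..<n}) :: ennreal) \<in> borel_measurable Q"
    and "(\<integral>\<^sup>+\<omega>. of_nat (colour_ffact (\<lambda>i. \<Sum>k\<in>A. \<omega> k i) c {..<n}) \<partial>Q) = ennreal (colour_permanent A n c lam)"
proof -
  let ?h = "\<lambda>f k z. of_nat (colour_ffact z c {u\<in>{..<n}. f u = k}) :: ennreal"
  have e: "of_nat (colour_ffact (\<lambda>i. \<Sum>k\<in>A. \<omega> k i) c {..<n}) = (\<Sum>f\<in>{..<n} \<rightarrow>\<^sub>E A. \<Prod>k\<in>A. ?h f k (\<omega> k))" for \<omega>
    using A by (subst colour_ffact_sum) auto
  have m: "(\<lambda>\<omega>. \<Prod>k\<in>A. ?h f k (\<omega> k)) \<in> borel_measurable Q" for f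
    using A by (intro borel_measurable_prod_ennreal measurable_coordinate) auto
  show "(\<lambda>\<omega>. of_nat (colour_ffact (\<lambda>i. \<Sum>k\<in>A. \<omega> k i) c {..<n}) :: ennreal) \<in> borel_measurable Q"
    unfolding e by (intro borel_measurable_sum m)
  have one: "(\<integral>\<^sup>+\<omega>. (\<Prod>k\<in>A. ?h f k (\<omega> k)) \<partial>Q) =
      ennreal (real (card (fibre_permutations f {..<n})) * (\<Prod>u<n. lam (f u) (c u)))"
    if f: "f \<in> {..<n} \<rightarrow>\<^sub>E A" for f
  proof -
    let ?U = "\<lambda>k. {u\<in>{..<n}. f u = k}"
    have "(\<integral>\<^sup>+\<omega>. (\<Prod>k\<in>A. ?h f k (\<omega> k)) \<partial>Q) = (\<Prod>k\<in>A. \<integral>\<^sup>+z. ?h f k z \<partial>measure_pmf (law k))"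
      unfolding Q_def by (rule nn_integral_PiM_prod) (use A in \<open>auto intro: prob_space_measure_pmf\<close>)
    also have "\<dots> = (\<Prod>k\<in>A. ennreal (fact (card (?U k)) * (\<Prod>u\<in>?U k. lam k (c u))))"
      by (intro prod.cong refl nn_integral_law) (use A c in auto)
    also have "\<dots> = ennreal (\<Prod>k\<in>A. fact (card (?U k)) * (\<Prod>u\<in>?U k. lam k (c u)))"
      by (rule prod_ennreal) (use A c lam_nonneg in \<open>auto intro!: mult_nonneg_nonneg prod_nonneg\<close>)
    also have "(\<Prod>k\<in>A. fact (card (?U k)) * (\<Prod>u\<in>?U k. lam k (c u))) =
       (\<Prod>k\<in>A. fact (card (?U k))) * (\<Prod>k\<in>A. \<Prod>u\<in>?U k. lam (f u) (c u))"
      by (simp add: prod.distrib)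
    also have "(\<Prod>k\<in>A. \<Prod>u\<in>?U k. lam (f u) (c u)) = (\<Prod>u<n. lam (f u) (c u))"
      by (rule prod.group) (use A f in auto)
    also have "(\<Prod>k\<in>A. fact (card (?U k))) = real (card (fibre_permutations f {..<n}))"
    proof -
      have "f ` {..<n} \<subseteq> A" using f by auto
      from card_fibre_permutations[OF _ A(1) this] show ?thesis by simp
    qed
    finally show ?thesis .
  qed
  have "(\<integral>\<^sup>+\<omega>. of_nat (colour_ffact (\<lambda>i. \<Sum>k\<in>A. \<omega> k i) c {..<n}) \<partial>Q) = (\<Sum>f\<in>{..<n} \<rightarrow>\<^sub>E A. \<integral>\<^sup>+\<omega>. (\<Prod>k\<in>A. ?h f k (\<omega> k)) \<partial>Q)"
    unfolding e by (rule nn_integral_sum) (rule m)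
  also have "\<dots> = (\<Sum>f\<in>{..<n} \<rightarrow>\<^sub>E A. ennreal (real (card (fibre_permutations f {..<n})) * (\<Prod>u<n. lam (f u) (c u))))"
    by (rule sum.cong[OF refl one])
  also have "\<dots> = ennreal (colour_permanent A n c lam)"
    unfolding colour_permanent_def
  proof (rule sum_ennreal)
    fix f assume f: "f \<in> {..<n} \<rightarrow>\<^sub>E A"
    have "0 \<le> (\<Prod>u<n. lam (f u) (c u))"
    proof (rule prod_nonneg)
      fix u assume "u \<in> {..<n}"
      then show "0 \<le> lam (f u) (c u)" using lam_nonneg[of "f u" "c u"] PiE_mem[OF f, of u] A c by auto
    qed
    then show "0 \<le> real (card (fibre_permutations f {..<n})) * (\<Prod>u<n. lam (f u) (c u))"
      by simp
  qed
  finally show "(\<integral>\<^sup>+\<omega>. of_nat (colour_ffact (\<lambda>i. \<Sum>k\<in>A. \<omega> k i) c {..<n}) \<partial>Q) = ennreal (colour_permanent A n c lam)" .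
qed

definition total :: "(nat \<Rightarrow> 'i \<Rightarrow> nat) \<Rightarrow> 'i \<Rightarrow> ennreal" where
  "total \<omega> i = (\<Sum>\<^sub>\<infinity>k\<in>I. of_nat (\<omega> k i))"

definition partial :: "nat \<Rightarrow> (nat \<Rightarrow> 'i \<Rightarrow> nat) \<Rightarrow> 'i \<Rightarrow> nat" where
  "partial m \<omega> i = (\<Sum>k\<in>{k\<in>I. k < m}. \<omega> k i)"

lemma total_suminf: "total \<omega> i = (\<Sum>k. if k \<in> I then of_nat (\<omega> k i) else 0)"
proof -
  have "total \<omega> i = (\<Sum>\<^sub>\<infinity>k. if k \<in> I then of_nat (\<omega> k i) else 0)"
    unfolding total_def by (rule infsum_cong_neutral) auto
  also have "\<dots> = (\<Sum>k. if k \<in> I then of_nat (\<omega> k i) else 0)"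
    by (intro sums_unique has_sum_imp_sums has_sum_infsum nonneg_summable_on_complete) auto
  finally show ?thesis .
qed

lemma total_SUP: "total \<omega> i = (SUP m. of_nat (partial m \<omega> i))"
proof -
  have "(\<Sum>k<m. if k \<in> I then of_nat (\<omega> k i) else 0) = (of_nat (partial m \<omega> i) :: ennreal)" for m
    unfolding partial_def of_nat_sum by (rule sum.mono_neutral_cong_right) auto
  then show ?thesis unfolding total_suminf suminf_eq_SUP by simp
qed

lemma total_measurable [measurable]: "(\<lambda>\<omega>. total \<omega> i) \<in> borel_measurable Q"
  unfolding total_suminf
proof (rule borel_measurable_suminf_order)
  fix k show "(\<lambda>\<omega>. if k \<in> I then of_nat (\<omega> k i) else 0 :: ennreal) \<in> borel_measurable Q"
    using measurable_coordinate[of "\<lambda>z. of_nat (z i) :: ennreal" borel k] by (cases "k \<in> I") auto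
qed

lemma partial_mono: "m \<le> m' \<Longrightarrow> partial m \<omega> i \<le> partial m' \<omega> i"
  unfolding partial_def by (rule sum_mono2) auto

text \<open>A bounded increasing sequence of natural numbers is eventually constant.\<close>

lemma total_finite_imp:
  assumes "total \<omega> i < \<top>"
  shows "\<forall>\<^sub>F m in sequentially. partial m \<omega> i = ennreal_count (total \<omega> i)"
    and "total \<omega> i = of_nat (ennreal_count (total \<omega> i))"
proof -
  obtain N :: nat where N: "total \<omega> i < of_nat N"
    using assms ennreal_Ex_less_of_nat[of "total \<omega> i"] by (auto simp: less_top)
  have "partial m \<omega> i \<le> N" for m
  proof -
    have "of_nat (partial m \<omega> i) \<le> total \<omega> i" unfolding total_SUP by (rule SUP_upper) simp
    then have "(of_nat (partial m \<omega> i) :: ennreal) \<le> of_nat N" using less_imp_le[OF N] by (rule order_trans)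
    then show ?thesis unfolding ennreal_of_nat_eq_real_of_nat by simp
  qed
  then have fin: "finite (range (\<lambda>m. partial m \<omega> i))" by (intro finite_subset[OF _ finite_atMost[of N]] image_subsetI) simp
  have "Max (range (\<lambda>m. partial m \<omega> i)) \<in> range (\<lambda>m. partial m \<omega> i)"
    by (rule Max_in[OF fin]) simp
  then obtain m0 where m0: "Max (range (\<lambda>m. partial m \<omega> i)) = partial m0 \<omega> i" by (rule imageE)
  have le: "partial m \<omega> i \<le> partial m0 \<omega> i" for m
    unfolding m0[symmetric] by (rule Max_ge[OF fin]) (rule rangeI)
  have "total \<omega> i = of_nat (partial m0 \<omega> i)"
    unfolding total_SUP by (rule antisym) (auto intro!: SUP_least SUP_upper le)
  moreover have "\<forall>\<^sub>F m in sequentially. partial m \<omega> i = partial m0 \<omega> i"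
    using eventually_ge_at_top[of m0] by eventually_elim (intro antisym le partial_mono)
  ultimately show "\<forall>\<^sub>F m in sequentially. partial m \<omega> i = ennreal_count (total \<omega> i)" "total \<omega> i = of_nat (ennreal_count (total \<omega> i))"
    by simp_all
qed

lemma moment_SUP:
  assumes c: "\<And>u. u < n \<Longrightarrow> c u \<in> R"
  shows "(\<lambda>m. ennreal (colour_permanent {k\<in>I. k < m} n c lam)) \<longlonglongrightarrow>
     (\<integral>\<^sup>+\<omega>. (SUP m. of_nat (colour_ffact (partial m \<omega>) c {..<n})) \<partial>Q)"
proof -
  have tm: "(\<integral>\<^sup>+\<omega>. of_nat (colour_ffact (partial m \<omega>) c {..<n}) \<partial>Q) = ennreal (colour_permanent {k\<in>I. k < m} n c lam)"
    "(\<lambda>\<omega>. of_nat (colour_ffact (partial m \<omega>) c {..<n}) :: ennreal) \<in> borel_measurable Q" for m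
    unfolding partial_def by (rule truncated_moment(2), simp, blast, rule c, assumption) (rule truncated_moment(1), simp, blast, rule c)
  have inc: "incseq (\<lambda>m \<omega>. of_nat (colour_ffact (partial m \<omega>) c {..<n}) :: ennreal)"
    by (auto simp: incseq_def le_fun_def intro!: colour_ffact_mono partial_mono)
  have "(\<integral>\<^sup>+\<omega>. (SUP m. of_nat (colour_ffact (partial m \<omega>) c {..<n})) \<partial>Q) = (SUP m. ennreal (colour_permanent {k\<in>I. k < m} n c lam))"
    unfolding tm(1)[symmetric] by (rule nn_integral_monotone_convergence_SUP[OF inc tm(2)])
  moreover have "incseq (\<lambda>m. ennreal (colour_permanent {k\<in>I. k < m} n c lam))"
    unfolding tm(1)[symmetric] by (intro incseq_SucI nn_integral_mono) (auto intro!: colour_ffact_mono partial_mono)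
  ultimately show ?thesis by (simp add: LIMSEQ_SUP)
qed

lemma total_finite:
  assumes bound: "\<And>i m. i \<in> R \<Longrightarrow> (\<Sum>k\<in>{k\<in>I. k < m}. lam k i) \<le> L" and i: "i \<in> R"
  shows "AE \<omega> in Q. total \<omega> i < \<top>"
proof -
  have cp: "colour_permanent {k\<in>I. k < m} 1 (\<lambda>_. i) lam \<le> L ^ 1 * fact 1" for m
    by (rule colour_permanent_le[where R = R]) (use lam_nonneg i bound in auto)
  have cf: "colour_ffact y (\<lambda>_. i) {..<1::nat} = y i" for y :: "'i \<Rightarrow> nat"
  proof -
    have "{..<1::nat} = {0}" by auto
    then show ?thesis by (simp add: colour_ffact_def ffact_def)
  qed
  have "(\<integral>\<^sup>+\<omega>. total \<omega> i \<partial>Q) \<le> ennreal L"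
    unfolding total_SUP cf[symmetric]
    by (rule LIMSEQ_le_const2[OF moment_SUP]) (use i cp in \<open>auto intro!: ennreal_leI exI[of _ 0]\<close>)
  then have "(\<integral>\<^sup>+\<omega>. total \<omega> i \<partial>Q) \<noteq> \<infinity>" by (auto simp: top_unique)
  then have "AE \<omega> in Q. total \<omega> i \<noteq> \<infinity>" by (rule nn_integral_noteq_infinite[rotated]) simp
  then show ?thesis by eventually_elim (simp add: less_top)
qed

text \<open>Monotone convergence for the partial sums, whose falling factorials are eventually those of the
  total.\<close>

lemma moment_tendsto:
  assumes bound: "\<And>i m. i \<in> R \<Longrightarrow> (\<Sum>k\<in>{k\<in>I. k < m}. lam k i) \<le> L"
    and c: "\<And>u. u < n \<Longrightarrow> c u \<in> R"
  shows "(\<lambda>m. ennreal (colour_permanent {k\<in>I. k < m} n c lam)) \<longlonglongrightarrow>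
     (\<integral>\<^sup>+\<omega>. of_nat (colour_ffact (\<lambda>i. ennreal_count (total \<omega> i)) c {..<n}) \<partial>Q)"
proof -
  have "AE \<omega> in Q. \<forall>i\<in>R. total \<omega> i < \<top>"
    using R total_finite[OF bound] by (subst AE_ball_countable) (auto simp: countable_finite)
  then have ae: "AE \<omega> in Q. (SUP m. of_nat (colour_ffact (partial m \<omega>) c {..<n})) = (of_nat (colour_ffact (\<lambda>i. ennreal_count (total \<omega> i)) c {..<n}) :: ennreal)"
  proof eventually_elim
    case (elim \<omega>)
    have "\<forall>\<^sub>F m in sequentially. \<forall>i\<in>R. partial m \<omega> i = ennreal_count (total \<omega> i)"
      using R elim total_finite_imp(1) by (simp add: eventually_ball_finite)
    then have "\<forall>\<^sub>F m in sequentially. of_nat (colour_ffact (partial m \<omega>) c {..<n}) = (of_nat (colour_ffact (\<lambda>i. ennreal_count (total \<omega> i)) c {..<n}) :: ennreal)"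
      by eventually_elim (use c in \<open>auto intro!: arg_cong[where f = of_nat] colour_ffact_cong\<close>)
    then have "(\<lambda>m. of_nat (colour_ffact (partial m \<omega>) c {..<n}) :: ennreal) \<longlonglongrightarrow> of_nat (colour_ffact (\<lambda>i. ennreal_count (total \<omega> i)) c {..<n})"
      by (rule tendsto_eventually)
    moreover have "(\<lambda>m. of_nat (colour_ffact (partial m \<omega>) c {..<n}) :: ennreal) \<longlonglongrightarrow> (SUP m. of_nat (colour_ffact (partial m \<omega>) c {..<n}))"
      by (rule LIMSEQ_SUP) (auto simp: incseq_def intro!: colour_ffact_mono partial_mono)
    ultimately show ?case by (rule LIMSEQ_unique[rotated])
  qed
  show ?thesis using moment_SUP[where n = n and c = c, OF c] unfolding nn_integral_cong_AE[OF ae] .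
qed

lemma geometric_total:
  assumes k: "k \<in> I"
  shows "measure Q {\<omega>\<in>space Q. (\<Sum>i\<in>R. \<omega> k i) = s} =
     ((\<Sum>i\<in>R. lam k i) / ((\<Sum>i\<in>R. lam k i) + 1)) ^ s * (1 / ((\<Sum>i\<in>R. lam k i) + 1))"
  using measure_coordinate[OF k, of "{n. (\<Sum>i\<in>R. n i) = s}"]
    measure_geometric_multinomial_total[OF R colour_pmf(2)[OF R lam_nonneg[OF k] lam_pos[OF k]] lam_pos[OF k], of s]
  by (simp add: law_def)

lemma multinomial_conditional:
  assumes k: "k \<in> I" and N: "(\<Sum>i\<in>R. n i) = N"
  shows "measure Q {\<omega>\<in>space Q. \<forall>i\<in>R. \<omega> k i = n i} =
     measure Q {\<omega>\<in>space Q. (\<Sum>i\<in>R. \<omega> k i) = N} *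
       (fact N / (\<Prod>i\<in>R. fact (n i)) * (\<Prod>i\<in>R. (lam k i / (\<Sum>j\<in>R. lam k j)) ^ n i))"
proof -
  have "(\<Prod>i\<in>R. pmf (colour_pmf R (lam k)) i ^ n i) = (\<Prod>i\<in>R. (lam k i / (\<Sum>j\<in>R. lam k j)) ^ n i)"
    by (rule prod.cong) (use colour_pmf(1)[OF R lam_nonneg[OF k] lam_pos[OF k]] in auto)
  then show ?thesis
    unfolding geometric_total[OF k]
    using measure_coordinate[OF k, of "{x. \<forall>i\<in>R. x i = n i}"]
      measure_geometric_multinomial_point[OF R colour_pmf(2)[OF R lam_nonneg[OF k] lam_pos[OF k]] lam_pos[OF k] N]
    by (simp add: law_def)
qed

end

section \<open>Law of the counts in simultaneously observable sets\<close>

theorem theorem12: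
  fixes \<mu> :: "'a::polish_space measure"
    and P :: "'w measure"
    and X :: "'w \<Rightarrow> 'a measure"
    and K :: "'a \<Rightarrow> 'a \<Rightarrow> complex"
    and r :: nat
    and D :: "nat \<Rightarrow> 'a set"
    and I :: "nat set"
    and \<phi> :: "nat \<Rightarrow> 'a \<Rightarrow> complex"
    and lam :: "nat \<Rightarrow> nat \<Rightarrow> real"
  assumes "locally compact (UNIV :: 'a set)"
    and "radon_measure \<mu>"
    and "point_process P X"
    and "permanental P \<mu> X K"
    and "bounded_kernel \<mu> K"
    and "selfadjoint_kernel \<mu> K"
    and "nonneg_kernel \<mu> K"
    and "trace_class_nonneg_kernel \<mu> K"
    and "kernel_expansion \<mu> K"
    and "\<And>i. i \<in> {1..r} \<Longrightarrow> D i \<in> sets borel"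
    and "disjoint_family_on D {1..r}"
    and "simultaneously_observable \<mu> K r D I \<phi> lam"
  shows "\<exists>(Q :: (nat \<Rightarrow> nat \<Rightarrow> nat) measure) (\<eta> :: nat \<Rightarrow> nat \<Rightarrow> (nat \<Rightarrow> nat \<Rightarrow> nat) \<Rightarrow> nat).
    prob_space Q \<and>
    prob_space.indep_vars Q (\<lambda>k. PiM {1..r} (\<lambda>i. count_space UNIV))
      (\<lambda>k \<omega>. \<lambda>i\<in>{1..r}. \<eta> k i \<omega>) I \<and>
    (\<forall>k\<in>I. \<forall>s::nat. \<P>(\<omega> in Q. (\<Sum>i=1..r. \<eta> k i \<omega>) = s) =
       ((\<Sum>i=1..r. lam k i) / ((\<Sum>i=1..r. lam k i) + 1)) ^ s * (1 / ((\<Sum>i=1..r. lam k i) + 1))) \<and>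
    (\<forall>k\<in>I. \<forall>(N::nat) (n :: nat \<Rightarrow> nat).
       \<P>(\<omega> in Q. (\<forall>i\<in>{1..r}. \<eta> k i \<omega> = n i) \<bar> (\<Sum>i=1..r. \<eta> k i \<omega>) = N) =
       multinomial_prob r N (\<lambda>i. lam k i / (\<Sum>j=1..r. lam k j)) n) \<and>
    distr P (PiM {1..r} (\<lambda>i. borel :: ennreal measure)) (\<lambda>\<omega>. \<lambda>i\<in>{1..r}. emeasure (X \<omega>) (D i)) =
    distr Q (PiM {1..r} (\<lambda>i. borel :: ennreal measure))
      (\<lambda>\<omega>. \<lambda>i\<in>{1..r}. \<Sum>\<^sub>\<infinity>k\<in>I. of_nat (\<eta> k i \<omega>))"
proof -
  let ?R = "{1..r}"
  have sets: "sets \<mu> = sets borel" using assms(2) by (simp add: radon_measure_def)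
  have sp: "space \<mu> = UNIV" using sets_eq_imp_space_eq[OF sets] by simp
  have D\<mu>: "D i \<in> sets \<mu>" if "i \<in> ?R" for i using assms(10)[OF that] sets by simp
  have R: "finite ?R" by simp
  have DR: "(\<Union>i\<in>?R. D i) \<in> sets \<mu>" using D\<mu> by (intro sets.finite_UN) auto
  interpret P: prob_space P using assms(3) by (simp add: point_process_def)
  from assms(12) obtain \<alpha> where sys: "nonzero_eigensystem \<mu> (\<Union>i\<in>?R. D i) K I \<phi> \<alpha>"
    and orth: "\<And>i k l. i \<in> ?R \<Longrightarrow> k \<in> I \<Longrightarrow> l \<in> I \<Longrightarrow> k \<noteq> l \<Longrightarrow> L2_inner \<mu> (D i) (\<phi> k) (\<phi> l) = 0"
    and eig: "\<And>i k. i \<in> ?R \<Longrightarrow> k \<in> I \<Longrightarrow> (AE x in \<mu>. x \<in> D i \<longrightarrow> \<phi> k x = 0) \<and> lam k i = 0 \<or>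
        eigenfunction \<mu> (D i) K (complex_of_real (lam k i)) (\<phi> k)"
    unfolding simultaneously_observable_def by blast
  obtain N a g where "kernel_eigen_expansion \<mu> (\<Union>i\<in>?R. D i) K I \<phi> N a g"
    using restricted_kernel_expansion[OF assms(5-9) DR sp sys] by blast
  then interpret B: kernel_eigen_expansion \<mu> "\<Union>i\<in>?R. D i" K I \<phi> N a g .
  interpret B: common_eigenfunctions \<mu> D ?R K I \<phi> N a g lam
  proof (rule common_eigenfunctions.intro[OF B.kernel_eigen_expansion_axioms common_eigenfunctions_axioms.intro])
    show "sigma_finite_measure \<mu>" by (rule sigma_finite_radon[OF assms(1,2)])
    show "L2_orthonormal \<mu> (\<Union>i\<in>?R. D i) I \<phi>" using sys by (simp add: nonzero_eigensystem_def)
  qed (fact R D\<mu> assms(11) orth eig)+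
  have lam_nonneg: "0 \<le> lam k i" if "k \<in> I" "i \<in> ?R" for k i
    using B.lam_eq[OF that(2,1)] B.a_pos[OF that(1)] by simp
  interpret G: geometric_multinomial_family I ?R lam
    by unfold_locales (use lam_nonneg B.sum_lam B.a_pos in auto)
  \<comment> \<open>the summand \<open>1\<close> makes \<open>L\<close> positive even if there are no eigenfunctions\<close>
  define L where "L = (\<Sum>k. if k \<in> I then a k else 0) + 1"
  have a0: "0 \<le> (if k \<in> I then a k else 0)" for k using B.a_pos[of k] by auto
  have L: "L > 0" unfolding L_def by (intro add_nonneg_pos suminf_nonneg B.a_summable a0) simp
  have bound: "(\<Sum>k\<in>{k\<in>I. k < m}. lam k i) \<le> L" if i: "i \<in> ?R" for i m
  proof -
    have "(\<Sum>k\<in>{k\<in>I. k < m}. lam k i) \<le> (\<Sum>k\<in>{k\<in>I. k < m}. a k)"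
    proof (rule sum_mono)
      fix k assume "k \<in> {k\<in>I. k < m}"
      then have k: "k \<in> I" by simp
      have "lam k i \<le> (\<Sum>j\<in>?R. lam k j)" by (rule member_le_sum) (use i lam_nonneg[OF k] in auto)
      then show "lam k i \<le> a k" using B.sum_lam[OF k] by simp
    qed
    also have "\<dots> = (\<Sum>k<m. if k \<in> I then a k else 0)"
      by (rule sum.mono_neutral_cong_left) auto
    also have "\<dots> \<le> (\<Sum>k. if k \<in> I then a k else 0)"
      by (rule sum_le_suminf[OF B.a_summable]) (use a0 in auto)
    finally show ?thesis by (simp add: L_def)
  qed
  have cp: "colour_permanent {k\<in>I. k < m} n c lam \<le> L ^ n * fact n" if "\<And>u. u < n \<Longrightarrow> c u \<in> ?R" for n c m
    by (rule colour_permanent_le[where R = ?R]) (use lam_nonneg bound that in auto)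
  from assms(4) obtain \<rho> where ji: "joint_intensities P \<mu> X \<rho>"
    and per: "\<And>m. m \<ge> 1 \<Longrightarrow> AE x in PiM {..<m} (\<lambda>_. \<mu>). complex_of_real (\<rho> m x) = per m (\<lambda>i j. K (x i) (x j))"
    by (auto simp: permanental_def)
  have \<rho>: "\<rho> n \<in> borel_measurable (PiM {..<n} (\<lambda>_. \<mu>))" "\<And>x. x \<in> space (PiM {..<n} (\<lambda>_. \<mu>)) \<Longrightarrow> 0 \<le> \<rho> n x" if "n \<ge> 1" for n
    using ji that by (auto simp: joint_intensities_def)
  have lim: "(\<lambda>m. ennreal (colour_permanent {k\<in>I. k < m} n c lam)) \<longlonglongrightarrow>
      (\<integral>\<^sup>+x\<in>{x. \<forall>u<n. x u \<in> D (c u)}. ennreal (\<rho> n x) \<partial>PiM {..<n} (\<lambda>_. \<mu>))"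
    if "n \<ge> 1" "\<And>u. u < n \<Longrightarrow> c u \<in> ?R" for n c
    using B.block_integral_tendsto[of n c "\<rho> n", OF that(2) \<rho>[OF that(1)] per[OF that(1)]] by (simp add: B.trunc_def)
  define Xn where "Xn \<omega> i = ennreal_count (emeasure (X \<omega>) (D i))" for \<omega> i
  define Yn where "Yn \<omega> i = ennreal_count (G.total \<omega> i)" for \<omega> i
  have Xm: "(\<lambda>\<omega>. emeasure (X \<omega>) (D i)) \<in> borel_measurable P" if "i \<in> ?R" for i
    using assms(3) assms(10)[OF that] by (simp add: point_process_def)
  have Xfin: "AE \<omega> in P. emeasure (X \<omega>) (D i) = of_nat (Xn \<omega> i)" if i: "i \<in> ?R" for i
  proof -
    have nat: "\<exists>n. emeasure (X \<omega>) (D i) = ennreal_of_enat n" if "\<omega> \<in> space P" for \<omega>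
      using assms(3) assms(10)[OF i] that by (auto simp: point_process_def)
    have fi: "(\<integral>\<^sup>+\<omega>. emeasure (X \<omega>) (D i) \<partial>P) = (\<integral>\<^sup>+x\<in>{x. \<forall>u<1. x u \<in> D i}. ennreal (\<rho> 1 x) \<partial>PiM {..<1} (\<lambda>_. \<mu>))"
      by (rule first_intensity[OF ji assms(10)[OF i]]) (rule nat)
    have lim1: "(\<lambda>m. ennreal (colour_permanent {k\<in>I. k < m} 1 (\<lambda>_. i) lam)) \<longlonglongrightarrow>
        (\<integral>\<^sup>+x\<in>{x. \<forall>u<1. x u \<in> D i}. ennreal (\<rho> 1 x) \<partial>PiM {..<1} (\<lambda>_. \<mu>))"
      by (rule lim) (use i in auto)
    have le1: "ennreal (colour_permanent {k\<in>I. k < m} 1 (\<lambda>_. i) lam) \<le> ennreal (L ^ 1 * fact 1)" for m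
      by (intro ennreal_leI cp) (rule i)
    have "(\<integral>\<^sup>+\<omega>. emeasure (X \<omega>) (D i) \<partial>P) \<le> ennreal (L ^ 1 * fact 1)"
      unfolding fi by (rule LIMSEQ_le_const2[OF lim1]) (intro exI[of _ 0] allI impI le1)
    then have "(\<integral>\<^sup>+\<omega>. emeasure (X \<omega>) (D i) \<partial>P) \<noteq> \<infinity>" by (auto simp: top_unique)
    then have "AE \<omega> in P. emeasure (X \<omega>) (D i) \<noteq> \<infinity>"
      by (rule nn_integral_noteq_infinite[OF Xm[OF i]])
    then show ?thesis using AE_space
    proof eventually_elim
      case (elim \<omega>)
      then obtain n where n: "emeasure (X \<omega>) (D i) = ennreal_of_enat n" using nat by auto
      then obtain k where "emeasure (X \<omega>) (D i) = of_nat k" using elim by (cases n) auto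
      then show ?case by (simp add: Xn_def)
    qed
  qed
  have Yfin: "AE \<omega> in G.Q. G.total \<omega> i = of_nat (Yn \<omega> i)" if i: "i \<in> ?R" for i
  proof -
    have "AE \<omega> in G.Q. G.total \<omega> i < \<top>"
      by (rule G.total_finite[where L = L]) (fact bound i)+
    then show ?thesis unfolding Yn_def by eventually_elim (rule G.total_finite_imp(2))
  qed
  have moments: "(\<integral>\<^sup>+\<omega>. (\<Prod>i\<in>?R. of_nat (ffact (Xn \<omega> i) (m i))) \<partial>P) = (\<integral>\<^sup>+\<omega>. (\<Prod>i\<in>?R. of_nat (ffact (Yn \<omega> i) (m i))) \<partial>G.Q) \<and>
     (\<integral>\<^sup>+\<omega>. (\<Prod>i\<in>?R. of_nat (ffact (Yn \<omega> i) (m i))) \<partial>G.Q) \<le> ennreal (L ^ (\<Sum>i\<in>?R. m i) * fact (\<Sum>i\<in>?R. m i))" for m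
  proof (cases "(\<Sum>i\<in>?R. m i) \<ge> 1")
    case True
    let ?n = "\<Sum>i\<in>?R. m i"
    have "\<exists>c. (\<forall>u<?n. c u \<in> ?R) \<and> (\<forall>i\<in>?R. card {u. u < ?n \<and> c u = i} = m i) \<and>
      (\<integral>\<^sup>+\<omega>. (\<Prod>i\<in>?R. of_nat (ffact (Xn \<omega> i) (m i))) \<partial>P) =
      (\<integral>\<^sup>+x\<in>{x. \<forall>u<?n. x u \<in> D (c u)}. ennreal (\<rho> ?n x) \<partial>PiM {..<?n} (\<lambda>_. \<mu>))"
      by (rule joint_intensities_moment) (fact ji R assms(10) assms(11) Xfin True)+
    then obtain c where c': "\<forall>u<?n. c u \<in> ?R" "\<forall>i\<in>?R. card {u. u < ?n \<and> c u = i} = m i"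
      and int: "(\<integral>\<^sup>+\<omega>. (\<Prod>i\<in>?R. of_nat (ffact (Xn \<omega> i) (m i))) \<partial>P) =
      (\<integral>\<^sup>+x\<in>{x. \<forall>u<?n. x u \<in> D (c u)}. ennreal (\<rho> ?n x) \<partial>PiM {..<?n} (\<lambda>_. \<mu>))"
      by blast
    have c: "c u \<in> ?R" if "u < ?n" for u using c' that by simp
    have pf: "(\<Prod>i\<in>?R. of_nat (ffact (y i) (m i))) = (of_nat (colour_ffact y c {..<?n}) :: ennreal)" for y
      by (rule prod_ffact_eq_colour_ffact) (use c' in auto)
    have Y: "(\<lambda>m. ennreal (colour_permanent {k\<in>I. k < m} ?n c lam)) \<longlonglongrightarrow> (\<integral>\<^sup>+\<omega>. (\<Prod>i\<in>?R. of_nat (ffact (Yn \<omega> i) (m i))) \<partial>G.Q)"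
      unfolding pf Yn_def by (rule G.moment_tendsto) (fact bound c)+
    \<comment> \<open>both moments are limits of the same sequence\<close>
    have X: "(\<lambda>m. ennreal (colour_permanent {k\<in>I. k < m} ?n c lam)) \<longlonglongrightarrow> (\<integral>\<^sup>+\<omega>. (\<Prod>i\<in>?R. of_nat (ffact (Xn \<omega> i) (m i))) \<partial>P)"
      unfolding int by (rule lim) (fact True c)+
    have cpl: "ennreal (colour_permanent {k\<in>I. k < m'} ?n c lam) \<le> ennreal (L ^ ?n * fact ?n)" for m'
      by (intro ennreal_leI cp) (rule c)
    have "(\<integral>\<^sup>+\<omega>. (\<Prod>i\<in>?R. of_nat (ffact (Yn \<omega> i) (m i))) \<partial>G.Q) \<le> ennreal (L ^ ?n * fact ?n)"
      by (rule LIMSEQ_le_const2[OF Y]) (intro exI[of _ 0] allI impI cpl)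
    with LIMSEQ_unique[OF X Y] show ?thesis by (intro conjI)
  next
    case False
    then have m0: "(\<Sum>i\<in>?R. m i) = 0" by linarith
    then have "m i = 0" if "i \<in> ?R" for i using that by simp
    then have p1: "(\<Prod>i\<in>?R. of_nat (ffact (y i) (m i))) = (1 :: ennreal)" for y
      by (intro prod.neutral) simp
    show ?thesis unfolding p1 m0 nn_integral_const P.emeasure_space_1 G.Q.emeasure_space_1 by simp
  qed
  have masses: "emeasure P {\<omega>\<in>space P. \<forall>i\<in>?R. Xn \<omega> i = n i} = emeasure G.Q {\<omega>\<in>space G.Q. \<forall>i\<in>?R. Yn \<omega> i = n i}" for n
  proof (rule mixed_factorial_moments_determine[OF R _ _ _ _ L])
    show "(\<lambda>\<omega>. Xn \<omega> i) \<in> measurable P (count_space UNIV)" if "i \<in> ?R" for i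
      unfolding Xn_def by (rule measurable_compose[OF Xm[OF that] measurable_ennreal_count])
    show "(\<lambda>\<omega>. Yn \<omega> i) \<in> measurable G.Q (count_space UNIV)" for i
      unfolding Yn_def by (rule measurable_compose[OF G.total_measurable measurable_ennreal_count])
  qed (use moments in blast)+
  have law: "distr P (PiM ?R (\<lambda>_. borel)) (\<lambda>\<omega>. \<lambda>i\<in>?R. emeasure (X \<omega>) (D i)) = distr G.Q (PiM ?R (\<lambda>_. borel)) (\<lambda>\<omega>. \<lambda>i\<in>?R. G.total \<omega> i)"
  proof (rule distr_eq_of_point_masses[OF R _ _ _ _ _ _ masses])
    show "(\<lambda>\<omega>. Xn \<omega> i) \<in> measurable P (count_space UNIV)" if "i \<in> ?R" for i
      unfolding Xn_def by (rule measurable_compose[OF Xm[OF that] measurable_ennreal_count])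
    show "(\<lambda>\<omega>. Yn \<omega> i) \<in> measurable G.Q (count_space UNIV)" for i
      unfolding Yn_def by (rule measurable_compose[OF G.total_measurable measurable_ennreal_count])
    show "(\<lambda>\<omega>. G.total \<omega> i) \<in> borel_measurable G.Q" for i by (rule G.total_measurable)
  qed (fact Xm Xfin Yfin)+
  show ?thesis
  proof (rule exI[of _ G.Q], rule exI[of _ "\<lambda>k i \<omega>. \<omega> k i"], intro conjI ballI allI)
    show "prob_space G.Q" by (rule G.Q.prob_space_axioms)
    show "G.Q.indep_vars (\<lambda>k. PiM ?R (\<lambda>i. count_space UNIV)) (\<lambda>k \<omega>. \<lambda>i\<in>?R. \<omega> k i) I"
      by (rule G.indep_coordinates)
    show "\<P>(\<omega> in G.Q. (\<Sum>i=1..r. \<omega> k i) = s) =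
       ((\<Sum>i=1..r. lam k i) / ((\<Sum>i=1..r. lam k i) + 1)) ^ s * (1 / ((\<Sum>i=1..r. lam k i) + 1))" if "k \<in> I" for k s
      by (rule G.geometric_total[OF that])
    show "\<P>(\<omega> in G.Q. (\<forall>i\<in>{1..r}. \<omega> k i = n i) \<bar> (\<Sum>i=1..r. \<omega> k i) = M) =
       multinomial_prob r M (\<lambda>i. lam k i / (\<Sum>j=1..r. lam k j)) n" if k: "k \<in> I" for k M n
    proof (cases "(\<Sum>i=1..r. n i) = M")
      case True
      have se: "{\<omega>\<in>space G.Q. (\<forall>i\<in>{1..r}. \<omega> k i = n i) \<and> (\<Sum>i=1..r. \<omega> k i) = M} = {\<omega>\<in>space G.Q. \<forall>i\<in>{1..r}. \<omega> k i = n i}"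
        using True by auto
      have nz: "measure G.Q {\<omega>\<in>space G.Q. (\<Sum>i=1..r. \<omega> k i) = M} \<noteq> 0"
        unfolding G.geometric_total[OF k] using G.lam_pos[OF k] by simp
      show ?thesis
        unfolding cond_prob_def se G.multinomial_conditional[OF k True] nonzero_mult_div_cancel_left[OF nz]
          multinomial_prob_def if_P[OF True] ..
    next
      case False
      then have em: "{\<omega>\<in>space G.Q. (\<forall>i\<in>{1..r}. \<omega> k i = n i) \<and> (\<Sum>i=1..r. \<omega> k i) = M} = {}"
        by auto
      show ?thesis
        unfolding cond_prob_def em multinomial_prob_def if_not_P[OF False] by simp
    qed
    show "distr P (PiM {1..r} (\<lambda>i. borel :: ennreal measure)) (\<lambda>\<omega>. \<lambda>i\<in>{1..r}. emeasure (X \<omega>) (D i)) =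
      distr G.Q (PiM {1..r} (\<lambda>i. borel :: ennreal measure)) (\<lambda>\<omega>. \<lambda>i\<in>{1..r}. \<Sum>\<^sub>\<infinity>k\<in>I. of_nat (\<omega> k i))"
      using law unfolding G.total_def .
  qed
qed

end
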